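(* Let $a\in\mathbb{R}$ be a constant and set $u_0(x_1,x_2)=\frac{a}{2}(x_2,-x_1)$. Let $(u,\pi)$ be a smooth solution in $\Omega=\mathbb{R}^2\setminus\overline{B_1}$ of the stationary Navier-Stokes equations $$u\cdot\nabla u+\nabla\pi=\Delta u,\qquad \operatorname{div}u=0\quad\text{in }\Omega,$$ with $u\in C^1(\overline{\Omega})$ and $$u|_{\partial B_1}=\tfrac{a}{2}(x_2,-x_1)|_{\partial B_1}.$$ Let $v=u-u_0$ and suppose that $v\in L^q(\Omega)$ for some $q$ with $1<q\le 2$. Then $u\equiv u_0$ in $\Omega$.
   Context: $B_1$ is the open disk of radius $1$ centered at the origin of $\mathbb{R}^2$. Here $u=(u_1,u_2):\Omega\to\mathbb{R}^2$ is the velocity and $\pi:\Omega\to\mathbb{R}$ is the pressure; $u\cdot\nabla u$ is the vector field with components $\sum_{i=1}^2 u_i\partial_i u_j$, $j=1,2$. *)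

theory Defs
  imports "HOL-Analysis.Analysis"
begin

definition partial_deriv :: "'n::finite \<Rightarrow> (real^'n \<Rightarrow> 'b::real_normed_vector) \<Rightarrow> real^'n \<Rightarrow> 'b"
  where "partial_deriv i f x = frechet_derivative f (at x) (axis i 1)"

(* The next three notions are meant for open S.  Then differentiable_on amounts to
   differentiability at each point of S, so partial_deriv takes its intended value there. *)

primrec Ck_on :: "nat \<Rightarrow> (real^'n::finite \<Rightarrow> 'b::real_normed_vector) \<Rightarrow> (real^'n) set \<Rightarrow> bool"
  where
    "Ck_on 0 f S \<longleftrightarrow> continuous_on S f"
  | "Ck_on (Suc k) f S \<longleftrightarrow> f differentiable_on S \<and> (\<forall>i. Ck_on k (partial_deriv i f) S)"

definition smooth_on :: "(real^'n::finite \<Rightarrow> 'b::real_normed_vector) \<Rightarrow> (real^'n) set \<Rightarrow> bool"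
  where "smooth_on f S \<longleftrightarrow> (\<forall>k. Ck_on k f S)"

(* The space C^1(closure S): f is C^1 in S, and f and its first partial derivatives extend
   continuously to closure S.  The values of f on the boundary are those of its extension.
   No boundedness or uniform continuity is required when S is unbounded. *)
definition C1_closure :: "(real^'n::finite \<Rightarrow> 'b::real_normed_vector) \<Rightarrow> (real^'n) set \<Rightarrow> bool"
  where "C1_closure f S \<longleftrightarrow>
    Ck_on 1 f S \<and> continuous_on (closure S) f \<and>
    (\<forall>i. \<exists>g. continuous_on (closure S) g \<and> (\<forall>x\<in>S. g x = partial_deriv i f x))"

(* f belongs to L^q(S) with respect to Lebesgue measure; meant for 0 < q < infinity. *)
definition in_Lq :: "real \<Rightarrow> (real^'n::finite) set \<Rightarrow> (real^'n \<Rightarrow> 'b::euclidean_space) \<Rightarrow> bool"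
  where "in_Lq q S f \<longleftrightarrow>
    set_borel_measurable lebesgue S f \<and> set_integrable lebesgue S (\<lambda>x. norm (f x) powr q)"

definition gradient :: "(real^'n::finite \<Rightarrow> real) \<Rightarrow> real^'n \<Rightarrow> real^'n"
  where "gradient p x = (\<chi> j. partial_deriv j p x)"

definition divergence :: "(real^'n::finite \<Rightarrow> real^'n) \<Rightarrow> real^'n \<Rightarrow> real"
  where "divergence u x = (\<Sum>i\<in>UNIV. partial_deriv i (\<lambda>y. u y $ i) x)"

definition vector_laplacian :: "(real^'n::finite \<Rightarrow> real^'n) \<Rightarrow> real^'n \<Rightarrow> real^'n"
  where "vector_laplacian u x =
    (\<chi> j. \<Sum>i\<in>UNIV. partial_deriv i (partial_deriv i (\<lambda>y. u y $ j)) x)"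

definition convection :: "(real^'n::finite \<Rightarrow> real^'n) \<Rightarrow> real^'n \<Rightarrow> real^'n"
  where "convection u x = (\<chi> j. \<Sum>i\<in>UNIV. u x $ i * partial_deriv i (\<lambda>y. u y $ j) x)"

definition stationary_NS_on ::
    "(real^'n::finite) set \<Rightarrow> (real^'n \<Rightarrow> real^'n) \<Rightarrow> (real^'n \<Rightarrow> real) \<Rightarrow> bool"
  where "stationary_NS_on S u p \<longleftrightarrow>
    (\<forall>x\<in>S. convection u x + gradient p x = vector_laplacian u x \<and> divergence u x = 0)"

definition rotating_flow :: "real \<Rightarrow> real^2 \<Rightarrow> real^2"
  where "rotating_flow a x = (a / 2) *\<^sub>R vector [x $ 2, - (x $ 1)]"

definition exterior_disk :: "(real^2) set"
  where "exterior_disk = UNIV - closure (ball 0 1)"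

end

theory Submission
  imports Defs
begin

text \<open>
Write v for the difference of u and the rotating flow u0. The term (u0.grad) u0 is a gradient and
goes into the pressure, so that v is divergence free, vanishes on the unit circle and solves
(v.grad) v + (u0.grad) v + (v.grad) u0 + grad P = Laplace v. The equation is tested with a cut-off
multiple of v. Derivatives along u0 are derivatives along circles and do not see a radial
cut-off, and the matrix grad u0 is antisymmetric; hence the linear growth of u0 does no harm,
and the rotation speed a may be large.

The pressure is not controlled, neither at infinity nor at the circle, so the test field must be
divergence free. Let eta be a radial cut-off with gradient k x, let J be the rotation by a right angle
and let the function h solve (J x.grad) h = - x.v. Then eta v + k h J x is divergence free, whatever
eta is. Such an h exists because the flux of v through every circle is zero (flux_eq_0); it is the
stream function of v minus its mean over circles, and an explicit circle integral of x.v (h_C1).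
As the mean is removed on each circle separately, h is bounded by r times an integral of |v| over
the same circle (h_le_V), whatever the stream function does at infinity. The outcome is energy_identity: the integral of eta |grad v|^2 + Q is zero, with
an error Q that is supported where eta varies.

Near the circle, in a layer of width delta, |v| is O(delta) and |h| is O(delta^2). So Q is bounded
there, and the area of the layer is O(delta). Far out, at distance R, half of the dissipation
absorbs the terms of Q that contain grad v, and what remains is a weighted integral of
|v|^2 + |v|^3 (energy_inequality). As 1 < q and q \<le> 2, the exponents 2 and 3 lie between q and
q + 2. Gagliardo's inequality for |v|^(1 + q/2) bounds the integral of |v|^(q + 2) by the
dissipation times the integral of |v|^q over a far annulus (sobolev_step). The latter tends to zero
because v is in L^q, and then the dissipation is absorbed. Since the derivatives of a cut-off are
not bounded by the cut-off itself, eta is taken to be a high power of a cut-off, the exponent growing as q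
approaches 1 (powr_interpolation). In the limit grad v = 0, so v is constant along rays, and it is
zero on the circle.
\<close>

section \<open>Functions of two variables with continuous gradient\<close>

text \<open>Partial derivatives are carried along as explicit functions, so that the product rule
  can compute them symbolically.\<close>

definition C1_grad :: "(real^2) set \<Rightarrow> (real^2 \<Rightarrow> real) \<Rightarrow> (real^2 \<Rightarrow> real) \<Rightarrow> (real^2 \<Rightarrow> real) \<Rightarrow> bool"
  where "C1_grad S f f1 f2 \<longleftrightarrow>
    (\<forall>x\<in>S. (f has_derivative (\<lambda>d. f1 x * d $ 1 + f2 x * d $ 2)) (at x)) \<and>
    continuous_on S f1 \<and> continuous_on S f2"

lemma C1_gradD:
  assumes "C1_grad S f f1 f2"
  shows "x \<in> S \<Longrightarrow> (f has_derivative (\<lambda>d. f1 x * d $ 1 + f2 x * d $ 2)) (at x)"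
    and "continuous_on S f1" "continuous_on S f2" "continuous_on S f"
proof -
  show d: "(f has_derivative (\<lambda>d. f1 x * d $ 1 + f2 x * d $ 2)) (at x)" if "x \<in> S" for x
    using assms that by (auto simp: C1_grad_def)
  show "continuous_on S f1" "continuous_on S f2" using assms by (auto simp: C1_grad_def)
  show "continuous_on S f"
    by (meson continuous_at_imp_continuous_on d has_derivative_continuous)
qed

lemma C1_grad_const: "C1_grad S (\<lambda>x. c) (\<lambda>x. 0) (\<lambda>x. 0)"
  by (auto simp: C1_grad_def)

lemma has_derivative_vec_nth: "((\<lambda>x::real^'n. x $ i) has_derivative (\<lambda>d. d $ i)) F"
  by (rule bounded_linear.has_derivative[OF bounded_linear_vec_nth]) (rule has_derivative_ident)

lemma C1_grad_coord:
  "C1_grad S (\<lambda>x. x $ 1) (\<lambda>x. 1) (\<lambda>x. 0)" "C1_grad S (\<lambda>x. x $ 2) (\<lambda>x. 0) (\<lambda>x. 1)"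
  by (auto simp: C1_grad_def has_derivative_vec_nth)

lemma C1_grad_add:
  assumes "C1_grad S f f1 f2" "C1_grad S g g1 g2"
  shows "C1_grad S (\<lambda>x. f x + g x) (\<lambda>x. f1 x + g1 x) (\<lambda>x. f2 x + g2 x)"
  using assms unfolding C1_grad_def
  by (auto intro!: continuous_intros has_derivative_eq_rhs[OF has_derivative_add]
      simp: fun_eq_iff algebra_simps)

lemma C1_grad_diff:
  assumes "C1_grad S f f1 f2" "C1_grad S g g1 g2"
  shows "C1_grad S (\<lambda>x. f x - g x) (\<lambda>x. f1 x - g1 x) (\<lambda>x. f2 x - g2 x)"
  using assms unfolding C1_grad_def
  by (auto intro!: continuous_intros has_derivative_eq_rhs[OF has_derivative_diff]
      simp: fun_eq_iff algebra_simps)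

lemma C1_grad_mult:
  assumes "C1_grad S f f1 f2" "C1_grad S g g1 g2"
  shows "C1_grad S (\<lambda>x. f x * g x) (\<lambda>x. f1 x * g x + f x * g1 x) (\<lambda>x. f2 x * g x + f x * g2 x)"
  using assms C1_gradD(4)[OF assms(1)] C1_gradD(4)[OF assms(2)] unfolding C1_grad_def
  by (auto intro!: continuous_intros has_derivative_eq_rhs[OF has_derivative_mult]
      simp: fun_eq_iff algebra_simps)

lemma C1_grad_minus:
  assumes "C1_grad S f f1 f2"
  shows "C1_grad S (\<lambda>x. - f x) (\<lambda>x. - f1 x) (\<lambda>x. - f2 x)"
  using assms unfolding C1_grad_def
  by (auto intro!: continuous_intros has_derivative_eq_rhs[OF has_derivative_minus]
      simp: fun_eq_iff algebra_simps)

lemmas C1_grad_intros = C1_grad_const C1_grad_coord C1_grad_add C1_grad_diff C1_grad_mult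
  C1_grad_minus

lemma C1_grad_cong:
  assumes "C1_grad S f f1 f2" "\<And>x. x \<in> S \<Longrightarrow> f1 x = g1 x" "\<And>x. x \<in> S \<Longrightarrow> f2 x = g2 x"
  shows "C1_grad S f g1 g2"
  using assms unfolding C1_grad_def by (auto cong: continuous_on_cong)

text \<open>Radial functions are written as functions of the square of the norm, which is smooth
  and has gradient 2 x.\<close>

definition sqn :: "real^2 \<Rightarrow> real" where "sqn x = (x $ 1)\<^sup>2 + (x $ 2)\<^sup>2"

lemma sqn_norm: "sqn x = (norm x)\<^sup>2"
  by (simp add: sqn_def norm_vec_def L2_set_def sum_2)

lemma sqn_nonneg [simp]: "0 \<le> sqn x"
  by (simp add: sqn_norm)

lemma continuous_on_sqn [continuous_intros]: "continuous_on S sqn"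
  unfolding sqn_def by (intro continuous_intros)

lemma C1_grad_radial:
  assumes "\<And>s. (g has_real_derivative g' s) (at s)" "continuous_on UNIV g'"
  shows "C1_grad S (\<lambda>x. g (sqn x)) (\<lambda>x. g' (sqn x) * (2 * x $ 1)) (\<lambda>x. g' (sqn x) * (2 * x $ 2))"
  unfolding C1_grad_def
proof (intro conjI ballI)
  have c: "continuous_on S (\<lambda>x. g' (sqn x))"
    by (rule continuous_on_compose2[OF assms(2)]) (auto intro!: continuous_intros)
  then show "continuous_on S (\<lambda>x. g' (sqn x) * (2 * x $ 1))"
    "continuous_on S (\<lambda>x. g' (sqn x) * (2 * x $ 2))" by (auto intro!: continuous_intros)
  fix x :: "real^2"
  have "(sqn has_derivative (\<lambda>d. 2 * x $ 1 * d $ 1 + 2 * x $ 2 * d $ 2)) (at x)"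
    unfolding sqn_def
    by (auto intro!: derivative_eq_intros has_derivative_vec_nth simp: fun_eq_iff algebra_simps)
  from has_derivative_compose[OF this assms(1)[unfolded has_field_derivative_def]]
  show "((\<lambda>x. g (sqn x)) has_derivative
      (\<lambda>d. g' (sqn x) * (2 * x $ 1) * d $ 1 + g' (sqn x) * (2 * x $ 2) * d $ 2)) (at x)"
    by (simp add: algebra_simps o_def)
qed

text \<open>The velocity and the pressure live outside the disk only. Products with a cut-off are
  extended by zero to the plane before they are integrated.\<close>

lemma C1_grad_extend_by_zero:
  assumes "open S" "compact K" "K \<subseteq> S" and C: "C1_grad S f f1 f2"
    and z: "\<And>x. x \<in> S - K \<Longrightarrow> f x = 0"
  shows "C1_grad UNIV (\<lambda>x. if x \<in> K then f x else 0)
     (\<lambda>x. if x \<in> K then f1 x else 0) (\<lambda>x. if x \<in> K then f2 x else 0)"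
    (is "C1_grad UNIV ?F ?F1 ?F2")
    and "\<And>x. x \<in> S - K \<Longrightarrow> f1 x = 0 \<and> f2 x = 0"
proof -
  have oK: "open (- K)" using assms(2) compact_imp_closed by blast
  have oSK: "open (S - K)" using assms(1,2) compact_imp_closed by blast
  show f0: "f1 x = 0 \<and> f2 x = 0" if "x \<in> S - K" for x
  proof -
    have "(f has_derivative (\<lambda>d. 0)) (at x)"
      by (rule has_derivative_transform_within_open[OF _ oSK that]) (auto simp: z)
    moreover have "(f has_derivative (\<lambda>d. f1 x * d $ 1 + f2 x * d $ 2)) (at x)"
      using C that by (auto simp: C1_grad_def)
    ultimately have "(\<lambda>d::real^2. 0) = (\<lambda>d. f1 x * d $ 1 + f2 x * d $ 2)"
      by (rule has_derivative_unique)
    from fun_cong[OF this, of "vector [1,0]"] fun_cong[OF this, of "vector [0,1]"]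
    show ?thesis by simp
  qed
  have FS: "?F x = f x" "?F1 x = f1 x" "?F2 x = f2 x" if "x \<in> S" for x
    using that f0 z by auto
  have un: "UNIV = S \<union> - K" using assms(3) by auto
  have c: "continuous_on UNIV (\<lambda>x. if x \<in> K then g x else 0)"
    if "continuous_on S g" "\<And>x. x \<in> S - K \<Longrightarrow> g x = 0" for g :: "real^2 \<Rightarrow> real"
  proof -
    have "continuous_on S (\<lambda>x. if x \<in> K then g x else 0)"
      using that by (subst continuous_on_cong[OF refl, of S _ g]) auto
    moreover have "continuous_on (-K) (\<lambda>x. if x \<in> K then g x else 0)"
      by (subst continuous_on_cong[OF refl, of _ _ "\<lambda>x. 0"]) auto
    ultimately show ?thesis
      unfolding un by (rule continuous_on_open_Un[OF assms(1) oK])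
  qed
  show "C1_grad UNIV ?F ?F1 ?F2"
    unfolding C1_grad_def
  proof (intro conjI ballI)
    show "continuous_on UNIV ?F1" "continuous_on UNIV ?F2"
      using C f0 by (auto intro!: c simp: C1_grad_def)
    fix x :: "real^2"
    show "(?F has_derivative (\<lambda>d. ?F1 x * d $ 1 + ?F2 x * d $ 2)) (at x)"
    proof (cases "x \<in> S")
      case True
      have "(f has_derivative (\<lambda>d. ?F1 x * d $ 1 + ?F2 x * d $ 2)) (at x)"
        using C True unfolding FS(2,3)[OF True] by (auto simp: C1_grad_def)
      then show ?thesis
        by (rule has_derivative_transform_within_open[OF _ assms(1) True]) (simp only: FS)
    next
      case False
      then have x: "x \<in> - K" using assms(3) by auto
      have "(?F has_derivative (\<lambda>d. 0)) (at x)"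
        by (rule has_derivative_transform_within_open[OF _ oK x]) auto
      then show ?thesis using x by simp
    qed
  qed
qed

section \<open>Integrals of derivatives and the Gagliardo inequality\<close>

lemma set_integrable_continuous_compact:
  fixes f :: "'a::euclidean_space \<Rightarrow> real"
  assumes "compact K" "continuous_on K f"
  shows "set_integrable lborel K f"
  using borel_integrable_compact[OF assms] by (simp add: set_integrable_def)

lemma integral_lborel_translate:
  fixes f :: "'a::euclidean_space \<Rightarrow> real"
  assumes "f \<in> borel_measurable borel"
  shows "(\<integral>x. f (x + c) \<partial>lborel) = (\<integral>x. f x \<partial>lborel)"
proof -
  have "(\<integral>x. f x \<partial>lborel) = (\<integral>x. f x \<partial>(distr lborel borel ((+) c)))"
    by (simp add: lborel_distr_plus)
  also have "\<dots> = (\<integral>x. f (c + x) \<partial>lborel)"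
    using assms by (subst integral_distr) auto
  finally show ?thesis by (simp add: add.commute)
qed

text \<open>The integral of f over a translate does not depend on the translation; its derivative with
  respect to the translation is the integral of a directional derivative of f.\<close>

lemma integral_directional_derivative_eq_0:
  fixes f :: "'a::euclidean_space \<Rightarrow> real" and D :: "'a \<Rightarrow> 'a \<Rightarrow> real"
  assumes d: "\<And>x. (f has_derivative D x) (at x)"
    and c: "continuous_on UNIV (\<lambda>x. D x e)"
    and K: "compact K" "\<And>x. x \<notin> K \<Longrightarrow> f x = 0"
    and De: "\<And>x. x \<notin> K \<Longrightarrow> D x e = 0"
  shows "(\<integral>x. D x e \<partial>lborel) = 0"
proof -
  obtain B where B: "\<And>x. x \<in> K \<Longrightarrow> \<bar>D x e\<bar> \<le> B" "0 \<le> B"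
  proof -
    have "bounded ((\<lambda>x. D x e) ` K)"
      by (intro compact_imp_bounded compact_continuous_image continuous_on_subset[OF c] K) auto
    then obtain B where "\<forall>y\<in>(\<lambda>x. D x e) ` K. norm y \<le> B" unfolding bounded_iff by blast
    then have "\<bar>D x e\<bar> \<le> max B 0" if "x \<in> K" for x using that by (simp add: le_max_iff_disj)
    then show thesis using that[of "max B 0"] by simp
  qed
  have B: "\<bar>D x e\<bar> \<le> B" for x using B De[of x] by (cases "x \<in> K") auto
  obtain r where r: "K \<subseteq> cball 0 r"
    using compact_imp_bounded[OF K(1)] unfolding bounded_iff by (auto simp: subset_iff)
  define L where "L = cball (0::'a) (r + norm e)"
  have fc: "continuous_on UNIV f"
    by (meson continuous_at_imp_continuous_on d has_derivative_continuous)
  have fm: "f \<in> borel_measurable borel" using fc by (rule borel_measurable_continuous_onI)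
  have fi: "integrable lborel f"
  proof -
    have "integrable lborel (\<lambda>x. indicator K x *\<^sub>R f x)"
      by (rule borel_integrable_compact) (auto intro: K continuous_on_subset[OF fc])
    also have "(\<lambda>x. indicator K x *\<^sub>R f x) = f" using K(2) by (auto simp: indicator_def fun_eq_iff)
    finally show ?thesis .
  qed
  define t where "t = (\<lambda>n::nat. inverse (real (Suc n)))"
  have t: "0 < t n" "t n \<le> 1" for n by (auto simp: t_def field_simps)
  have t0: "t \<longlonglongrightarrow> 0" unfolding t_def by (rule LIMSEQ_inverse_real_of_nat)
  define q where "q = (\<lambda>n x. (f (x + t n *\<^sub>R e) - f x) / t n)"
  have line: "((\<lambda>\<tau>. f (x + \<tau> *\<^sub>R e)) has_real_derivative D (x + \<tau> *\<^sub>R e) e) (at \<tau>)" for x \<tau>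
  proof -
    have "((\<lambda>\<tau>. x + \<tau> *\<^sub>R e) has_derivative (\<lambda>h. h *\<^sub>R e)) (at \<tau>)"
      by (auto intro!: derivative_eq_intros)
    from has_derivative_compose[OF this d]
    have "((\<lambda>\<tau>. f (x + \<tau> *\<^sub>R e)) has_derivative (\<lambda>h. D (x + \<tau> *\<^sub>R e) (h *\<^sub>R e))) (at \<tau>)" by simp
    moreover have "D y (h *\<^sub>R e) = h * D y e" for h y
      using linear_scale[OF has_derivative_linear[OF d]] by simp
    ultimately show ?thesis by (simp add: has_field_derivative_def mult_commute_abs)
  qed
  have "(\<lambda>n. \<integral>x. q n x \<partial>lborel) \<longlonglongrightarrow> (\<integral>x. D x e \<partial>lborel)"
  proof (rule integral_dominated_convergence)
    show "(\<lambda>x. D x e) \<in> borel_measurable lborel" using borel_measurable_continuous_onI[OF c] by simp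
    show "q n \<in> borel_measurable lborel" for n unfolding q_def using fm by measurable
    show "integrable lborel (\<lambda>x. indicator L x * B)"
      by (auto simp: L_def intro!: integrable_mult_left emeasure_compact_finite)
    show "AE x in lborel. (\<lambda>n. q n x) \<longlonglongrightarrow> D x e"
    proof (rule AE_I2)
      fix x
      have "((\<lambda>h. (f (x + h *\<^sub>R e) - f x) / h) \<longlongrightarrow> D x e) (at 0)"
        using line[of x 0] by (simp add: DERIV_def)
      moreover have "filterlim t (at 0) sequentially"
        using t0 t(1) by (auto simp: filterlim_at intro!: always_eventually less_imp_neq[symmetric])
      ultimately show "(\<lambda>n. q n x) \<longlonglongrightarrow> D x e"
        unfolding q_def by (rule filterlim_compose)
    qed
    show "AE x in lborel. norm (q n x) \<le> indicator L x * B" for n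
    proof (rule AE_I2)
      fix x
      show "norm (q n x) \<le> indicator L x * B"
      proof (cases "x \<in> L")
        case True
        obtain \<tau> where "f (x + t n *\<^sub>R e) - f (x + 0 *\<^sub>R e) = (t n - 0) * D (x + \<tau> *\<^sub>R e) e"
          using MVT2[OF t(1)[of n], of "\<lambda>\<tau>. f (x + \<tau> *\<^sub>R e)" "\<lambda>\<tau>. D (x + \<tau> *\<^sub>R e) e"] line
          by blast
        then have "q n x = D (x + \<tau> *\<^sub>R e) e" using t(1)[of n] by (simp add: q_def)
        then show ?thesis using B True by simp
      next
        case False
        then have nx: "norm x > r + norm e" by (auto simp: L_def)
        have "norm (t n *\<^sub>R e) \<le> norm e"
          using t[of n] by (simp add: mult_left_le_one_le)
        then have "norm (x + t n *\<^sub>R e) > r"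
          using norm_triangle_ineq2[of x "- (t n *\<^sub>R e)"] nx by simp
        moreover have "norm x > r" using nx norm_ge_zero[of e] by linarith
          ultimately have "x \<notin> K" "x + t n *\<^sub>R e \<notin> K"
            using r by (metis mem_cball_0 not_less subset_iff)+
        then show ?thesis using K(2) False by (simp add: q_def)
      qed
    qed
  qed
  moreover have "(\<integral>x. q n x \<partial>lborel) = 0" for n
  proof -
    have "integrable lborel (\<lambda>x. f (x + t n *\<^sub>R e))"
    proof -
      have "integrable (distr lborel borel ((+) (t n *\<^sub>R e))) f"
        using fi by (simp add: lborel_distr_plus)
      then show ?thesis using fm by (subst (asm) integrable_distr_eq) (auto simp: add.commute)
    qed
    then show ?thesis unfolding q_def using fi
      by (simp add: integral_lborel_translate[OF fm])
  qed
  ultimately show ?thesis by (simp add: LIMSEQ_const_iff)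
qed

lemma integral_partial_derivative_eq_0:
  assumes "open S" "compact K" "K \<subseteq> S" and C: "C1_grad S f f1 f2"
    and z: "\<And>x. x \<in> S - K \<Longrightarrow> f x = 0"
  shows "(LINT x:K|lborel. f1 x) = 0" "(LINT x:K|lborel. f2 x) = 0"
proof -
  note E = C1_grad_extend_by_zero[OF assms]
  let ?F = "\<lambda>g x. if x \<in> K then g x else (0::real)"
  have *: "(\<integral>x. ?F f1 x * e $ 1 + ?F f2 x * e $ 2 \<partial>lborel) = 0" for e :: "real^2"
    by (rule integral_directional_derivative_eq_0[where f="?F f" and K=K
        and D="\<lambda>x d. ?F f1 x * d $ 1 + ?F f2 x * d $ 2"])
      (use E(1) assms(2) in \<open>auto simp: C1_grad_def intro!: continuous_intros\<close>)
  have s: "(LINT x:K|lborel. g x) = (\<integral>x. ?F g x \<partial>lborel)" for g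
    by (auto simp: set_lebesgue_integral_def indicator_def intro!: Bochner_Integration.integral_cong)
  show "(LINT x:K|lborel. f1 x) = 0" "(LINT x:K|lborel. f2 x) = 0"
    using *[of "vector [1,0]"] *[of "vector [0,1]"] by (simp_all add: s)
qed

lemma vector2_eq_lambda: "(vector [a, b] :: real^2) = (\<chi> i. if i = 1 then a else b)"
  by (simp add: vec_eq_iff forall_2)

lemma continuous_on_vector2 [continuous_intros]:
  fixes f g :: "'a::topological_space \<Rightarrow> real"
  assumes "continuous_on S f" "continuous_on S g"
  shows "continuous_on S (\<lambda>x. vector [f x, g x] :: real^2)"
proof -
  have "continuous_on S (\<lambda>x. if i = (1::2) then f x else g x)" for i using assms by (cases "i = 1") auto
  then show ?thesis unfolding vector2_eq_lambda by (intro continuous_on_vec_lambda)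
qed

text \<open>Identifies the plane with a product of two lines, so that Fubini applies.\<close>

lemma lborel_vec2:
  "lborel = distr (lborel \<Otimes>\<^sub>M lborel) borel (\<lambda>p. vector [fst p, snd p] :: real^2)"
proof (rule lborel_eqI)
  have c: "continuous_on UNIV (\<lambda>p::real\<times>real. vector [fst p, snd p] :: real^2)"
    by (intro continuous_intros)
  have m[measurable]: "(\<lambda>p::real\<times>real. vector [fst p, snd p] :: real^2) \<in> borel_measurable (lborel \<Otimes>\<^sub>M lborel)"
    using borel_measurable_continuous_onI[OF c] by (simp add: lborel_prod)
  fix l u :: "real^2"
  assume lu: "\<And>b. b \<in> Basis \<Longrightarrow> l \<bullet> b \<le> u \<bullet> b"
  have B: "(Basis :: (real^2) set) = {axis 1 1, axis 2 1}"
    by (auto simp: Basis_vec_def) (metis exhaust_2)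
  have le: "l $ 1 \<le> u $ 1" "l $ 2 \<le> u $ 2"
    using lu[of "axis 1 1"] lu[of "axis 2 1"] by (auto simp: B inner_axis)
  have ne: "axis 1 1 \<noteq> (axis 2 1 :: real^2)"
    by (auto simp: axis_eq_axis)
  have "emeasure (distr (lborel \<Otimes>\<^sub>M lborel) borel (\<lambda>p. vector [fst p, snd p] :: real^2)) (box l u)
     = emeasure (lborel \<Otimes>\<^sub>M lborel) ({l $ 1 <..< u $ 1} \<times> {l $ 2 <..< u $ 2})"
    by (subst emeasure_distr) (auto simp: mem_box_cart forall_2 space_pair_measure intro!: arg_cong2[where f=emeasure])
  also have "\<dots> = ennreal ((u $ 1 - l $ 1) * (u $ 2 - l $ 2))"
    using le by (subst lborel.emeasure_pair_measure_Times) (auto simp: ennreal_mult)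
  also have "(u $ 1 - l $ 1) * (u $ 2 - l $ 2) = (\<Prod>b\<in>Basis. (u - l) \<bullet> b)"
    using ne by (simp add: B inner_axis)
  finally show "emeasure (distr (lborel \<Otimes>\<^sub>M lborel) borel (\<lambda>p. vector [fst p, snd p] :: real^2)) (box l u)
     = (\<Prod>b\<in>Basis. (u - l) \<bullet> b)" .
qed simp

lemma measurable_vector2 [measurable]:
  assumes "f \<in> borel_measurable M" "g \<in> borel_measurable M"
  shows "(\<lambda>x. vector [f x, g x] :: real^2) \<in> borel_measurable M"
proof -
  have "(\<lambda>p::real\<times>real. vector [fst p, snd p] :: real^2) \<in> borel_measurable borel"
    by (intro borel_measurable_continuous_onI continuous_intros)
  from measurable_compose[OF borel_measurable_Pair[OF assms] this] show ?thesis by simp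
qed

lemma nn_integral_vec2:
  fixes g :: "real^2 \<Rightarrow> ennreal"
  assumes [measurable]: "g \<in> borel_measurable borel"
  shows "(\<integral>\<^sup>+x. g x \<partial>lborel) = (\<integral>\<^sup>+a. (\<integral>\<^sup>+b. g (vector [a, b]) \<partial>lborel) \<partial>lborel)"
    and "(\<integral>\<^sup>+x. g x \<partial>lborel) = (\<integral>\<^sup>+b. (\<integral>\<^sup>+a. g (vector [a, b]) \<partial>lborel) \<partial>lborel)"
proof -
  have m: "(\<lambda>p::real\<times>real. vector [fst p, snd p] :: real^2) \<in> borel_measurable (lborel \<Otimes>\<^sub>M lborel)"
    by measurable
  have *: "(\<integral>\<^sup>+x. g x \<partial>lborel) = (\<integral>\<^sup>+p. g (vector [fst p, snd p]) \<partial>(lborel \<Otimes>\<^sub>M lborel))"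
    by (subst lborel_vec2, subst nn_integral_distr) (use m in auto)
  show "(\<integral>\<^sup>+x. g x \<partial>lborel) = (\<integral>\<^sup>+a. (\<integral>\<^sup>+b. g (vector [a, b]) \<partial>lborel) \<partial>lborel)"
    unfolding * by (subst lborel.nn_integral_fst[symmetric]) auto
  show "(\<integral>\<^sup>+x. g x \<partial>lborel) = (\<integral>\<^sup>+b. (\<integral>\<^sup>+a. g (vector [a, b]) \<partial>lborel) \<partial>lborel)"
    unfolding * by (subst lborel_pair.nn_integral_snd[symmetric]) (auto simp: split_beta')
qed

lemma abs_le_nn_integral_derivative:
  fixes f f' :: "real \<Rightarrow> real"
  assumes d: "\<And>s. (f has_real_derivative f' s) (at s)" and c: "continuous_on UNIV f'"
    and z: "\<And>s. s \<le> lo \<Longrightarrow> f s = 0"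
  shows "ennreal \<bar>f a\<bar> \<le> (\<integral>\<^sup>+s. ennreal \<bar>f' s\<bar> \<partial>lborel)"
proof -
  define c where "c = min lo a"
  have ca: "c \<le> a" "f c = 0" using z by (auto simp: c_def)
  let ?i = "\<lambda>s. indicator {c..a} s *\<^sub>R f' s"
  have "integrable lborel ?i"
    by (rule borel_integrable_compact) (auto intro: continuous_on_subset[OF c])
  then have "ennreal (norm (integral\<^sup>L lborel ?i)) \<le> (\<integral>\<^sup>+s. ennreal (norm (?i s)) \<partial>lborel)"
    by (rule integral_norm_bound_ennreal)
  also have "integral\<^sup>L lborel ?i = f a - f c"
    by (rule integral_FTC_atLeastAtMost[OF ca(1)])
      (auto intro: continuous_on_subset[OF c] has_vector_derivative_at_within
        simp: d[unfolded has_real_derivative_iff_has_vector_derivative])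
  also have "(\<integral>\<^sup>+s. ennreal (norm (?i s)) \<partial>lborel) \<le> (\<integral>\<^sup>+s. ennreal \<bar>f' s\<bar> \<partial>lborel)"
    by (rule nn_integral_mono) (auto simp: indicator_def)
  finally show ?thesis using ca by simp
qed

text \<open>The value of f at a point is at most the integral of the modulus of its first partial derivative over
  the horizontal line, and of the second over the vertical line, through the point. The first
  bound depends on the second coordinate only and the second one on the first, so the integral of
  their product factorises.\<close>

lemma gagliardo_UNIV:
  assumes C: "C1_grad UNIV f f1 f2" and K: "compact K"
    and z: "\<And>x. x \<notin> K \<Longrightarrow> f x = 0 \<and> f1 x = 0 \<and> f2 x = 0"
  shows "(\<integral>x. (f x)\<^sup>2 \<partial>lborel) \<le> (\<integral>x. \<bar>f1 x\<bar> \<partial>lborel) * (\<integral>x. \<bar>f2 x\<bar> \<partial>lborel)"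
proof -
  note cont = C1_gradD(2-4)[OF C]
  note [measurable] = cont[THEN borel_measurable_continuous_onI]
  have int: "integrable lborel g" if "continuous_on UNIV g" "\<And>x. x \<notin> K \<Longrightarrow> g x = 0"
    for g :: "real^2 \<Rightarrow> real"
  proof -
    have "integrable lborel (\<lambda>x. indicator K x *\<^sub>R g x)"
      by (rule borel_integrable_compact[OF K]) (auto intro: continuous_on_subset[OF that(1)])
    also have "(\<lambda>x. indicator K x *\<^sub>R g x) = g" using that(2) by (auto simp: indicator_def fun_eq_iff)
    finally show ?thesis .
  qed
  obtain L where L: "K \<subseteq> cball 0 L"
    using compact_imp_bounded[OF K] unfolding bounded_iff by (auto simp: subset_iff)
  have out: "f (vector [a, b]) = 0" if "a \<le> - L - 1 \<or> b \<le> - L - 1" for a b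
  proof -
    have "\<bar>a\<bar> \<le> norm (vector [a, b] :: real^2)" "\<bar>b\<bar> \<le> norm (vector [a, b] :: real^2)"
      using component_le_norm_cart[of "vector [a, b]"] by (metis vector_2)+
    then have "(vector [a, b] :: real^2) \<notin> cball 0 L" using that by auto
    then show ?thesis using z L by blast
  qed
  have line: "((\<lambda>t. f (vector [\<alpha> t, \<beta> t])) has_real_derivative
      f1 (vector [\<alpha> t, \<beta> t]) * a + f2 (vector [\<alpha> t, \<beta> t]) * b) (at t)"
    if "\<And>t. vector [\<alpha> t, \<beta> t] = vector [\<alpha> 0, \<beta> 0] + t *\<^sub>R (vector [a, b] :: real^2)"
    for \<alpha> \<beta> a b t
  proof -
    have eq: "(\<lambda>t. vector [\<alpha> t, \<beta> t]) = (\<lambda>t. vector [\<alpha> 0, \<beta> 0] + t *\<^sub>R (vector [a, b] :: real^2))"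
      by (rule ext, rule that)
    have "((\<lambda>t. vector [\<alpha> t, \<beta> t] :: real^2) has_derivative (\<lambda>h. h *\<^sub>R vector [a, b])) (at t)"
      by (subst eq) (auto intro!: derivative_eq_intros)
    from has_derivative_compose[OF this C1_gradD(1)[OF C UNIV_I]]
    show ?thesis unfolding has_field_derivative_def
      by (rule has_derivative_eq_rhs) (simp add: algebra_simps fun_eq_iff)
  qed
  have l1: "((\<lambda>s. f (vector [s, b])) has_real_derivative f1 (vector [s, b])) (at s)" for s b
    using line[of "\<lambda>s. s" "\<lambda>s. b" 1 0 s] by (simp add: vec_eq_iff forall_2)
  have l2: "((\<lambda>s. f (vector [a, s])) has_real_derivative f2 (vector [a, s])) (at s)" for s a
    using line[of "\<lambda>s. a" "\<lambda>s. s" 0 1 s] by (simp add: vec_eq_iff forall_2)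
  define A where "A b = (\<integral>\<^sup>+s. ennreal \<bar>f1 (vector [s, b])\<bar> \<partial>lborel)" for b
  define B where "B a = (\<integral>\<^sup>+s. ennreal \<bar>f2 (vector [a, s])\<bar> \<partial>lborel)" for a
  have A: "ennreal \<bar>f (vector [a, b])\<bar> \<le> A b" for a b
    unfolding A_def by (rule abs_le_nn_integral_derivative[OF l1, where lo="-L-1"])
      (auto intro!: continuous_on_compose2[OF cont(1)] continuous_intros out)
  have B: "ennreal \<bar>f (vector [a, b])\<bar> \<le> B a" for a b
    unfolding B_def by (rule abs_le_nn_integral_derivative[OF l2, where lo="-L-1"])
      (auto intro!: continuous_on_compose2[OF cont(2)] continuous_intros out)
  have [measurable]: "A \<in> borel_measurable borel" "B \<in> borel_measurable borel"
    unfolding A_def B_def by measurable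
  have "(\<integral>\<^sup>+x. ennreal ((f x)\<^sup>2) \<partial>lborel)
      = (\<integral>\<^sup>+a. (\<integral>\<^sup>+b. ennreal ((f (vector [a, b]))\<^sup>2) \<partial>lborel) \<partial>lborel)"
    by (rule nn_integral_vec2) measurable
  also have "\<dots> \<le> (\<integral>\<^sup>+a. (\<integral>\<^sup>+b. B a * A b \<partial>lborel) \<partial>lborel)"
  proof (intro nn_integral_mono)
    fix a b
    have "ennreal ((f (vector [a, b]))\<^sup>2)
        = ennreal \<bar>f (vector [a, b])\<bar> * ennreal \<bar>f (vector [a, b])\<bar>"
      by (subst ennreal_mult[symmetric]) (auto simp: power2_eq_square)
    also have "\<dots> \<le> B a * A b" by (intro mult_mono A B) auto
    finally show "ennreal ((f (vector [a, b]))\<^sup>2) \<le> B a * A b" .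
  qed
  also have "\<dots> = (\<integral>\<^sup>+a. B a \<partial>lborel) * (\<integral>\<^sup>+b. A b \<partial>lborel)"
    by (simp add: nn_integral_cmult nn_integral_multc)
  also have "(\<integral>\<^sup>+a. B a \<partial>lborel) = (\<integral>\<^sup>+x. ennreal \<bar>f2 x\<bar> \<partial>lborel)"
    unfolding B_def by (rule nn_integral_vec2(1)[symmetric]) measurable
  also have "(\<integral>\<^sup>+b. A b \<partial>lborel) = (\<integral>\<^sup>+x. ennreal \<bar>f1 x\<bar> \<partial>lborel)"
    unfolding A_def by (rule nn_integral_vec2(2)[symmetric]) measurable
  also have "(\<integral>\<^sup>+x. ennreal \<bar>f2 x\<bar> \<partial>lborel) = ennreal (\<integral>x. \<bar>f2 x\<bar> \<partial>lborel)"
    using z by (intro nn_integral_eq_integral int) (auto intro!: continuous_intros cont)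
  also have "(\<integral>\<^sup>+x. ennreal \<bar>f1 x\<bar> \<partial>lborel) = ennreal (\<integral>x. \<bar>f1 x\<bar> \<partial>lborel)"
    using z by (intro nn_integral_eq_integral int) (auto intro!: continuous_intros cont)
  also have "(\<integral>\<^sup>+x. ennreal ((f x)\<^sup>2) \<partial>lborel) = ennreal (\<integral>x. (f x)\<^sup>2 \<partial>lborel)"
    using z by (intro nn_integral_eq_integral int) (auto intro!: continuous_intros cont)
  finally have "ennreal (\<integral>x. (f x)\<^sup>2 \<partial>lborel)
      \<le> ennreal ((\<integral>x. \<bar>f2 x\<bar> \<partial>lborel) * (\<integral>x. \<bar>f1 x\<bar> \<partial>lborel))"
    by (simp add: ennreal_mult)
  then show ?thesis by (subst (asm) ennreal_le_iff) (auto simp: mult.commute)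
qed

lemma gagliardo:
  assumes "open S" "compact K" "K \<subseteq> S" and C: "C1_grad S f f1 f2"
    and z: "\<And>x. x \<in> S - K \<Longrightarrow> f x = 0"
  shows "(LINT x:K|lborel. (f x)\<^sup>2) \<le> (LINT x:K|lborel. \<bar>f1 x\<bar>) * (LINT x:K|lborel. \<bar>f2 x\<bar>)"
proof -
  let ?F = "\<lambda>g x. if x \<in> K then g x else (0::real)"
  have "(\<integral>x. (?F f x)\<^sup>2 \<partial>lborel) \<le> (\<integral>x. \<bar>?F f1 x\<bar> \<partial>lborel) * (\<integral>x. \<bar>?F f2 x\<bar> \<partial>lborel)"
    by (rule gagliardo_UNIV[OF C1_grad_extend_by_zero(1)[OF assms] assms(2)]) auto
  moreover have s: "(LINT x:K|lborel. g x) = (\<integral>x. ?F g x \<partial>lborel)" for g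
    by (auto simp: set_lebesgue_integral_def indicator_def intro!: Bochner_Integration.integral_cong)
  ultimately show ?thesis by (simp add: s if_distrib[of "\<lambda>x. x\<^sup>2"] if_distrib[of abs] cong: if_cong)
qed

section \<open>Rotations and circle averages\<close>

definition rot :: "real \<Rightarrow> real^2 \<Rightarrow> real^2" where
  "rot t x = vector [cos t * x $ 1 - sin t * x $ 2, sin t * x $ 1 + cos t * x $ 2]"

lemma rot_nth [simp]: "rot t x $ 1 = cos t * x $ 1 - sin t * x $ 2"
  "rot t x $ 2 = sin t * x $ 1 + cos t * x $ 2"
  by (simp_all add: rot_def)

lemma sqn_rot [simp]: "sqn (rot t x) = sqn x"
proof -
  have "sqn (rot t x) = ((sin t)\<^sup>2 + (cos t)\<^sup>2) * sqn x"
    unfolding sqn_def rot_nth by algebra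
  then show ?thesis by simp
qed

lemma norm_rot [simp]: "norm (rot t x) = norm x"
  using sqn_rot[of t x] by (simp add: sqn_norm)

lemma rot_rot [simp]: "rot s (rot t x) = rot (s + t) x"
  by (simp add: vec_eq_iff forall_2 cos_add sin_add algebra_simps)

lemma rot_0 [simp]: "rot 0 x = x" "rot (2 * pi) x = x"
  by (simp_all add: vec_eq_iff forall_2)

lemma continuous_on_rot [continuous_intros]:
  fixes f :: "'a::t2_space \<Rightarrow> real"
  assumes "continuous_on S f" "continuous_on S g"
  shows "continuous_on S (\<lambda>x. rot (f x) (g x))"
  unfolding rot_def by (intro continuous_intros assms)

lemma linear_rot: "linear (rot t)"
  by (rule linearI) (simp_all add: vec_eq_iff forall_2 algebra_simps)

lemma lborel_distr_rot: "distr lborel borel (rot t) = lborel"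
proof (rule lborel_eqI[symmetric])
  fix l u :: "real^2"
  assume lu: "\<And>b. b \<in> Basis \<Longrightarrow> l \<bullet> b \<le> u \<bullet> b"
  have m: "rot t \<in> borel_measurable borel"
    by (intro borel_measurable_continuous_onI continuous_intros)
  have eq: "rot t -` box l u = rot (- t) ` box l u"
  proof (intro set_eqI iffI)
    fix x assume "x \<in> rot t -` box l u"
    then show "x \<in> rot (- t) ` box l u" by (intro image_eqI[of _ _ "rot t x"]) auto
  qed auto
  have o: "orthogonal_transformation (rot (- t))"
    unfolding orthogonal_transformation by (simp add: linear_rot)
  have bl: "rot (- t) ` box l u \<in> lmeasurable"
    by (intro measurable_orthogonal_image o) auto
  have "emeasure (distr lborel borel (rot t)) (box l u) = emeasure lborel (rot t -` box l u)"
    using m by (subst emeasure_distr) auto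
  also have "\<dots> = emeasure lebesgue (rot (- t) ` box l u)"
    unfolding eq[symmetric] using measurable_sets[OF m, of "box l u"] by (simp add: emeasure_completion)
  also have "\<dots> = ennreal (measure lebesgue (rot (- t) ` box l u))"
    using bl by (rule emeasure_eq_measure2)
  also have "measure lebesgue (rot (- t) ` box l u) = measure lebesgue (box l u)"
    by (intro measure_orthogonal_image o) auto
  also have "\<dots> = (\<Prod>b\<in>Basis. (u - l) \<bullet> b)"
    using lu by (simp add: inner_diff_left measure_completion measure_lborel_box)
  finally show "emeasure (distr lborel borel (rot t)) (box l u) = (\<Prod>b\<in>Basis. (u - l) \<bullet> b)" .
qed simp

abbreviation Om :: "(real^2) set" where "Om \<equiv> {x. 1 < norm x}"

lemma open_Om: "open Om"
  by (intro open_Collect_less continuous_intros)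

lemma continuous_on_circle_integrand:
  assumes "continuous_on Om f" "continuous_on UNIV \<kappa>"
  shows "continuous_on (Om \<times> T) (\<lambda>(x, t). \<kappa> t * f (rot t x) :: real)"
  unfolding split_beta'
  by (intro continuous_intros continuous_on_compose2[OF assms(1)] continuous_on_compose2[OF assms(2)])
    auto

lemma continuous_on_circle:
  assumes "continuous_on Om f" "x \<in> Om" "continuous_on UNIV \<kappa>"
  shows "continuous_on T (\<lambda>t. \<kappa> t * f (rot t x) :: real)"
  by (intro continuous_intros continuous_on_compose2[OF assms(1)]
      continuous_on_subset[OF assms(3)]) (use assms(2) in auto)

text \<open>Integration over the circle through x. The weight 1 gives circle means up to the factor
  2 pi; the weight t inverts the angular derivative on functions of mean zero.\<close>

definition circle_int :: "(real \<Rightarrow> real) \<Rightarrow> (real^2 \<Rightarrow> real) \<Rightarrow> real^2 \<Rightarrow> real" where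
  "circle_int \<kappa> f x = integral {0..2 * pi} (\<lambda>t. \<kappa> t * f (rot t x))"

lemma circle_integrable:
  assumes "continuous_on Om f" "x \<in> Om" "continuous_on UNIV \<kappa>"
  shows "(\<lambda>t. \<kappa> t * f (rot t x) :: real) integrable_on {0..2 * pi}"
  by (rule integrable_continuous_real, rule continuous_on_circle[OF assms])

lemma continuous_on_circle_int:
  assumes "continuous_on Om f" "continuous_on UNIV \<kappa>"
  shows "continuous_on Om (circle_int \<kappa> f)"
  unfolding circle_int_def[abs_def] cbox_interval[symmetric]
  by (intro integral_continuous_on_param continuous_on_circle_integrand assms)

lemma circle_int_add:
  assumes "continuous_on Om f" "continuous_on Om g" "continuous_on UNIV \<kappa>" "x \<in> Om"
  shows "circle_int \<kappa> (\<lambda>y. f y + g y) x = circle_int \<kappa> f x + circle_int \<kappa> g x"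
  unfolding circle_int_def distrib_left
  by (intro integral_add circle_integrable assms)

lemma circle_int_cmult: "circle_int \<kappa> (\<lambda>y. c * f y) x = c * circle_int \<kappa> f x"
proof -
  have "(\<lambda>t. \<kappa> t * (c * f (rot t x))) = (\<lambda>t. c * (\<kappa> t * f (rot t x)))"
    by (simp add: fun_eq_iff)
  then show ?thesis unfolding circle_int_def by simp
qed

lemma circle_int_abs_le:
  assumes f: "continuous_on Om f" and x: "x \<in> Om" and k: "continuous_on UNIV \<kappa>"
    and g: "continuous_on Om g" and l: "continuous_on UNIV l"
    and le: "\<And>t. 0 \<le> t \<Longrightarrow> t \<le> 2 * pi \<Longrightarrow> \<bar>\<kappa> t * f (rot t x)\<bar> \<le> l t * g (rot t x)"
  shows "\<bar>circle_int \<kappa> f x\<bar> \<le> circle_int l g x"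
  unfolding circle_int_def real_norm_def[symmetric]
  by (rule integral_norm_bound_integral) (use le in \<open>auto intro!: circle_integrable f x k g l\<close>)

text \<open>The gradient of a circle integral: the gradient of the integrand, rotated back.\<close>

definition circle_grad1 :: "(real \<Rightarrow> real) \<Rightarrow> (real^2 \<Rightarrow> real) \<Rightarrow> (real^2 \<Rightarrow> real) \<Rightarrow> real^2 \<Rightarrow> real" where
  "circle_grad1 \<kappa> f1 f2 x = circle_int (\<lambda>t. \<kappa> t * cos t) f1 x + circle_int (\<lambda>t. \<kappa> t * sin t) f2 x"

definition circle_grad2 :: "(real \<Rightarrow> real) \<Rightarrow> (real^2 \<Rightarrow> real) \<Rightarrow> (real^2 \<Rightarrow> real) \<Rightarrow> real^2 \<Rightarrow> real" where
  "circle_grad2 \<kappa> f1 f2 x = circle_int (\<lambda>t. \<kappa> t * cos t) f2 x - circle_int (\<lambda>t. \<kappa> t * sin t) f1 x"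

lemma C1_grad_circle_int:
  assumes C: "C1_grad Om f f1 f2" and k: "continuous_on UNIV \<kappa>"
  shows "C1_grad Om (circle_int \<kappa> f) (circle_grad1 \<kappa> f1 f2) (circle_grad2 \<kappa> f1 f2)"
    (is "C1_grad Om ?F _ _")
  unfolding C1_grad_def circle_grad1_def[abs_def] circle_grad2_def[abs_def]
proof (intro conjI ballI)
  let ?F1 = "\<lambda>x. circle_int (\<lambda>t. \<kappa> t * cos t) f1 x + circle_int (\<lambda>t. \<kappa> t * sin t) f2 x"
  let ?F2 = "\<lambda>x. circle_int (\<lambda>t. \<kappa> t * cos t) f2 x - circle_int (\<lambda>t. \<kappa> t * sin t) f1 x"
  note cont = C1_gradD(2-4)[OF C]
  have kc: "continuous_on UNIV (\<lambda>t. \<kappa> t * cos t)" "continuous_on UNIV (\<lambda>t. \<kappa> t * sin t)"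
    by (intro continuous_intros k)+
  show "continuous_on Om ?F1" "continuous_on Om ?F2"
    by (intro continuous_intros continuous_on_circle_int cont kc)+
  fix x0 assume x0: "x0 \<in> Om"
  obtain e where e: "e > 0" "ball x0 e \<subseteq> Om"
    using open_Om x0 open_contains_ball by blast
  define G :: "real^2 \<Rightarrow> real \<Rightarrow> real^2" where "G x t = vector
    [\<kappa> t * (f1 (rot t x) * cos t + f2 (rot t x) * sin t),
     \<kappa> t * (f2 (rot t x) * cos t - f1 (rot t x) * sin t)]" for x t
  have Gc: "continuous_on (Om \<times> T) (\<lambda>(x, t). G x t)" for T
    unfolding G_def split_beta'
    by (intro continuous_intros continuous_on_compose2[OF cont(1)]
        continuous_on_compose2[OF cont(2)] continuous_on_compose2[OF k]) auto
  let ?fx = "\<lambda>x t. blinfun_inner_left (G x t)"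
  have Bc: "continuous_on (ball x0 e \<times> T) (\<lambda>(x, t). ?fx x t)" for T
  proof -
    have "continuous_on (Om \<times> T) (\<lambda>p. blinfun_inner_left (case p of (x, t) \<Rightarrow> G x t))"
      by (intro bounded_linear.continuous_on[OF bounded_linear_blinfun_inner_left] Gc)
    then show ?thesis using e by (auto simp: split_beta' intro: continuous_on_subset)
  qed
  have "((\<lambda>x. integral (cbox 0 (2 * pi)) (\<lambda>t. \<kappa> t * f (rot t x)))
      has_derivative integral (cbox 0 (2 * pi)) (?fx x0)) (at x0 within ball x0 e)"
  proof (rule leibniz_rule)
    show "continuous_on (ball x0 e \<times> cbox 0 (2 * pi)) (\<lambda>(x, t). ?fx x t)" by (rule Bc)
    show "x0 \<in> ball x0 e" using e by simp
    fix x assume "x \<in> ball x0 e"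
    then have x: "x \<in> Om" using e by auto
    show "(\<lambda>t. \<kappa> t * f (rot t x)) integrable_on cbox 0 (2 * pi)"
      using circle_integrable[OF cont(3) x k] by simp
    fix t :: real
    have "(rot t has_derivative rot t) (at x)"
      by (rule bounded_linear_imp_has_derivative) (simp add: linear_rot linear_conv_bounded_linear[symmetric])
    from has_derivative_compose[OF this C1_gradD(1)[OF C]] x
    have "((\<lambda>x. f (rot t x)) has_derivative
        (\<lambda>d. f1 (rot t x) * rot t d $ 1 + f2 (rot t x) * rot t d $ 2)) (at x)" by simp
    note d = has_derivative_mult_right[OF this, of "\<kappa> t"]
    show "((\<lambda>x. \<kappa> t * f (rot t x)) has_derivative blinfun_apply (?fx x t)) (at x within ball x0 e)"
      by (rule has_derivative_at_withinI, rule has_derivative_eq_rhs[OF d])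
        (simp add: fun_eq_iff G_def inner_vec_def sum_2 algebra_simps)
  qed simp
  then have 1: "(?F has_derivative integral (cbox 0 (2 * pi)) (?fx x0)) (at x0)"
    using e by (simp add: circle_int_def[abs_def] at_within_open[of x0 "ball x0 e"])
  have 2: "blinfun_apply (integral (cbox 0 (2 * pi)) (?fx x0)) d = ?F1 x0 * d $ 1 + ?F2 x0 * d $ 2" for d
  proof -
    have i: "?fx x0 integrable_on cbox 0 (2 * pi)"
    proof (rule integrable_continuous)
      have "continuous_on ((\<lambda>t. (x0, t)) ` cbox 0 (2 * pi)) (\<lambda>(x, t). ?fx x t)"
        by (rule continuous_on_subset[OF Bc[of UNIV]]) (use e in auto)
      then have "continuous_on (cbox 0 (2 * pi)) ((\<lambda>(x, t). ?fx x t) \<circ> (\<lambda>t. (x0, t)))"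
        by (intro continuous_on_compose continuous_intros)
      then show "continuous_on (cbox 0 (2 * pi)) (?fx x0)" by (simp add: o_def)
    qed
    note I = circle_integrable[OF _ x0]
    have i4: "(\<lambda>t. \<kappa> t * cos t * f1 (rot t x0) * d $ 1) integrable_on {0..2*pi}"
      "(\<lambda>t. \<kappa> t * sin t * f2 (rot t x0) * d $ 1) integrable_on {0..2*pi}"
      "(\<lambda>t. \<kappa> t * cos t * f2 (rot t x0) * d $ 2) integrable_on {0..2*pi}"
      "(\<lambda>t. \<kappa> t * sin t * f1 (rot t x0) * d $ 2) integrable_on {0..2*pi}"
      by (intro integrable_on_mult_left I cont kc)+
    have "blinfun_apply (integral (cbox 0 (2 * pi)) (?fx x0)) d
        = integral (cbox 0 (2 * pi)) (\<lambda>t. d \<bullet> G x0 t)"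
      by (subst blinfun_apply_integral[OF i]) (simp add: inner_commute)
    also have "\<dots> = integral {0..2*pi} (\<lambda>t. (\<kappa> t * cos t * f1 (rot t x0) * d $ 1
        + \<kappa> t * sin t * f2 (rot t x0) * d $ 1) + (\<kappa> t * cos t * f2 (rot t x0) * d $ 2
        - \<kappa> t * sin t * f1 (rot t x0) * d $ 2))"
      by (simp add: G_def inner_vec_def sum_2 algebra_simps)
    also have "\<dots> = ?F1 x0 * d $ 1 + ?F2 x0 * d $ 2"
      using i4 by (simp only: integral_add integral_diff integrable_add integrable_diff
          integral_mult_left circle_int_def distrib_right left_diff_distrib)
    finally show ?thesis .
  qed
  show "(?F has_derivative (\<lambda>d. ?F1 x0 * d $ 1 + ?F2 x0 * d $ 2)) (at x0)"
    by (rule has_derivative_eq_rhs[OF 1]) (simp only: fun_eq_iff 2 simp_thms)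
qed

text \<open>The angular and the radial derivative commute with rotations, hence with circle integrals.\<close>

lemma circle_grad_polar:
  assumes C: "C1_grad Om f f1 f2" and x: "x \<in> Om" and k: "continuous_on UNIV \<kappa>"
  shows "x $ 1 * circle_grad2 \<kappa> f1 f2 x - x $ 2 * circle_grad1 \<kappa> f1 f2 x
      = circle_int \<kappa> (\<lambda>y. y $ 1 * f2 y - y $ 2 * f1 y) x" (is ?angular)
    and "x $ 1 * circle_grad1 \<kappa> f1 f2 x + x $ 2 * circle_grad2 \<kappa> f1 f2 x
      = circle_int \<kappa> (\<lambda>y. y $ 1 * f1 y + y $ 2 * f2 y) x" (is ?radial)
proof -
  note c = C1_gradD(2,3)[OF C]
  have kc: "continuous_on UNIV (\<lambda>t. \<kappa> t * cos t)" "continuous_on UNIV (\<lambda>t. \<kappa> t * sin t)"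
    by (intro continuous_intros k)+
  define F1 F2 where "F1 t = \<kappa> t * cos t * f1 (rot t x) + \<kappa> t * sin t * f2 (rot t x)"
    and "F2 t = \<kappa> t * cos t * f2 (rot t x) - \<kappa> t * sin t * f1 (rot t x)" for t
  note I = circle_integrable[OF c(1) x kc(1)] circle_integrable[OF c(1) x kc(2)]
    circle_integrable[OF c(2) x kc(1)] circle_integrable[OF c(2) x kc(2)]
  have F: "F1 integrable_on {0..2*pi}" "F2 integrable_on {0..2*pi}"
    unfolding F1_def[abs_def] F2_def[abs_def] by (rule integrable_add I integrable_diff)+
  have G: "circle_grad1 \<kappa> f1 f2 x = integral {0..2*pi} F1" "circle_grad2 \<kappa> f1 f2 x = integral {0..2*pi} F2"
    unfolding circle_grad1_def circle_grad2_def circle_int_def F1_def[abs_def] F2_def[abs_def] using I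
    by (simp_all only: integral_add integral_diff)
  have "x $ 1 * integral {0..2*pi} F2 - x $ 2 * integral {0..2*pi} F1
      = integral {0..2*pi} (\<lambda>t. x $ 1 * F2 t - x $ 2 * F1 t)"
    using F by (simp only: integral_diff integral_mult_right integrable_on_mult_right)
  also have "\<dots> = circle_int \<kappa> (\<lambda>y. y $ 1 * f2 y - y $ 2 * f1 y) x"
    unfolding circle_int_def F1_def F2_def by (rule integral_cong) (simp add: algebra_simps)
  finally show ?angular unfolding G .
  have "x $ 1 * integral {0..2*pi} F1 + x $ 2 * integral {0..2*pi} F2
      = integral {0..2*pi} (\<lambda>t. x $ 1 * F1 t + x $ 2 * F2 t)"
    using F by (simp only: integral_add integral_mult_right integrable_on_mult_right)
  also have "\<dots> = circle_int \<kappa> (\<lambda>y. y $ 1 * f1 y + y $ 2 * f2 y) x"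
    unfolding circle_int_def F1_def F2_def by (rule integral_cong) (simp add: algebra_simps)
  finally show ?radial unfolding G .
qed

lemma rot_has_derivative:
  assumes C: "C1_grad Om f f1 f2" and x: "x \<in> Om"
  shows "((\<lambda>t. f (rot t x)) has_real_derivative
    (rot t x $ 1 * f2 (rot t x) - rot t x $ 2 * f1 (rot t x))) (at t)"
proof -
  have eq: "(\<lambda>t. rot t x) = (\<lambda>t. cos t *\<^sub>R x + sin t *\<^sub>R vector [- (x $ 2), x $ 1])"
    by (simp add: fun_eq_iff vec_eq_iff forall_2)
  have "((\<lambda>t. rot t x) has_derivative
      (\<lambda>h. h *\<^sub>R (- sin t *\<^sub>R x + cos t *\<^sub>R vector [- (x $ 2), x $ 1]))) (at t)"
    unfolding eq by (auto intro!: derivative_eq_intros simp: fun_eq_iff algebra_simps)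
  from has_derivative_compose[OF this C1_gradD(1)[OF C, of "rot t x"]] x
  have "((\<lambda>t. f (rot t x)) has_derivative (\<lambda>h. f1 (rot t x) * (h *\<^sub>R (- sin t *\<^sub>R x + cos t *\<^sub>R vector [- (x $ 2), x $ 1])) $ 1
      + f2 (rot t x) * (h *\<^sub>R (- sin t *\<^sub>R x + cos t *\<^sub>R vector [- (x $ 2), x $ 1])) $ 2)) (at t)"
    by simp
  then show ?thesis unfolding has_field_derivative_def
    by (rule has_derivative_eq_rhs) (simp add: fun_eq_iff algebra_simps)
qed

text \<open>Integration by parts on a circle.\<close>

lemma circle_int_angular_derivative:
  assumes C: "C1_grad Om f f1 f2" and x: "x \<in> Om"
  shows "circle_int (\<lambda>t. 1) (\<lambda>y. y $ 1 * f2 y - y $ 2 * f1 y) x = 0"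
    and "circle_int (\<lambda>t. t) (\<lambda>y. y $ 1 * f2 y - y $ 2 * f1 y) x
      = 2 * pi * f x - circle_int (\<lambda>t. 1) f x"
proof -
  let ?D = "\<lambda>t. rot t x $ 1 * f2 (rot t x) - rot t x $ 2 * f1 (rot t x)"
  note d = rot_has_derivative[OF C x]
  have "(?D has_integral (f (rot (2 * pi) x) - f (rot 0 x))) {0..2 * pi}"
    by (rule fundamental_theorem_of_calculus[OF _ has_vector_derivative_at_within[OF
            d[unfolded has_real_derivative_iff_has_vector_derivative]]]) (use pi_ge_zero in simp)
  then show "circle_int (\<lambda>t. 1) (\<lambda>y. y $ 1 * f2 y - y $ 2 * f1 y) x = 0"
    by (simp add: circle_int_def integral_unique)
  have d2: "((\<lambda>t. t * f (rot t x)) has_real_derivative f (rot t x) + t * ?D t) (at t)" for t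
    by (rule derivative_eq_intros d refl)+ simp
  have "((\<lambda>t. f (rot t x) + t * ?D t) has_integral (2 * pi * f (rot (2 * pi) x) - 0 * f (rot 0 x))) {0..2 * pi}"
    by (rule fundamental_theorem_of_calculus[OF _ has_vector_derivative_at_within[OF
            d2[unfolded has_real_derivative_iff_has_vector_derivative]]]) (use pi_ge_zero in simp)
  then have "integral {0..2*pi} (\<lambda>t. f (rot t x) + t * ?D t) = 2 * pi * f x"
    by (simp add: integral_unique)
  moreover have "(\<lambda>t. f (rot t x)) integrable_on {0..2*pi}"
    using circle_integrable[OF C1_gradD(4)[OF C] x, of "\<lambda>t. 1"] by simp
  moreover have "(\<lambda>t. t * ?D t) integrable_on {0..2*pi}"
    by (rule circle_integrable[OF _ x, of "\<lambda>y. y $ 1 * f2 y - y $ 2 * f1 y"])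
      (intro continuous_intros C1_gradD[OF C])+
  ultimately show "circle_int (\<lambda>t. t) (\<lambda>y. y $ 1 * f2 y - y $ 2 * f1 y) x
      = 2 * pi * f x - circle_int (\<lambda>t. 1) f x"
    by (simp add: circle_int_def integral_add)
qed

text \<open>If f vanishes on the unit circle, it is recovered from its radial derivative by integration
  along rays. The expression bounded by B is the radial derivative times the norm.\<close>

lemma radial_bound:
  assumes C: "C1_grad Om f f1 f2"
    and near: "\<And>y. 1 < norm y \<Longrightarrow> norm y \<le> 2 \<Longrightarrow> \<bar>f y\<bar> \<le> c * (norm y - 1)"
    and E: "\<And>y. 1 < norm y \<Longrightarrow> norm y \<le> norm x \<Longrightarrow> \<bar>y $ 1 * f1 y + y $ 2 * f2 y\<bar> \<le> B"
    and x: "x \<in> Om"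
  shows "\<bar>f x\<bar> \<le> B * (norm x - 1)"
proof (rule field_le_epsilon)
  fix e :: real assume e: "0 < e"
  define r where "r = norm x"
  have r: "1 < r" using x by (simp add: r_def)
  have c: "0 \<le> c"
  proof -
    have "\<bar>f (vector [2, 0])\<bar> \<le> c * (norm (vector [2, 0] :: real^2) - 1)"
      by (rule near) (simp_all add: norm_vec_def L2_set_def sum_2)
    then show ?thesis by (simp add: norm_vec_def L2_set_def sum_2)
  qed
  define \<delta> where "\<delta> = min 1 (min (e / (c + 1)) ((r - 1) / 2))"
  have \<delta>: "0 < \<delta>" "\<delta> \<le> 1" "\<delta> * (c + 1) \<le> e" "\<delta> < r - 1"
  proof -
    show "0 < \<delta>" "\<delta> \<le> 1" using e c r by (auto simp: \<delta>_def)
    have "\<delta> \<le> e / (c + 1)" unfolding \<delta>_def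
      by (meson min.cobounded1 min.cobounded2 order_trans)
    then show "\<delta> * (c + 1) \<le> e" using c by (simp add: field_simps)
    have "\<delta> \<le> (r - 1) / 2" unfolding \<delta>_def by (meson min.cobounded2 order_trans)
    then show "\<delta> < r - 1" using r by simp
  qed
  define \<rho> where "\<rho> = (1 + \<delta>) / r"
  have \<rho>: "0 < \<rho>" "\<rho> < 1" "\<rho> * r = 1 + \<delta>" using r \<delta> by (auto simp: \<rho>_def field_simps)
  have inOm: "t *\<^sub>R x \<in> Om" if "\<rho> \<le> t" for t
  proof -
    have "\<rho> * r \<le> t * r" using that r by simp
    then show ?thesis using \<rho> \<delta> that by (simp add: r_def[symmetric])
  qed
  have d: "((\<lambda>t. f (t *\<^sub>R x)) has_real_derivative (f1 (t *\<^sub>R x) * x $ 1 + f2 (t *\<^sub>R x) * x $ 2)) (at t)"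
    if "\<rho> \<le> t" for t
  proof -
    have "((\<lambda>t. t *\<^sub>R x) has_derivative (\<lambda>h. h *\<^sub>R x)) (at t)"
      by (auto intro!: derivative_eq_intros)
    from has_derivative_compose[OF this C1_gradD(1)[OF C inOm[OF that]]]
    show ?thesis unfolding has_field_derivative_def
      by (rule has_derivative_eq_rhs) (simp add: algebra_simps fun_eq_iff)
  qed
  obtain t where t: "\<rho> < t" "t < 1"
    "f (1 *\<^sub>R x) - f (\<rho> *\<^sub>R x) = (1 - \<rho>) * (f1 (t *\<^sub>R x) * x $ 1 + f2 (t *\<^sub>R x) * x $ 2)"
    using MVT2[OF \<rho>(2), of "\<lambda>t. f (t *\<^sub>R x)"
        "\<lambda>t. f1 (t *\<^sub>R x) * x $ 1 + f2 (t *\<^sub>R x) * x $ 2"] d by blast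
  let ?G = "f1 (t *\<^sub>R x) * x $ 1 + f2 (t *\<^sub>R x) * x $ 2"
  have "t *\<^sub>R x \<in> Om" using t by (intro inOm) simp
  then have "\<bar>(t *\<^sub>R x) $ 1 * f1 (t *\<^sub>R x) + (t *\<^sub>R x) $ 2 * f2 (t *\<^sub>R x)\<bar> \<le> B"
    using t \<rho> mult_right_mono[of t 1 "norm x"] by (intro E) auto
  also have "(t *\<^sub>R x) $ 1 * f1 (t *\<^sub>R x) + (t *\<^sub>R x) $ 2 * f2 (t *\<^sub>R x) = t * ?G"
    by (simp add: algebra_simps)
  finally have "t * \<bar>?G\<bar> \<le> B" using t \<rho> by (simp add: abs_mult)
  moreover have "\<rho> * \<bar>?G\<bar> \<le> t * \<bar>?G\<bar>" using t by (intro mult_right_mono) auto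
  ultimately have G: "\<rho> * \<bar>?G\<bar> \<le> B" by linarith
  then have B: "0 \<le> B" using \<rho> by (meson abs_ge_zero less_imp_le mult_nonneg_nonneg order_trans)
  have "(1 - \<rho>) * \<bar>?G\<bar> = (1 / \<rho> - 1) * (\<rho> * \<bar>?G\<bar>)" using \<rho> by (simp add: field_simps)
  also have "\<dots> \<le> (r - 1) * B"
  proof (rule mult_mono)
    show "1 / \<rho> - 1 \<le> r - 1" using \<rho> \<delta> r by (simp add: \<rho>_def field_simps)
  qed (use G r \<rho> in auto)
  finally have 1: "\<bar>f x - f (\<rho> *\<^sub>R x)\<bar> \<le> B * (r - 1)"
    using t(3) \<rho> by (simp add: abs_mult mult.commute)
  have "\<bar>f (\<rho> *\<^sub>R x)\<bar> \<le> c * (norm (\<rho> *\<^sub>R x) - 1)"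
    by (rule near) (use \<rho> \<delta> in \<open>simp_all add: r_def[symmetric]\<close>)
  also have "\<dots> = c * \<delta>" using \<rho> by (simp add: r_def[symmetric])
  also have "\<dots> \<le> e" using \<delta> by (simp add: algebra_simps)
  finally show "\<bar>f x\<bar> \<le> B * (norm x - 1) + e" using 1 by (simp add: r_def[symmetric])
qed

definition annulus :: "real \<Rightarrow> real \<Rightarrow> (real^2) set" where
  "annulus s0 s1 = {x. s0 \<le> sqn x \<and> sqn x \<le> s1}"

lemma compact_annulus: "compact (annulus s0 s1)"
proof -
  have "closed (annulus s0 s1)"
    unfolding annulus_def by (intro closed_Collect_conj closed_Collect_le continuous_intros)
  moreover have "bounded (annulus s0 s1)"
    unfolding bounded_iff
  proof (intro exI[of _ "sqrt s1"] ballI)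
    fix x assume "x \<in> annulus s0 s1"
    then have "(norm x)\<^sup>2 \<le> s1" by (simp add: annulus_def sqn_norm)
    then show "norm x \<le> sqrt s1" by (rule real_le_rsqrt)
  qed
  ultimately show ?thesis by (simp add: compact_eq_bounded_closed)
qed

lemma one_less_sqn: "1 < sqn x \<longleftrightarrow> 1 < norm x"
  unfolding sqn_norm using power_mono_iff[of "norm x" 1 2] by (simp flip: not_le)

lemma annulus_subset_Om: "1 < s0 \<Longrightarrow> annulus s0 s1 \<subseteq> Om"
  by (auto simp: annulus_def one_less_sqn[symmetric])

lemma integral_lborel_rot:
  fixes g :: "real^2 \<Rightarrow> real"
  assumes "g \<in> borel_measurable borel"
  shows "(\<integral>x. g (rot t x) \<partial>lborel) = (\<integral>x. g x \<partial>lborel)"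
proof -
  have m: "rot t \<in> borel_measurable borel"
    by (intro borel_measurable_continuous_onI continuous_intros)
  have "(\<integral>x. g x \<partial>lborel) = (\<integral>x. g x \<partial>(distr lborel borel (rot t)))"
    by (simp add: lborel_distr_rot)
  also have "\<dots> = (\<integral>x. g (rot t x) \<partial>lborel)"
    using assms m by (subst integral_distr) auto
  finally show ?thesis ..
qed

text \<open>A circle integral weighs a function equally over the circle, so it may be removed under the
  integral against a radial weight.\<close>

lemma integral_annulus_circle_int:
  assumes f: "continuous_on Om f" and w: "continuous_on UNIV w" and s0: "1 < s0"
  shows "(LINT x:annulus s0 s1|lborel. w (sqn x) * circle_int (\<lambda>t. 1) f x)
    = 2 * pi * (LINT x:annulus s0 s1|lborel. w (sqn x) * f x)"
proof -
  let ?K = "annulus s0 s1" and ?T = "{0..2 * pi}"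
  note KOm = annulus_subset_Om[OF s0, of s1]
  define g where "g x = indicator ?K x *\<^sub>R (w (sqn x) * f x)" for x
  have ws: "continuous_on S (\<lambda>x. w (sqn x))" for S
    by (intro continuous_on_compose2[OF w] continuous_intros) auto
  have Kb: "?K \<in> sets borel" using compact_annulus by (rule borel_compact)
  have gm: "g \<in> borel_measurable borel"
    unfolding g_def by (intro borel_measurable_continuous_on_indicator continuous_intros ws
        continuous_on_subset[OF f KOm] Kb)
  have gr: "g (rot t x) = indicator ?K x * (w (sqn x) * f (rot t x))" for t x
    by (simp add: g_def annulus_def indicator_def)
  define F where "F = (\<lambda>x t. indicator (?K \<times> ?T) (x, t) *\<^sub>R (w (sqn x) * f (rot t x)))"
  have Ft: "F x t = indicator ?T t * g (rot t x)" for x t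
    by (simp add: F_def gr indicator_times)
  have "integrable lborel (\<lambda>p. indicator (?K \<times> ?T) p *\<^sub>R (w (sqn (fst p)) * f (rot (snd p) (fst p))))"
    by (intro borel_integrable_compact compact_Times compact_annulus compact_Icc continuous_intros
        continuous_on_compose2[OF f] continuous_on_compose2[OF ws[of UNIV]]) (use KOm in auto)
  then have Fi: "integrable (lborel \<Otimes>\<^sub>M lborel) (case_prod F)"
    by (simp add: F_def lborel_prod split_beta')
  have c: "(LINT t|lborel. F x t) = indicator ?K x * (w (sqn x) * circle_int (\<lambda>t. 1) f x)" for x
  proof (cases "x \<in> ?K")
    case True
    have c: "continuous_on {0..2*pi} (\<lambda>t. 1 * f (rot t x))"
      by (rule continuous_on_circle[OF f]) (use True KOm in auto)
    have "(LINT t|lborel. F x t) = w (sqn x) * (LINT t:?T|lborel. f (rot t x))"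
      using True by (simp add: F_def indicator_times set_lebesgue_integral_def mult.left_commute
          flip: integral_mult_right_zero)
    also have "(LINT t:?T|lborel. f (rot t x)) = circle_int (\<lambda>t. 1) f x"
      unfolding circle_int_def using c
      by (subst set_borel_integral_eq_integral) (auto intro: set_integrable_continuous_compact)
    finally show ?thesis using True by simp
  qed (simp add: F_def)
  have "(LINT x:?K|lborel. w (sqn x) * circle_int (\<lambda>t. 1) f x) = (LINT x|lborel. LINT t|lborel. F x t)"
    unfolding c by (simp add: set_lebesgue_integral_def)
  also have "\<dots> = (LINT t|lborel. LINT x|lborel. F x t)"
    by (rule lborel_pair.Fubini_integral[OF Fi, symmetric])
  also have "\<dots> = (LINT t|lborel. indicator ?T t * (LINT x|lborel. g x))"
    unfolding Ft by (simp add: integral_lborel_rot[OF gm])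
  also have "\<dots> = 2 * pi * (LINT x|lborel. g x)"
    by simp
  also have "(LINT x|lborel. g x) = (LINT x:?K|lborel. w (sqn x) * f x)"
    by (simp add: g_def set_lebesgue_integral_def)
  finally show ?thesis .
qed

section \<open>Perturbations of the rotating flow\<close>

text \<open>Here dij stands for the i-th partial derivative of the j-th component of v, and lkij for the
  k-th partial derivative of dij. The rotating flow is a / 2 times (x2, - x1), and the centrifugal term
  (u0.grad) u0 is part of grad P. Regularity up to the circle enters through the last two
  assumptions only.\<close>

locale rotating_perturbation =
  fixes a :: real and v :: "real^2 \<Rightarrow> real^2"
    and d11 d21 d12 d22 l111 l211 l121 l221 l112 l212 l122 l222 P P1 P2 :: "real^2 \<Rightarrow> real"
    and C0 :: real
  assumes v1: "C1_grad Om (\<lambda>x. v x $ 1) d11 d21"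
    and v2: "C1_grad Om (\<lambda>x. v x $ 2) d12 d22"
    and d11: "C1_grad Om d11 l111 l211"
    and d21: "C1_grad Om d21 l121 l221"
    and d12: "C1_grad Om d12 l112 l212"
    and d22: "C1_grad Om d22 l122 l222"
    and P: "C1_grad Om P P1 P2"
    and div0: "x \<in> Om \<Longrightarrow> d11 x + d22 x = 0"
    and eq1: "x \<in> Om \<Longrightarrow> v x $ 1 * d11 x + v x $ 2 * d21 x + a / 2 * (x $ 2 * d11 x - x $ 1 * d21 x)
       + a / 2 * v x $ 2 + P1 x = l111 x + l221 x"
    and eq2: "x \<in> Om \<Longrightarrow> v x $ 1 * d12 x + v x $ 2 * d22 x + a / 2 * (x $ 2 * d12 x - x $ 1 * d22 x)
       - a / 2 * v x $ 1 + P2 x = l112 x + l222 x"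
    and near_v: "1 < norm x \<Longrightarrow> norm x \<le> 2 \<Longrightarrow> norm (v x) \<le> C0 * (norm x - 1)"
    and near_d: "1 < norm x \<Longrightarrow> norm x \<le> 2 \<Longrightarrow>
       \<bar>d11 x\<bar> \<le> C0 \<and> \<bar>d21 x\<bar> \<le> C0 \<and> \<bar>d12 x\<bar> \<le> C0 \<and> \<bar>d22 x\<bar> \<le> C0"
begin

text \<open>In polar coordinates, rad and ang are r times the radial and the angular component of v.\<close>

definition rad :: "real^2 \<Rightarrow> real" where "rad x = x $ 1 * v x $ 1 + x $ 2 * v x $ 2"
definition ang :: "real^2 \<Rightarrow> real" where "ang x = x $ 1 * v x $ 2 - x $ 2 * v x $ 1"

text \<open>A primitive of - rad along circles; H1 and H2 are its partial derivatives, obtained from the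
  angular derivative - rad and the radial derivative ang - ang_mean.\<close>

definition h :: "real^2 \<Rightarrow> real" where "h x = - (1 / (2 * pi)) * circle_int (\<lambda>t. t) rad x"
definition ang_mean :: "real^2 \<Rightarrow> real" where "ang_mean x = 1 / (2 * pi) * circle_int (\<lambda>t. 1) ang x"
definition V :: "real^2 \<Rightarrow> real" where "V = circle_int (\<lambda>t. 1) (\<lambda>x. norm (v x))"
definition H1 :: "real^2 \<Rightarrow> real" where
  "H1 x = ((ang x - ang_mean x) * x $ 1 + rad x * x $ 2) / sqn x"
definition H2 :: "real^2 \<Rightarrow> real" where
  "H2 x = ((ang x - ang_mean x) * x $ 2 - rad x * x $ 1) / sqn x"

abbreviation rad_d1 where "rad_d1 \<equiv> \<lambda>x. v x $ 1 + x $ 1 * d11 x + x $ 2 * d12 x"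
abbreviation rad_d2 where "rad_d2 \<equiv> \<lambda>x. v x $ 2 + x $ 1 * d21 x + x $ 2 * d22 x"
abbreviation ang_d1 where "ang_d1 \<equiv> \<lambda>x. v x $ 2 + x $ 1 * d12 x - x $ 2 * d11 x"
abbreviation ang_d2 where "ang_d2 \<equiv> \<lambda>x. x $ 1 * d22 x - x $ 2 * d21 x - v x $ 1"

lemma rad_C1: "C1_grad Om rad rad_d1 rad_d2"
  unfolding rad_def[abs_def]
  by (rule C1_grad_cong, (rule C1_grad_intros v1 v2)+) (auto simp: algebra_simps)

lemma ang_C1: "C1_grad Om ang ang_d1 ang_d2"
  unfolding ang_def[abs_def]
  by (rule C1_grad_cong, (rule C1_grad_intros v1 v2)+) (auto simp: algebra_simps)

lemma C1_grad_cmult: "C1_grad S f f1 f2 \<Longrightarrow> C1_grad S (\<lambda>x. c * f x) (\<lambda>x. c * f1 x) (\<lambda>x. c * f2 x)"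
  by (rule C1_grad_cong, (rule C1_grad_intros | assumption)+) auto

lemma cont_v: "continuous_on Om v"
  using C1_gradD(4)[OF v1] C1_gradD(4)[OF v2]
  by (subst continuous_on_componentwise) (auto simp: Basis_vec_def inner_axis; metis exhaust_2)

lemma cont_rad: "continuous_on Om rad" and cont_ang: "continuous_on Om ang"
  using C1_gradD(4)[OF rad_C1] C1_gradD(4)[OF ang_C1] .

lemma rad_abs: "\<bar>rad x\<bar> \<le> norm x * norm (v x)"
  using Cauchy_Schwarz_ineq2[of x "v x"] by (simp add: rad_def inner_vec_def sum_2)

lemma ang_abs: "\<bar>ang x\<bar> \<le> norm x * norm (v x)"
proof -
  have "ang x = vector [- (x $ 2), x $ 1] \<bullet> v x" by (simp add: ang_def inner_vec_def sum_2)
  moreover have "norm (vector [- (x $ 2), x $ 1] :: real^2) = norm x"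
    by (simp add: norm_vec_def L2_set_def sum_2)
  ultimately show ?thesis using Cauchy_Schwarz_ineq2[of "vector [- (x $ 2), x $ 1]" "v x"] by simp
qed

text \<open>Because v is divergence free, the radial derivative of its radial part is an angular
  derivative.\<close>

lemma radial_derivative_rad:
  assumes "x \<in> Om"
  shows "x $ 1 * rad_d1 x + x $ 2 * rad_d2 x = - (x $ 1 * ang_d2 x - x $ 2 * ang_d1 x)"
proof -
  have "d22 x = - d11 x" using div0[OF assms] by simp
  then show ?thesis by (simp add: algebra_simps)
qed

lemma circle_int_radial_derivative_rad:
  assumes x: "x \<in> Om" and k: "continuous_on UNIV \<kappa>"
  shows "x $ 1 * circle_grad1 \<kappa> rad_d1 rad_d2 x + x $ 2 * circle_grad2 \<kappa> rad_d1 rad_d2 x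
    = - circle_int \<kappa> (\<lambda>y. y $ 1 * ang_d2 y - y $ 2 * ang_d1 y) x"
  unfolding circle_grad_polar(2)[OF rad_C1 x k] circle_int_def integral_neg[symmetric]
proof (rule integral_cong)
  fix t
  have "rot t x \<in> Om" using x by simp
  from radial_derivative_rad[OF this]
  show "\<kappa> t * (rot t x $ 1 * rad_d1 (rot t x) + rot t x $ 2 * rad_d2 (rot t x))
      = - (\<kappa> t * (rot t x $ 1 * ang_d2 (rot t x) - rot t x $ 2 * ang_d1 (rot t x)))"
    by (simp only: mult_minus_right)
qed

end

lemma circle_int_const_bound:
  assumes f: "continuous_on Om f" and x: "x \<in> Om" and k: "continuous_on UNIV \<kappa>"
    and le: "\<And>t. 0 \<le> t \<Longrightarrow> t \<le> 2 * pi \<Longrightarrow> \<bar>\<kappa> t * f (rot t x)\<bar> \<le> B"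
  shows "\<bar>circle_int \<kappa> f x\<bar> \<le> 2 * pi * B"
proof -
  have "\<bar>circle_int \<kappa> f x\<bar> \<le> circle_int (\<lambda>t. 1) (\<lambda>y. B) x"
    by (rule circle_int_abs_le) (use assms in auto)
  then show ?thesis by (simp add: circle_int_def)
qed

context rotating_perturbation
begin

text \<open>The radial derivative of the flux is a circle integral of an angular derivative, hence zero,
  and the flux vanishes on the unit circle.\<close>

lemma flux_eq_0:
  assumes x: "x \<in> Om"
  shows "circle_int (\<lambda>t. 1) rad x = 0"
proof -
  have "\<bar>circle_int (\<lambda>t. 1) rad x\<bar> \<le> 0 * (norm x - 1)"
  proof (rule radial_bound[OF C1_grad_circle_int[OF rad_C1 continuous_on_const]])
    fix y :: "real^2" assume y: "1 < norm y" "norm y \<le> 2"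
    have "\<bar>circle_int (\<lambda>t. 1) rad y\<bar> \<le> 2 * pi * (2 * (C0 * (norm y - 1)))"
    proof (rule circle_int_const_bound[OF cont_rad])
      fix t
      have "\<bar>rad (rot t y)\<bar> \<le> norm (rot t y) * norm (v (rot t y))" by (rule rad_abs)
      also have "\<dots> \<le> 2 * (C0 * (norm (rot t y) - 1))"
        using y by (intro mult_mono near_v) auto
      finally show "\<bar>1 * rad (rot t y)\<bar> \<le> 2 * (C0 * (norm y - 1))" by simp
    qed (use y in auto)
    then show "\<bar>circle_int (\<lambda>t. 1) rad y\<bar> \<le> 4 * pi * C0 * (norm y - 1)" by simp
  next
    fix y :: "real^2" assume "1 < norm y" "norm y \<le> norm x"
    then have y: "y \<in> Om" by simp
    show "\<bar>y $ 1 * circle_grad1 (\<lambda>t. 1) rad_d1 rad_d2 y + y $ 2 * circle_grad2 (\<lambda>t. 1) rad_d1 rad_d2 y\<bar> \<le> 0"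
      unfolding circle_int_radial_derivative_rad[OF y continuous_on_const]
        circle_int_angular_derivative(1)[OF ang_C1 y] by simp
  qed (rule x)
  then show ?thesis by simp
qed

lemma sqn_pos: "x \<in> Om \<Longrightarrow> 0 < sqn x"
  using one_less_sqn[of x] by simp

lemma H_radial: "x \<in> Om \<Longrightarrow> x $ 1 * H1 x + x $ 2 * H2 x = ang x - ang_mean x"
  and H_angular: "x \<in> Om \<Longrightarrow> x $ 1 * H2 x - x $ 2 * H1 x = - rad x"
proof -
  assume x: "x \<in> Om"
  have s: "sqn x \<noteq> 0" using sqn_pos[OF x] by simp
  have "x $ 1 * H1 x + x $ 2 * H2 x = (ang x - ang_mean x) * sqn x / sqn x"
    unfolding H1_def H2_def by (simp add: sqn_def power2_eq_square algebra_simps flip: add_divide_distrib diff_divide_distrib)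
  then show "x $ 1 * H1 x + x $ 2 * H2 x = ang x - ang_mean x" using s by simp
  have "x $ 1 * H2 x - x $ 2 * H1 x = - rad x * sqn x / sqn x"
    unfolding H1_def H2_def by (simp add: sqn_def power2_eq_square algebra_simps flip: add_divide_distrib diff_divide_distrib)
  then show "x $ 1 * H2 x - x $ 2 * H1 x = - rad x" using s by simp
qed

text \<open>Integration by parts on the circle gives the angular derivative - rad, because rad has
  mean zero. The radial derivative of rad is minus the angular derivative of ang, which gives
  ang - ang_mean in the same way.\<close>

lemma h_C1: "C1_grad Om h H1 H2"
proof -
  let ?F1 = "circle_grad1 (\<lambda>t. t) rad_d1 rad_d2" and ?F2 = "circle_grad2 (\<lambda>t. t) rad_d1 rad_d2"
  have "C1_grad Om h (\<lambda>x. - (1 / (2 * pi)) * ?F1 x) (\<lambda>x. - (1 / (2 * pi)) * ?F2 x)"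
    unfolding h_def[abs_def]
    by (intro C1_grad_cmult C1_grad_circle_int rad_C1 continuous_intros)
  then show ?thesis
  proof (rule C1_grad_cong)
    fix x assume x: "x \<in> Om"
    define F1 F2 where "F1 = ?F1 x" and "F2 = ?F2 x"
    have "x $ 1 * F2 - x $ 2 * F1 = 2 * pi * rad x"
      unfolding F1_def F2_def circle_grad_polar(1)[OF rad_C1 x continuous_on_id]
        circle_int_angular_derivative(2)[OF rad_C1 x] flux_eq_0[OF x] by simp
    moreover have "x $ 1 * F1 + x $ 2 * F2 = - (2 * pi * (ang x - ang_mean x))"
      unfolding F1_def F2_def ang_mean_def circle_int_radial_derivative_rad[OF x continuous_on_id]
        circle_int_angular_derivative(2)[OF ang_C1 x] by (simp add: algebra_simps)
    ultimately have mx: "rad x = 1 / (2 * pi) * (x $ 1 * F2 - x $ 2 * F1)"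
      and E: "- (1 / (2 * pi)) * (x $ 1 * F1 + x $ 2 * F2) = ang x - ang_mean x" by simp_all
    have s: "sqn x \<noteq> 0" using sqn_pos[OF x] by simp
    have "H1 x * sqn x = (ang x - ang_mean x) * x $ 1 + rad x * x $ 2"
      using s by (simp add: H1_def)
    also have "\<dots> = (- (1 / (2 * pi)) * F1) * sqn x"
      unfolding E[symmetric] mx sqn_def by (simp add: power2_eq_square algebra_simps)
    finally have "H1 x * sqn x = (- (1 / (2 * pi)) * F1) * sqn x" .
    then have "- (1 / (2 * pi)) * F1 = H1 x" using s by (metis mult_right_cancel)
    then show "- (1 / (2 * pi)) * ?F1 x = H1 x" unfolding F1_def .
    have "H2 x * sqn x = (ang x - ang_mean x) * x $ 2 - rad x * x $ 1"
      using s by (simp add: H2_def)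
    also have "\<dots> = (- (1 / (2 * pi)) * F2) * sqn x"
      unfolding E[symmetric] mx sqn_def by (simp add: power2_eq_square algebra_simps)
    finally have "H2 x * sqn x = (- (1 / (2 * pi)) * F2) * sqn x" .
    then have "- (1 / (2 * pi)) * F2 = H2 x" using s by (metis mult_right_cancel)
    then show "- (1 / (2 * pi)) * ?F2 x = H2 x" unfolding F2_def .
  qed
qed

lemma V_nonneg: "x \<in> Om \<Longrightarrow> 0 \<le> V x"
  unfolding V_def circle_int_def
  by (rule integral_nonneg, rule circle_integrable) (auto intro!: continuous_intros cont_v)

lemma h_le_V: assumes x: "x \<in> Om" shows "\<bar>h x\<bar> \<le> norm x * V x"
proof -
  have "\<bar>circle_int (\<lambda>t. t) rad x\<bar> \<le> circle_int (\<lambda>t. 1) (\<lambda>y. (2 * pi * norm x) * norm (v y)) x"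
  proof (rule circle_int_abs_le[OF cont_rad x])
    fix t :: real assume t: "0 \<le> t" "t \<le> 2 * pi"
    have "\<bar>t * rad (rot t x)\<bar> \<le> (2 * pi) * (norm (rot t x) * norm (v (rot t x)))"
      unfolding abs_mult using t by (intro mult_mono rad_abs) auto
    then show "\<bar>t * rad (rot t x)\<bar> \<le> 1 * ((2 * pi * norm x) * norm (v (rot t x)))"
      by (simp add: mult.assoc)
  qed (intro continuous_intros cont_v)+
  also have "\<dots> = 2 * pi * norm x * V x" unfolding V_def by (rule circle_int_cmult)
  finally show ?thesis by (simp add: h_def abs_mult field_simps)
qed

lemma ang_mean_le_V: assumes x: "x \<in> Om" shows "\<bar>ang_mean x\<bar> \<le> norm x * V x"
proof -
  have "\<bar>circle_int (\<lambda>t. 1) ang x\<bar> \<le> circle_int (\<lambda>t. 1) (\<lambda>y. norm x * norm (v y)) x"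
  proof (rule circle_int_abs_le[OF cont_ang x])
    show "\<bar>1 * ang (rot t x)\<bar> \<le> 1 * (norm x * norm (v (rot t x)))" for t
      using ang_abs[of "rot t x"] by simp
  qed (intro continuous_intros cont_v)+
  also have "\<dots> = norm x * V x" unfolding V_def by (rule circle_int_cmult)
  finally have "\<bar>ang_mean x\<bar> \<le> 1 / (2 * pi) * (norm x * V x)"
    by (simp add: ang_mean_def abs_mult field_simps)
  also have "\<dots> \<le> 1 * (norm x * V x)"
    using V_nonneg[OF x] pi_ge_two by (intro mult_right_mono) (auto simp: field_simps)
  finally show ?thesis by simp
qed

lemma H_le_V:
  assumes x: "x \<in> Om"
  shows "\<bar>H1 x\<bar> \<le> 2 * norm (v x) + V x" "\<bar>H2 x\<bar> \<le> 2 * norm (v x) + V x"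
proof -
  define r where "r = norm x"
  have r: "0 < r" "sqn x = r * r" using x by (auto simp: r_def sqn_norm power2_eq_square intro: order.strict_trans[of 0 1])
  have c: "\<bar>x $ 1\<bar> \<le> r" "\<bar>x $ 2\<bar> \<le> r" unfolding r_def by (rule component_le_norm_cart)+
  have b: "\<bar>ang x - ang_mean x\<bar> \<le> r * (norm (v x) + V x)" "\<bar>rad x\<bar> \<le> r * norm (v x)"
    using ang_abs[of x] rad_abs[of x] ang_mean_le_V[OF x] unfolding r_def by (auto simp: algebra_simps)
  have *: "\<bar>p / sqn x\<bar> \<le> 2 * norm (v x) + V x" if "\<bar>p\<bar> \<le> r * (norm (v x) + V x) * r + r * norm (v x) * r" for p
    using that r by (simp add: field_simps abs_mult)
  have "\<bar>(ang x - ang_mean x) * x $ 1 + rad x * x $ 2\<bar> \<le> \<bar>ang x - ang_mean x\<bar> * \<bar>x $ 1\<bar> + \<bar>rad x\<bar> * \<bar>x $ 2\<bar>"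
    by (metis abs_mult abs_triangle_ineq)
  also have "\<dots> \<le> r * (norm (v x) + V x) * r + r * norm (v x) * r"
    using b c r V_nonneg[OF x] by (intro add_mono mult_mono) auto
  finally show "\<bar>H1 x\<bar> \<le> 2 * norm (v x) + V x" unfolding H1_def by (rule *)
  have "\<bar>(ang x - ang_mean x) * x $ 2 - rad x * x $ 1\<bar> \<le> \<bar>ang x - ang_mean x\<bar> * \<bar>x $ 2\<bar> + \<bar>rad x\<bar> * \<bar>x $ 1\<bar>"
    by (metis abs_mult abs_triangle_ineq4)
  also have "\<dots> \<le> r * (norm (v x) + V x) * r + r * norm (v x) * r"
    using b c r V_nonneg[OF x] by (intro add_mono mult_mono) auto
  finally show "\<bar>H2 x\<bar> \<le> 2 * norm (v x) + V x" unfolding H2_def by (rule *)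
qed

lemma C0_nonneg: "0 \<le> C0"
proof -
  have "norm (vector [2, 0] :: real^2) = 2" by (simp add: norm_vec_def L2_set_def sum_2)
  then have "norm (v (vector [2, 0] :: real^2)) \<le> C0 * (2 - 1)" using near_v[of "vector [2, 0] :: real^2"] by simp
  from order_trans[OF norm_ge_zero this] show ?thesis by simp
qed

lemma near_V:
  assumes x: "1 < norm x" "norm x \<le> 2"
  shows "V x \<le> 2 * pi * (C0 * (norm x - 1))"
proof -
  have "\<bar>V x\<bar> \<le> 2 * pi * (C0 * (norm x - 1))"
    unfolding V_def
  proof (rule circle_int_const_bound)
    show "\<bar>1 * norm (v (rot t x))\<bar> \<le> C0 * (norm x - 1)" for t
      using near_v[of "rot t x"] x by simp
  qed (use x in \<open>auto intro!: continuous_intros cont_v\<close>)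
  then show ?thesis by simp
qed

text \<open>Quadratic decay at the circle, because the radial derivative of h is controlled by v itself,
  which vanishes linearly.\<close>

lemma near_h:
  assumes x: "1 < norm x" "norm x \<le> 2"
  shows "\<bar>h x\<bar> \<le> 4 * C0 * (norm x - 1) * (norm x - 1)"
proof (rule radial_bound[OF h_C1])
  fix y :: "real^2" assume y: "1 < norm y" "norm y \<le> 2"
  have "\<bar>h y\<bar> \<le> norm y * V y" using y by (intro h_le_V) simp
  also have "\<dots> \<le> 2 * (2 * pi * (C0 * (norm y - 1)))"
    using y by (intro mult_mono near_V V_nonneg) auto
  finally show "\<bar>h y\<bar> \<le> 4 * pi * C0 * (norm y - 1)" by simp
next
  fix y :: "real^2" assume y: "1 < norm y" "norm y \<le> norm x"
  have nb: "\<bar>ang z\<bar> \<le> 2 * (C0 * (norm x - 1))" if z: "norm z = norm y" for z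
  proof -
    have "\<bar>ang z\<bar> \<le> norm z * norm (v z)" by (rule ang_abs)
    also have "\<dots> \<le> 2 * (C0 * (norm z - 1))" using y x z by (intro mult_mono near_v) auto
    also have "\<dots> \<le> 2 * (C0 * (norm x - 1))" using y z C0_nonneg by (intro mult_left_mono) auto
    finally show ?thesis .
  qed
  have "\<bar>circle_int (\<lambda>t. 1) ang y\<bar> \<le> 2 * pi * (2 * (C0 * (norm x - 1)))"
    by (rule circle_int_const_bound[OF cont_ang]) (use y nb in auto)
  then have "\<bar>ang_mean y\<bar> \<le> 2 * (C0 * (norm x - 1))"
    by (simp add: ang_mean_def abs_mult field_simps)
  then show "\<bar>y $ 1 * H1 y + y $ 2 * H2 y\<bar> \<le> 4 * C0 * (norm x - 1)"
    using nb[of y] H_radial[of y] y by simp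
qed (use x in auto)

definition Dsq :: "real^2 \<Rightarrow> real" where
  "Dsq x = (d11 x)\<^sup>2 + (d12 x)\<^sup>2 + (d21 x)\<^sup>2 + (d22 x)\<^sup>2"

text \<open>The error term for a cut-off eta with gradient k (|x|^2) x and for k' the derivative of k. The
  vector (b1, b2) is k J x, with J the rotation by a right angle, and Wij is the i-th partial derivative of h bj.\<close>

definition Q :: "(real \<Rightarrow> real) \<Rightarrow> (real \<Rightarrow> real) \<Rightarrow> real^2 \<Rightarrow> real" where
  "Q k k' x = (let s = sqn x; y1 = x $ 1; y2 = x $ 2; u1 = v x $ 1; u2 = v x $ 2;
     b1 = - (k s * y2); b2 = k s * y1;
     W11 = H1 x * b1 - h x * (2 * y1 * k' s * y2);
     W21 = H2 x * b1 - h x * (2 * y2 * k' s * y2 + k s);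
     W12 = H1 x * b2 + h x * (2 * y1 * k' s * y1 + k s);
     W22 = H2 x * b2 + h x * (2 * y2 * k' s * y1)
   in k s * (y1 * (u1 * d11 x + u2 * d12 x) + y2 * (u1 * d21 x + u2 * d22 x))
     + (d11 x * W11 + d12 x * W12 + d21 x * W21 + d22 x * W22)
     - (u1\<^sup>2 + u2\<^sup>2) / 2 * k s * rad x
     - (u1\<^sup>2 * W11 + u1 * u2 * (W12 + W21) + u2\<^sup>2 * W22)
     - a / 2 * k s * rad x * ang x)"

text \<open>Multiplied by the test field w = eta v + k h J x, the equation of motion shows that the integrand
  is the divergence of a compactly supported field. The contribution of u0 reduces to an angular derivative and
  the last term of Q, because the angular derivative of h is - rad.\<close>

lemma energy_identity:
  assumes g: "\<And>s. (g has_real_derivative k s / 2) (at s)"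
    and k: "\<And>s. (k has_real_derivative k' s) (at s)" and k': "continuous_on UNIV k'"
    and s0: "1 < s0" and out: "\<And>s. s < s0 \<or> s1 < s \<Longrightarrow> g s = 0 \<and> k s = 0"
  shows "(LINT x:annulus s0 s1|lborel. g (sqn x) * Dsq x + Q k k' x) = 0"
    and "set_integrable lborel (annulus s0 s1) (\<lambda>x. g (sqn x) * Dsq x + Q k k' x)"
proof -
  have kc: "continuous_on UNIV (\<lambda>s. k s / 2)"
    by (intro continuous_intros continuous_at_imp_continuous_on ballI DERIV_isCont[OF k]) simp
  note G = C1_grad_radial[of g, OF g kc, of Om] and K = C1_grad_radial[of k, OF k k', of Om]
  note rules = C1_grad_intros v1 v2 d11 d12 d21 d22 P h_C1 G K rad_C1 ang_C1
  let ?w1 = "\<lambda>x. g (sqn x) * v x $ 1 - k (sqn x) * h x * x $ 2"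
  let ?w2 = "\<lambda>x. g (sqn x) * v x $ 2 + k (sqn x) * h x * x $ 1"
  let ?vv = "\<lambda>x. v x $ 1 * v x $ 1 + v x $ 2 * v x $ 2"
  \<comment> \<open>The potential of the angular derivatives that the rotating flow contributes.\<close>
  let ?A = "\<lambda>x. (a / 2) * (1/2 * g (sqn x) * ?vv x + k (sqn x) * ang x * h x - k (sqn x) * h x * h x)"
  let ?X1 = "\<lambda>x. d11 x * ?w1 x + d12 x * ?w2 x - v x $ 1 * (v x $ 1 * ?w1 x + v x $ 2 * ?w2 x)
     - P x * ?w1 x + 1/2 * g (sqn x) * v x $ 1 * ?vv x - x $ 2 * ?A x"
  let ?X2 = "\<lambda>x. d21 x * ?w1 x + d22 x * ?w2 x - v x $ 2 * (v x $ 1 * ?w1 x + v x $ 2 * ?w2 x)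
     - P x * ?w2 x + 1/2 * g (sqn x) * v x $ 2 * ?vv x + x $ 1 * ?A x"
  have "\<exists>X11 X12 X21 X22. C1_grad Om ?X1 X11 X12 \<and> C1_grad Om ?X2 X21 X22 \<and>
      (\<forall>x\<in>Om. X11 x + X22 x = g (sqn x) * Dsq x + Q k k' x)"
  proof ((rule exI)+, rule conjI, (rule rules)+, rule conjI, (rule rules)+, rule ballI, goal_cases)
    case (1 x)
    have e: "l111 x + l221 x - (v x $ 1 * d11 x + v x $ 2 * d21 x + a / 2 * (x $ 2 * d11 x - x $ 1 * d21 x)
       + a / 2 * v x $ 2 + P1 x) = 0"
      "l112 x + l222 x - (v x $ 1 * d12 x + v x $ 2 * d22 x + a / 2 * (x $ 2 * d12 x - x $ 1 * d22 x)
       - a / 2 * v x $ 1 + P2 x) = 0"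
      "d11 x + d22 x = 0" "x $ 1 * H2 x - x $ 2 * H1 x + rad x = 0"
      using eq1[OF 1] eq2[OF 1] div0[OF 1] H_angular[OF 1] by simp_all
    \<comment> \<open>The divergence minus the integrand is a combination of the equations in e; the coefficients are read off from the product rule.\<close>
    have "0 = ?w1 x * (l111 x + l221 x - (v x $ 1 * d11 x + v x $ 2 * d21 x + a / 2 * (x $ 2 * d11 x - x $ 1 * d21 x)
       + a / 2 * v x $ 2 + P1 x))
      + ?w2 x * (l112 x + l222 x - (v x $ 1 * d12 x + v x $ 2 * d22 x + a / 2 * (x $ 2 * d12 x - x $ 1 * d22 x)
       - a / 2 * v x $ 1 + P2 x))
      + (1/2 * g (sqn x) * ?vv x - P x * g (sqn x) - (v x $ 1 * ?w1 x + v x $ 2 * ?w2 x)) * (d11 x + d22 x)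
      + k (sqn x) * (a / 2 * (ang x - 2 * h x) - P x) * (x $ 1 * H2 x - x $ 2 * H1 x + rad x)"
      unfolding e by simp
    then show ?case
      unfolding Q_def Let_def Dsq_def rad_def ang_def
      by (simp add: algebra_simps power2_eq_square add_divide_distrib diff_divide_distrib)
  qed
  then obtain X11 X12 X21 X22 where X: "C1_grad Om ?X1 X11 X12" "C1_grad Om ?X2 X21 X22"
    and eq: "\<And>x. x \<in> Om \<Longrightarrow> X11 x + X22 x = g (sqn x) * Dsq x + Q k k' x" by blast
  let ?K = "annulus s0 s1"
  have KOm: "?K \<subseteq> Om" by (rule annulus_subset_Om[OF s0])
  have z: "g (sqn x) = 0 \<and> k (sqn x) = 0" if "x \<in> Om - ?K" for x
    using that by (intro out) (auto simp: annulus_def)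
  have "(LINT x:?K|lborel. X11 x) = 0"
    by (rule integral_partial_derivative_eq_0(1)[OF open_Om compact_annulus KOm X(1)]) (simp add: z)
  moreover have "(LINT x:?K|lborel. X22 x) = 0"
    by (rule integral_partial_derivative_eq_0(2)[OF open_Om compact_annulus KOm X(2)]) (simp add: z)
  moreover have i: "set_integrable lborel ?K X11" "set_integrable lborel ?K X22"
    by (intro set_integrable_continuous_compact compact_annulus continuous_on_subset[OF _ KOm]
        C1_gradD(2)[OF X(1)] C1_gradD(3)[OF X(2)])+
  moreover have "(LINT x:?K|lborel. g (sqn x) * Dsq x + Q k k' x) = (LINT x:?K|lborel. X11 x + X22 x)"
    using KOm eq by (intro set_lebesgue_integral_cong) (auto simp: borel_compact compact_annulus)
  ultimately show "(LINT x:?K|lborel. g (sqn x) * Dsq x + Q k k' x) = 0"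
    by (simp add: set_integral_add)
  have "set_integrable lborel ?K (\<lambda>x. X11 x + X22 x)" using i by (rule set_integral_add)
  moreover have "(\<lambda>x. indicator ?K x *\<^sub>R (g (sqn x) * Dsq x + Q k k' x))
      = (\<lambda>x. indicator ?K x *\<^sub>R (X11 x + X22 x))"
    using KOm eq by (auto simp: fun_eq_iff indicator_def)
  ultimately show "set_integrable lborel ?K (\<lambda>x. g (sqn x) * Dsq x + Q k k' x)"
    by (simp only: set_integrable_def)
qed

end

section \<open>Cut-off functions\<close>

lemma DERIV_pos_part_power:
  assumes "2 \<le> n"
  shows "((\<lambda>t::real. max 0 t ^ n) has_real_derivative real n * max 0 t ^ (n - 1)) (at t)"
proof (cases "t = 0")
  case False
  then consider "t > 0" | "t < 0" by linarith
  then show ?thesis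
  proof cases
    case 1
    have "((\<lambda>t. t ^ n) has_real_derivative real n * max 0 t ^ (n - 1)) (at t)"
      using 1 by (auto intro!: derivative_eq_intros)
    then show ?thesis
      by (rule has_field_derivative_transform_within_open[where S="{0<..}"]) (use 1 in auto)
  next
    case 2
    have "((\<lambda>t. 0) has_real_derivative real n * max 0 t ^ (n - 1)) (at t)"
      using 2 assms by (auto intro!: derivative_eq_intros)
    then show ?thesis
      by (rule has_field_derivative_transform_within_open[where S="{..<0}"]) (use 2 assms in auto)
  qed
next
  case True
  have "((\<lambda>y. (max 0 y ^ n - max 0 0 ^ n) / (y - 0)) \<longlongrightarrow> 0) (at (0::real))"
  proof (rule Lim_null_comparison)
    have e0: "(0::real) ^ (n - 1) = 0" using assms by (simp add: power_0_left)
    have "((\<lambda>y::real. \<bar>y\<bar> ^ (n - 1)) \<longlongrightarrow> \<bar>0\<bar> ^ (n - 1)) (at 0)" by (intro tendsto_intros)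
    then show "((\<lambda>y::real. \<bar>y\<bar> ^ (n - 1)) \<longlongrightarrow> 0) (at 0)" by (simp only: abs_zero e0)
    have "norm ((max 0 y ^ n - max 0 0 ^ n) / (y - 0)) \<le> \<bar>y\<bar> ^ (n - 1)" for y :: real
    proof (cases "y > 0")
      case True
      then have "y ^ n = y * y ^ (n - 1)" using assms by (cases n) auto
      then show ?thesis using True assms by (simp add: power_0_left)
    qed (use assms in \<open>simp add: power_0_left max_def\<close>)
    then show "\<forall>\<^sub>F y in at (0::real). norm ((max 0 y ^ n - max 0 0 ^ n) / (y - 0)) \<le> \<bar>y\<bar> ^ (n - 1)"
      by (intro always_eventually allI)
  qed
  then show ?thesis using True assms by (simp add: has_field_derivative_iff power_0_left)
qed

text \<open>Equal to 1 for s up to s0 and to 0 from s0 + L on. Its powers with exponent at least 3 are twice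
  continuously differentiable, and their derivatives are bounded by lower powers of bump.\<close>

definition bump :: "real \<Rightarrow> real \<Rightarrow> real \<Rightarrow> real" where
  "bump s0 L s = max 0 (1 - max 0 ((s - s0) / L) ^ 3)"

definition cutoff :: "nat \<Rightarrow> real \<Rightarrow> real \<Rightarrow> real \<Rightarrow> real" where
  "cutoff M s0 L s = bump s0 L s ^ M"

definition cutoff' :: "nat \<Rightarrow> real \<Rightarrow> real \<Rightarrow> real \<Rightarrow> real" where
  "cutoff' M s0 L s = - (3 * real M / L) * (bump s0 L s ^ (M - 1) * max 0 ((s - s0) / L) ^ 2)"

definition cutoff'' :: "nat \<Rightarrow> real \<Rightarrow> real \<Rightarrow> real \<Rightarrow> real" where
  "cutoff'' M s0 L s = - (3 * real M / L) * (cutoff' (M - 1) s0 L s * max 0 ((s - s0) / L) ^ 2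
     + bump s0 L s ^ (M - 1) * (2 * max 0 ((s - s0) / L) / L))"

lemma bump_bounds: "0 \<le> bump s0 L s" "bump s0 L s \<le> 1"
  by (auto simp: bump_def)

lemma bump_eq_1: "0 < L \<Longrightarrow> s \<le> s0 \<Longrightarrow> bump s0 L s = 1"
proof -
  assume "0 < L" "s \<le> s0"
  then have "(s - s0) / L \<le> 0" by (simp add: divide_nonpos_pos)
  then show ?thesis by (simp add: bump_def)
qed

lemma bump_eq_0: "0 < L \<Longrightarrow> s0 + L \<le> s \<Longrightarrow> bump s0 L s = 0"
proof -
  assume "0 < L" "s0 + L \<le> s"
  then have "1 \<le> (s - s0) / L" by simp
  then have "1 \<le> max 0 ((s - s0) / L) ^ 3" by (intro one_le_power) simp
  then show ?thesis by (simp add: bump_def)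
qed

lemma continuous_on_bump: "0 < L \<Longrightarrow> continuous_on S (bump s0 L)"
  unfolding bump_def[abs_def] by (intro continuous_intros) auto

lemma DERIV_cutoff:
  assumes "0 < L" "2 \<le> M"
  shows "(cutoff M s0 L has_real_derivative cutoff' M s0 L s) (at s)"
proof -
  have 1: "((\<lambda>s. (s - s0) / L) has_real_derivative 1 / L) (at s)"
    using assms by (auto intro!: derivative_eq_intros)
  have "((\<lambda>s. max 0 ((s - s0) / L) ^ 3) has_real_derivative 3 * max 0 ((s - s0) / L) ^ 2 * (1 / L)) (at s)"
    using DERIV_chain2[OF DERIV_pos_part_power[of 3] 1] by simp
  then have 2: "((\<lambda>s. 1 - max 0 ((s - s0) / L) ^ 3) has_real_derivative
      0 - 3 * max 0 ((s - s0) / L) ^ 2 * (1 / L)) (at s)"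
    by (intro DERIV_diff DERIV_const)
  from DERIV_chain2[OF DERIV_pos_part_power[OF assms(2)] this]
  show ?thesis unfolding cutoff_def[abs_def] cutoff'_def bump_def[abs_def]
    by (rule DERIV_cong) (simp add: field_simps)
qed

lemma DERIV_cutoff':
  assumes "0 < L" "3 \<le> M"
  shows "(cutoff' M s0 L has_real_derivative cutoff'' M s0 L s) (at s)"
proof -
  have 1: "((\<lambda>s. (s - s0) / L) has_real_derivative 1 / L) (at s)"
    using assms by (auto intro!: derivative_eq_intros)
  have 2: "((\<lambda>s. max 0 ((s - s0) / L) ^ 2) has_real_derivative 2 * max 0 ((s - s0) / L) / L) (at s)"
    using DERIV_chain2[OF DERIV_pos_part_power[of 2] 1] by simp
  have "((\<lambda>s. bump s0 L s ^ (M - 1)) has_real_derivative cutoff' (M - 1) s0 L s) (at s)"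
    using DERIV_cutoff[of L "M - 1" s0 s] assms by (simp add: cutoff_def[abs_def])
  from DERIV_cmult[OF DERIV_mult[OF this 2], of "- (3 * real M / L)"]
  show ?thesis unfolding cutoff'_def[of M, abs_def] cutoff''_def by (rule DERIV_cong) (simp add: algebra_simps)
qed

lemma continuous_on_cutoff'': "0 < L \<Longrightarrow> continuous_on S (cutoff'' M s0 L)"
  unfolding cutoff''_def[abs_def] cutoff'_def[abs_def]
  by (intro continuous_intros continuous_on_bump) auto

lemma pos_part_le_1: "0 < bump s0 L s \<Longrightarrow> max 0 ((s - s0) / L) \<le> 1"
proof (rule ccontr)
  assume b: "0 < bump s0 L s" and "\<not> max 0 ((s - s0) / L) \<le> 1"
  then have "1 \<le> max 0 ((s - s0) / L) ^ 3" by (intro one_le_power) simp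
  then show False using b by (simp add: bump_def)
qed

lemma cutoff'_bound:
  assumes "0 < L" "2 \<le> M"
  shows "\<bar>cutoff' M s0 L s\<bar> \<le> 3 * real M / L * bump s0 L s ^ (M - 1)"
proof (cases "bump s0 L s = 0")
  case True
  then show ?thesis using assms by (simp add: cutoff'_def power_0_left)
next
  case False
  then have p: "0 < bump s0 L s" using bump_bounds(1)[of s0 L s] by simp
  have "bump s0 L s ^ (M - 1) * max 0 ((s - s0) / L) ^ 2 \<le> bump s0 L s ^ (M - 1) * 1"
    using p pos_part_le_1[OF p] by (intro mult_left_mono power_le_one) auto
  then show ?thesis using assms p unfolding cutoff'_def abs_mult abs_minus_cancel
    by (intro mult_mono) auto
qed

lemma cutoff''_bound:
  assumes "0 < L" "3 \<le> M"
  shows "\<bar>cutoff'' M s0 L s\<bar> \<le> 9 * (real M)\<^sup>2 / L\<^sup>2 * bump s0 L s ^ (M - 2)"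
proof (cases "bump s0 L s = 0")
  case True
  then show ?thesis using assms by (simp add: cutoff''_def cutoff'_def power_0_left)
next
  case False
  define b where "b = bump s0 L s"
  define t where "t = max 0 ((s - s0) / L)"
  have p: "0 < b" "b \<le> 1" using False bump_bounds[of s0 L s] by (auto simp: b_def)
  have t: "0 \<le> t" "t \<le> 1" using pos_part_le_1 p by (auto simp: t_def b_def)
  have 1: "\<bar>cutoff' (M - 1) s0 L s * t ^ 2\<bar> \<le> 3 * real (M - 1) / L * b ^ (M - 2) * 1"
  proof -
    have "\<bar>cutoff' (M - 1) s0 L s\<bar> \<le> 3 * real (M - 1) / L * b ^ (M - 2)"
      using cutoff'_bound[of L "M - 1" s0 s] assms by (simp add: b_def numeral_2_eq_2)
    then show ?thesis
      unfolding abs_mult using assms t p by (intro mult_mono) (auto simp: power_le_one)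
  qed
  have 2: "\<bar>b ^ (M - 1) * (2 * t / L)\<bar> \<le> b ^ (M - 2) * (2 / L)"
    unfolding abs_mult using p t assms
    by (intro mult_mono) (auto simp: power_decreasing divide_right_mono)
  have "\<bar>cutoff'' M s0 L s\<bar> \<le> 3 * real M / L * (3 * real (M - 1) / L * b ^ (M - 2) * 1 + b ^ (M - 2) * (2 / L))"
    unfolding cutoff''_def abs_mult b_def[symmetric] t_def[symmetric] using assms 1 2
    by (intro mult_mono order_trans[OF abs_triangle_ineq add_mono]) auto
  also have "\<dots> = 3 * real M / L\<^sup>2 * (3 * real M - 1) * b ^ (M - 2)"
    using assms by (simp add: of_nat_diff power2_eq_square field_simps)
  also have "\<dots> \<le> 3 * real M / L\<^sup>2 * (3 * real M) * b ^ (M - 2)"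
    using assms p by (intro mult_right_mono mult_left_mono) auto
  also have "\<dots> = 9 * (real M)\<^sup>2 / L\<^sup>2 * b ^ (M - 2)" by (simp add: power2_eq_square)
  finally show ?thesis by (simp add: b_def)
qed

section \<open>The error term of the energy identity\<close>

context rotating_perturbation
begin

lemma Dsq_nonneg: "0 \<le> Dsq x"
  by (simp add: Dsq_def)

lemma d_le: "\<bar>d11 x\<bar> \<le> sqrt (Dsq x)" "\<bar>d12 x\<bar> \<le> sqrt (Dsq x)" "\<bar>d21 x\<bar> \<le> sqrt (Dsq x)" "\<bar>d22 x\<bar> \<le> sqrt (Dsq x)"
  by (rule real_le_rsqrt, simp add: Dsq_def)+

lemma Q_bound:
  assumes H: "\<bar>H1 x\<bar> \<le> B" "\<bar>H2 x\<bar> \<le> B"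
  shows "\<bar>Q k k' x\<bar> \<le> 4 * (sqrt (Dsq x) + (norm (v x))\<^sup>2)
      * (norm x * \<bar>k (sqn x)\<bar> * (norm (v x) + B) + (2 * sqn x * \<bar>k' (sqn x)\<bar> + \<bar>k (sqn x)\<bar>) * \<bar>h x\<bar>)
    + \<bar>a\<bar> * (norm x * \<bar>k (sqn x)\<bar>) * norm x * (norm (v x))\<^sup>2"
proof -
  define r z D where "r = norm x" and "z = norm (v x)" and "D = sqrt (Dsq x)"
  define y1 y2 u1 u2 where "y1 = x $ 1" and "y2 = x $ 2" and "u1 = v x $ 1" and "u2 = v x $ 2"
  define K K' where "K = k (sqn x)" and "K' = k' (sqn x)"
  define b1 b2 where "b1 = - (K * y2)" and "b2 = K * y1"
  define W11 where "W11 = H1 x * b1 - h x * (2 * y1 * K' * y2)"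
  define W21 where "W21 = H2 x * b1 - h x * (2 * y2 * K' * y2 + K)"
  define W12 where "W12 = H1 x * b2 + h x * (2 * y1 * K' * y1 + K)"
  define W22 where "W22 = H2 x * b2 + h x * (2 * y2 * K' * y1)"
  define \<alpha> \<beta> where "\<alpha> = r * \<bar>K\<bar>" and "\<beta> = 2 * sqn x * \<bar>K'\<bar> + \<bar>K\<bar>"
  have s: "sqn x = r * r" by (simp add: sqn_norm r_def power2_eq_square)
  have nn: "0 \<le> r" "0 \<le> z" "0 \<le> D" "0 \<le> B" "0 \<le> \<alpha>" "0 \<le> \<beta>"
    using H Dsq_nonneg[of x] by (auto simp: r_def z_def D_def \<alpha>_def \<beta>_def)
  have y: "\<bar>y1\<bar> \<le> r" "\<bar>y2\<bar> \<le> r" and u: "\<bar>u1\<bar> \<le> z" "\<bar>u2\<bar> \<le> z"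
    unfolding y1_def y2_def u1_def u2_def r_def z_def by (rule component_le_norm_cart)+
  have d: "\<bar>d11 x\<bar> \<le> D" "\<bar>d12 x\<bar> \<le> D" "\<bar>d21 x\<bar> \<le> D" "\<bar>d22 x\<bar> \<le> D"
    unfolding D_def by (rule d_le)+
  have pm: "\<bar>p * p'\<bar> \<le> c * c'" if "\<bar>p\<bar> \<le> c" "\<bar>p'\<bar> \<le> c'" for p p' c c' :: real
    unfolding abs_mult using that by (intro mult_mono) auto
  have b: "\<bar>b1\<bar> \<le> \<alpha>" "\<bar>b2\<bar> \<le> \<alpha>"
    using pm[OF order_refl[of "\<bar>K\<bar>"] y(2)] pm[OF order_refl[of "\<bar>K\<bar>"] y(1)]
    by (simp_all add: b1_def b2_def \<alpha>_def mult.commute)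
  have yy: "\<bar>2 * p * K' * p' + e * K\<bar> \<le> \<beta>" if "\<bar>p\<bar> \<le> r" "\<bar>p'\<bar> \<le> r" "\<bar>e\<bar> \<le> 1" for p p' e
  proof -
    have "\<bar>2 * p * K' * p'\<bar> = 2 * \<bar>K'\<bar> * \<bar>p * p'\<bar>" by (simp add: abs_mult)
    also have "\<dots> \<le> 2 * \<bar>K'\<bar> * (r * r)" using that by (intro mult_left_mono pm) auto
    finally have "\<bar>2 * p * K' * p'\<bar> \<le> 2 * \<bar>K'\<bar> * (r * r)" .
    moreover have "\<bar>e * K\<bar> \<le> 1 * \<bar>K\<bar>" using that by (intro pm) auto
    ultimately show ?thesis unfolding \<beta>_def s by (simp add: algebra_simps)
  qed
  define Wb where "Wb = \<alpha> * B + \<beta> * \<bar>h x\<bar>"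
  have Wb0: "0 \<le> Wb" using nn by (simp add: Wb_def)
  have Wg: "\<bar>p * c + e * h x * y\<bar> \<le> Wb" if "\<bar>p\<bar> \<le> B" "\<bar>c\<bar> \<le> \<alpha>" "\<bar>y\<bar> \<le> \<beta>" "\<bar>e\<bar> = 1" for p c y e
  proof -
    have "\<bar>e * h x * y\<bar> = \<bar>y\<bar> * \<bar>h x\<bar>" using that by (simp add: abs_mult)
    also have "\<dots> \<le> \<beta> * \<bar>h x\<bar>" using that by (intro mult_right_mono) auto
    finally show ?thesis using pm[OF that(1,2)] unfolding Wb_def by (simp add: mult.commute)
  qed
  have W: "\<bar>W11\<bar> \<le> Wb" "\<bar>W21\<bar> \<le> Wb" "\<bar>W12\<bar> \<le> Wb" "\<bar>W22\<bar> \<le> Wb"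
    using Wg[OF H(1) b(1) yy[OF y(1) y(2), of 0], of "-1"] Wg[OF H(2) b(1) yy[OF y(2) y(2), of 1], of "-1"]
      Wg[OF H(1) b(2) yy[OF y(1) y(1), of 1], of 1] Wg[OF H(2) b(2) yy[OF y(2) y(1), of 0], of 1]
    by (auto simp: W11_def W21_def W12_def W22_def)
  have mz: "\<bar>rad x\<bar> \<le> r * z" "\<bar>ang x\<bar> \<le> r * z" using rad_abs ang_abs by (auto simp: r_def z_def)
  have uu: "u1\<^sup>2 + u2\<^sup>2 = z\<^sup>2" unfolding z_def u1_def u2_def sqn_norm[symmetric] sqn_def ..
  have Qeq: "Q k k' x = K * (y1 * (u1 * d11 x + u2 * d12 x) + y2 * (u1 * d21 x + u2 * d22 x))
     + (d11 x * W11 + d12 x * W12 + d21 x * W21 + d22 x * W22)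
     - z\<^sup>2 / 2 * (K * rad x)
     - (u1 * u1 * W11 + u1 * u2 * (W12 + W21) + u2 * u2 * W22)
     - a / 2 * ((K * rad x) * ang x)"
    unfolding uu[symmetric]
    by (simp add: Q_def Let_def K_def K'_def y1_def y2_def u1_def u2_def b1_def b2_def W11_def W12_def
        W21_def W22_def power2_eq_square)
  have T1: "\<bar>K * (y1 * (u1 * d11 x + u2 * d12 x) + y2 * (u1 * d21 x + u2 * d22 x))\<bar> \<le> 4 * \<alpha> * z * D"
  proof -
    have "\<bar>u1 * d11 x + u2 * d12 x\<bar> \<le> 2 * z * D" "\<bar>u1 * d21 x + u2 * d22 x\<bar> \<le> 2 * z * D"
      using pm[OF u(1) d(1)] pm[OF u(2) d(2)] pm[OF u(1) d(3)] pm[OF u(2) d(4)] by linarith+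
    from pm[OF y(1) this(1)] pm[OF y(2) this(2)]
    have "\<bar>y1 * (u1 * d11 x + u2 * d12 x) + y2 * (u1 * d21 x + u2 * d22 x)\<bar> \<le> r * (4 * z * D)"
      by (simp add: algebra_simps)
    from pm[OF order_refl[of "\<bar>K\<bar>"] this] show ?thesis by (simp add: \<alpha>_def mult_ac)
  qed
  have T2: "\<bar>d11 x * W11 + d12 x * W12 + d21 x * W21 + d22 x * W22\<bar> \<le> 4 * (D * Wb)"
    using pm[OF d(1) W(1)] pm[OF d(2) W(3)] pm[OF d(3) W(2)] pm[OF d(4) W(4)] by linarith
  have Km: "\<bar>K * rad x\<bar> \<le> \<alpha> * z" using pm[OF order_refl[of "\<bar>K\<bar>"] mz(1)] by (simp add: \<alpha>_def mult_ac)
  have T3: "\<bar>z\<^sup>2 / 2 * (K * rad x)\<bar> \<le> z\<^sup>2 / 2 * (\<alpha> * z)"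
    using pm[OF order_refl[of "\<bar>z\<^sup>2 / 2\<bar>"] Km] by simp
  have T4: "\<bar>u1 * u1 * W11 + u1 * u2 * (W12 + W21) + u2 * u2 * W22\<bar> \<le> 4 * (z\<^sup>2 * Wb)"
  proof -
    have "\<bar>W12 + W21\<bar> \<le> 2 * Wb" using W by linarith
    from pm[OF pm[OF u(1) u(1)] W(1)] pm[OF pm[OF u(1) u(2)] this] pm[OF pm[OF u(2) u(2)] W(4)]
    show ?thesis unfolding power2_eq_square by linarith
  qed
  have T5: "\<bar>a / 2 * ((K * rad x) * ang x)\<bar> \<le> \<bar>a\<bar> / 2 * ((\<alpha> * z) * (r * z))"
    using pm[OF order_refl[of "\<bar>a / 2\<bar>"] pm[OF Km mz(2)]] by simp
  have "\<bar>Q k k' x\<bar> \<le> 4 * \<alpha> * z * D + 4 * (D * Wb) + z\<^sup>2 / 2 * (\<alpha> * z) + 4 * (z\<^sup>2 * Wb)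
      + \<bar>a\<bar> / 2 * ((\<alpha> * z) * (r * z))"
  proof -
    have "\<bar>p1 + p2 - p3 - p4 - p5\<bar> \<le> c1 + c2 + c3 + c4 + c5"
      if "\<bar>p1\<bar> \<le> c1" "\<bar>p2\<bar> \<le> c2" "\<bar>p3\<bar> \<le> c3" "\<bar>p4\<bar> \<le> c4" "\<bar>p5\<bar> \<le> c5"
      for p1 p2 p3 p4 p5 c1 c2 c3 c4 c5 :: real
      using that by linarith
    from this[OF T1 T2 T3 T4 T5] show ?thesis unfolding Qeq .
  qed
  also have "\<dots> \<le> 4 * (D + z\<^sup>2) * (\<alpha> * (z + B) + \<beta> * \<bar>h x\<bar>) + \<bar>a\<bar> * \<alpha> * r * z\<^sup>2"
  proof -
    have "z\<^sup>2 / 2 * (\<alpha> * z) \<le> 4 * (z\<^sup>2 * (\<alpha> * z))" using nn by simp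
    moreover have "\<bar>a\<bar> / 2 * ((\<alpha> * z) * (r * z)) \<le> \<bar>a\<bar> * \<alpha> * r * z\<^sup>2"
      using nn by (simp add: power2_eq_square mult_ac)
    ultimately show ?thesis unfolding Wb_def by (simp add: algebra_simps)
  qed
  finally show ?thesis
    unfolding r_def z_def D_def \<alpha>_def \<beta>_def K_def K'_def by (simp only: mult.assoc)
qed

end

section \<open>The energy inequality\<close>

lemma set_integral_indicator_subset:
  fixes f :: "'a \<Rightarrow> real"
  assumes "B \<subseteq> A"
  shows "(LINT x:A|M. indicator B x * f x) = (LINT x:B|M. f x)"
    "set_integrable M A (\<lambda>x. indicator B x * f x) \<longleftrightarrow> set_integrable M B f"
proof -
  have "(\<lambda>x. indicator A x *\<^sub>R (indicator B x * f x)) = (\<lambda>x. indicator B x *\<^sub>R f x)"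
    using assms by (auto simp: fun_eq_iff indicator_def)
  then show "(LINT x:A|M. indicator B x * f x) = (LINT x:B|M. f x)"
    "set_integrable M A (\<lambda>x. indicator B x * f x) \<longleftrightarrow> set_integrable M B f"
    unfolding set_lebesgue_integral_def set_integrable_def by simp_all
qed

lemma measure_thin_annulus:
  assumes "0 < \<delta>"
  shows "measure lborel (annulus (1 + \<delta>) (1 + 2 * \<delta>)) \<le> 2 * pi * \<delta>"
proof -
  let ?B = "cball (0::real^2) (sqrt (1 + 2 * \<delta>))" and ?A = "ball (0::real^2) 1"
  have sub: "?A \<subseteq> ?B"
  proof
    fix x :: "real^2" assume "x \<in> ?A"
    moreover have "1 \<le> sqrt (1 + 2 * \<delta>)" using assms by simp
    ultimately show "x \<in> ?B" by (simp del: real_sqrt_ge_1_iff)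
  qed
  have "annulus (1 + \<delta>) (1 + 2 * \<delta>) \<subseteq> ?B - ?A"
  proof
    fix x assume x: "x \<in> annulus (1 + \<delta>) (1 + 2 * \<delta>)"
    then have "(norm x)\<^sup>2 \<le> 1 + 2 * \<delta>" "1 < sqn x" using assms by (auto simp: annulus_def sqn_norm)
    then have "norm x \<le> sqrt (1 + 2 * \<delta>)" "1 < norm x" by (auto intro: real_le_rsqrt simp: one_less_sqn)
    then show "x \<in> ?B - ?A" by simp
  qed
  then have "measure lborel (annulus (1 + \<delta>) (1 + 2 * \<delta>)) \<le> measure lborel (?B - ?A)"
    by (intro measure_mono_fmeasurable) (auto intro!: fmeasurableI2[of ?B] fmeasurableI emeasure_bounded_finite
        compact_annulus borel_compact)
  also have "\<dots> = measure lborel ?B - measure lborel ?A"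
    using sub by (intro measurable_measure_Diff) (auto intro!: fmeasurableI emeasure_bounded_finite)
  also have "\<dots> = 2 * pi * \<delta>"
    using assms by (simp add: content_cball content_ball unit_ball_vol_2 algebra_simps)
  finally show ?thesis .
qed

lemma circle_int_mono:
  assumes "continuous_on Om f" "continuous_on Om g" "x \<in> Om"
    and "\<And>t. 0 \<le> t \<Longrightarrow> t \<le> 2 * pi \<Longrightarrow> f (rot t x) \<le> g (rot t x)"
  shows "circle_int (\<lambda>t. 1) f x \<le> circle_int (\<lambda>t. 1) g x"
  unfolding circle_int_def
  by (rule integral_le[OF circle_integrable[OF assms(1,3) continuous_on_const]
        circle_integrable[OF assms(2,3) continuous_on_const]]) (use assms(4) in auto)

lemma circle_int_const: "circle_int (\<lambda>t. 1) (\<lambda>y. c) x = 2 * pi * c"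
  by (simp add: circle_int_def)

text \<open>Rises from 0 to 1 for s between 1 + delta and 1 + 2 delta and falls back to 0 between R^2
  and 4 R^2; the exponent M serves the outer part only.\<close>

definition eta :: "real \<Rightarrow> real \<Rightarrow> nat \<Rightarrow> real \<Rightarrow> real" where
  "eta \<delta> R M s = (1 - cutoff 3 (1 + \<delta>) \<delta> s) * cutoff M (R\<^sup>2) (3 * R\<^sup>2) s"

definition twice_eta' :: "real \<Rightarrow> real \<Rightarrow> nat \<Rightarrow> real \<Rightarrow> real" where
  "twice_eta' \<delta> R M s = 2 * ((1 - cutoff 3 (1 + \<delta>) \<delta> s) * cutoff' M (R\<^sup>2) (3 * R\<^sup>2) s
     - cutoff' 3 (1 + \<delta>) \<delta> s * cutoff M (R\<^sup>2) (3 * R\<^sup>2) s)"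

definition twice_eta'' :: "real \<Rightarrow> real \<Rightarrow> nat \<Rightarrow> real \<Rightarrow> real" where
  "twice_eta'' \<delta> R M s = 2 * ((1 - cutoff 3 (1 + \<delta>) \<delta> s) * cutoff'' M (R\<^sup>2) (3 * R\<^sup>2) s
     - 2 * cutoff' 3 (1 + \<delta>) \<delta> s * cutoff' M (R\<^sup>2) (3 * R\<^sup>2) s
     - cutoff'' 3 (1 + \<delta>) \<delta> s * cutoff M (R\<^sup>2) (3 * R\<^sup>2) s)"

lemma cutoff_left: "0 < L \<Longrightarrow> s \<le> s0 \<Longrightarrow> cutoff M s0 L s = 1 \<and> cutoff' M s0 L s = 0 \<and> cutoff'' M s0 L s = 0"
proof -
  assume L: "0 < L" "s \<le> s0"
  then have "(s - s0) / L \<le> 0" by (simp add: divide_nonpos_pos)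
  then have "max 0 ((s - s0) / L) = 0" by simp
  then show ?thesis by (simp add: cutoff_def cutoff'_def cutoff''_def bump_eq_1 L)
qed

lemma cutoff_right: "0 < L \<Longrightarrow> s0 + L \<le> s \<Longrightarrow> 3 \<le> M \<Longrightarrow> cutoff M s0 L s = 0 \<and> cutoff' M s0 L s = 0 \<and> cutoff'' M s0 L s = 0"
  by (auto simp: cutoff_def cutoff'_def cutoff''_def bump_eq_0 power_0_left)

context
  fixes \<delta> R :: real and M :: nat
  assumes \<delta>: "0 < \<delta>" "\<delta> \<le> 1 / 2" and R: "4 \<le> R" and M: "3 \<le> M"
begin

lemma R_sq: "16 \<le> R\<^sup>2" "R \<noteq> 0"
  using power_mono[of 4 R 2] R by auto

lemma DERIV_eta: "(eta \<delta> R M has_real_derivative twice_eta' \<delta> R M s / 2) (at s)"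
  unfolding eta_def[abs_def] twice_eta'_def
  by (rule DERIV_cong[OF DERIV_mult[OF DERIV_diff[OF DERIV_const DERIV_cutoff] DERIV_cutoff]])
    (use \<delta> R_sq M in \<open>auto simp: algebra_simps\<close>)

lemma DERIV_twice_eta': "(twice_eta' \<delta> R M has_real_derivative twice_eta'' \<delta> R M s) (at s)"
  unfolding twice_eta'_def[abs_def] twice_eta''_def
  by (rule DERIV_cong[OF DERIV_cmult[OF DERIV_diff[OF DERIV_mult[OF DERIV_diff[OF DERIV_const DERIV_cutoff] DERIV_cutoff']
      DERIV_mult[OF DERIV_cutoff' DERIV_cutoff]]]])
    (use \<delta> R_sq M in \<open>auto simp: algebra_simps\<close>)

lemma continuous_on_twice_eta'': "continuous_on S (twice_eta'' \<delta> R M)"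
proof -
  have "continuous_on S (cutoff K s0 L)" "continuous_on S (cutoff' K s0 L)" "continuous_on S (cutoff'' K s0 L)"
    if "0 < L" "3 \<le> K" for K s0 L
    using that DERIV_isCont[OF DERIV_cutoff[of L K s0]] DERIV_isCont[OF DERIV_cutoff'[of L K s0]]
    by (simp_all add: continuous_on_cutoff'' continuous_at_imp_continuous_on)
  then show ?thesis unfolding twice_eta''_def[abs_def]
    using \<delta> R_sq M by (intro continuous_intros) auto
qed

lemma eta_outside: "s < 1 + \<delta> \<or> 4 * R\<^sup>2 < s \<Longrightarrow> eta \<delta> R M s = 0 \<and> twice_eta' \<delta> R M s = 0"
proof (elim disjE)
  assume "s < 1 + \<delta>"
  then show ?thesis using cutoff_left[OF \<delta>(1), of s "1 + \<delta>" 3] by (simp add: eta_def twice_eta'_def)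
next
  assume "4 * R\<^sup>2 < s"
  then show ?thesis using cutoff_right[of "3 * R\<^sup>2" "R\<^sup>2" s M] R_sq M by (simp add: eta_def twice_eta'_def)
qed

lemma eta_inner:
  assumes "1 + \<delta> \<le> s" "s \<le> 1 + 2 * \<delta>"
  shows "\<bar>twice_eta' \<delta> R M s\<bar> \<le> 18 / \<delta>" "\<bar>twice_eta'' \<delta> R M s\<bar> \<le> 162 / \<delta>\<^sup>2"
proof -
  note c = cutoff_left[of "3 * R\<^sup>2" s "R\<^sup>2" M]
  have c: "cutoff M (R\<^sup>2) (3 * R\<^sup>2) s = 1" "cutoff' M (R\<^sup>2) (3 * R\<^sup>2) s = 0" "cutoff'' M (R\<^sup>2) (3 * R\<^sup>2) s = 0"
    using c assms R_sq \<delta> by auto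
  have b: "bump (1 + \<delta>) \<delta> s ^ j \<le> 1" for j using bump_bounds by (intro power_le_one) auto
  have "\<bar>cutoff' 3 (1 + \<delta>) \<delta> s\<bar> \<le> 9 / \<delta> * 1"
    using cutoff'_bound[of \<delta> 3 "1 + \<delta>" s] mult_left_mono[OF b[of 2], of "9 / \<delta>"] \<delta> by simp
  then show "\<bar>twice_eta' \<delta> R M s\<bar> \<le> 18 / \<delta>" by (simp add: twice_eta'_def c abs_mult)
  have "\<bar>cutoff'' 3 (1 + \<delta>) \<delta> s\<bar> \<le> 81 / \<delta>\<^sup>2 * 1"
    using cutoff''_bound[of \<delta> 3 "1 + \<delta>" s] mult_left_mono[OF b[of 1], of "81 / \<delta>\<^sup>2"] \<delta> by simp
  then show "\<bar>twice_eta'' \<delta> R M s\<bar> \<le> 162 / \<delta>\<^sup>2" by (simp add: twice_eta''_def c abs_mult)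
qed

lemma eta_outer:
  assumes "1 + 2 * \<delta> \<le> s"
  shows "eta \<delta> R M s = cutoff M (R\<^sup>2) (3 * R\<^sup>2) s" "twice_eta' \<delta> R M s = 2 * cutoff' M (R\<^sup>2) (3 * R\<^sup>2) s"
    "twice_eta'' \<delta> R M s = 2 * cutoff'' M (R\<^sup>2) (3 * R\<^sup>2) s"
  using cutoff_right[of \<delta> "1 + \<delta>" s 3] assms \<delta> by (auto simp: eta_def twice_eta'_def twice_eta''_def)

lemma eta_bounds: "0 \<le> eta \<delta> R M s" "eta \<delta> R M s \<le> 1"
proof -
  have "0 \<le> cutoff K s0 L s" "cutoff K s0 L s \<le> 1" for K s0 L
    unfolding cutoff_def using bump_bounds by (auto intro: power_le_one)
  then show "0 \<le> eta \<delta> R M s" "eta \<delta> R M s \<le> 1" unfolding eta_def by (auto intro: mult_le_one)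
qed

lemma eta_plateau: "1 + 2 * \<delta> \<le> s \<Longrightarrow> s \<le> R\<^sup>2 \<Longrightarrow>
    eta \<delta> R M s = 1 \<and> twice_eta' \<delta> R M s = 0 \<and> twice_eta'' \<delta> R M s = 0"
  using cutoff_left[of "3 * R\<^sup>2" s "R\<^sup>2" M] eta_outer[of s] R_sq by simp

end

context rotating_perturbation
begin

definition sq_plus_cube :: "real^2 \<Rightarrow> real" where "sq_plus_cube x = (norm (v x))\<^sup>2 + norm (v x) ^ 3"
definition W :: "real^2 \<Rightarrow> real" where "W = circle_int (\<lambda>t. 1) sq_plus_cube"

lemma cont_sq_plus_cube: "continuous_on Om sq_plus_cube"
  unfolding sq_plus_cube_def[abs_def] by (intro continuous_intros cont_v)

text \<open>Cauchy-Schwarz on the circle, through the square of norm v minus its mean c.\<close>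

lemma V_sq_le_W: assumes x: "x \<in> Om" shows "(V x)\<^sup>2 \<le> 2 * pi * W x"
proof -
  define c where "c = V x / (2 * pi)"
  have "circle_int (\<lambda>t. 1) (\<lambda>y. (2 * c) * norm (v y) + (- (c\<^sup>2))) x \<le> W x"
    unfolding W_def
  proof (rule circle_int_mono)
    fix t
    define f where "f = norm (v (rot t x))"
    have "0 \<le> (f - c)\<^sup>2" "0 \<le> f ^ 3" by (auto simp: f_def)
    then show "(2 * c) * norm (v (rot t x)) + (- (c\<^sup>2)) \<le> sq_plus_cube (rot t x)"
      unfolding sq_plus_cube_def f_def[symmetric] power2_diff mult.assoc mult.commute[of c] by linarith
  qed (intro continuous_intros cont_v cont_sq_plus_cube x)+
  also have "circle_int (\<lambda>t. 1) (\<lambda>y. (2 * c) * norm (v y) + (- (c\<^sup>2))) x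
      = circle_int (\<lambda>t. 1) (\<lambda>y. (2 * c) * norm (v y)) x + circle_int (\<lambda>t. 1) (\<lambda>y. - (c\<^sup>2)) x"
    by (rule circle_int_add) (intro continuous_intros cont_v x)+
  also have "\<dots> = 2 * c * V x - 2 * pi * c\<^sup>2"
    unfolding circle_int_cmult circle_int_const V_def by simp
  also have "\<dots> = (V x)\<^sup>2 / (2 * pi)" by (simp add: c_def power2_eq_square field_simps)
  finally show ?thesis by (simp add: field_simps)
qed

lemma sq_mult_V_le_W: assumes x: "x \<in> Om" shows "(norm (v x))\<^sup>2 * V x \<le> 2 * pi * sq_plus_cube x + W x"
proof -
  define z where "z = norm (v x)"
  have "z\<^sup>2 * V x = circle_int (\<lambda>t. 1) (\<lambda>y. z\<^sup>2 * norm (v y)) x"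
    unfolding V_def by (rule circle_int_cmult[symmetric])
  also have "\<dots> \<le> circle_int (\<lambda>t. 1) (\<lambda>y. sq_plus_cube x + sq_plus_cube y) x"
  proof (rule circle_int_mono)
    fix t
    define f where "f = norm (v (rot t x))"
    have nn: "0 \<le> z" "0 \<le> f" by (auto simp: z_def f_def)
    have "z\<^sup>2 * f \<le> z ^ 3 + f ^ 3"
    proof (cases "f \<le> z")
      case True
      then have "z\<^sup>2 * f \<le> z\<^sup>2 * z" by (intro mult_left_mono) auto
      moreover have "0 \<le> f ^ 3" using nn by simp
      ultimately show ?thesis by (simp add: power3_eq_cube power2_eq_square)
    next
      case False
      then have "z\<^sup>2 * f \<le> f\<^sup>2 * f" using nn by (intro mult_right_mono power_mono) auto
      moreover have "0 \<le> z ^ 3" using nn by simp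
      ultimately show ?thesis by (simp add: power3_eq_cube power2_eq_square)
    qed
    moreover have "0 \<le> z\<^sup>2" "0 \<le> f\<^sup>2" by simp_all
    ultimately show "z\<^sup>2 * norm (v (rot t x)) \<le> sq_plus_cube x + sq_plus_cube (rot t x)"
      unfolding sq_plus_cube_def f_def[symmetric] z_def[symmetric] by linarith
  qed (intro continuous_intros cont_v cont_sq_plus_cube x)+
  also have "\<dots> = circle_int (\<lambda>t. 1) (\<lambda>y. sq_plus_cube x) x + W x"
    unfolding W_def by (rule circle_int_add) (intro continuous_intros cont_sq_plus_cube x)+
  finally show ?thesis by (simp add: z_def circle_int_const)
qed

lemma W_nonneg: "x \<in> Om \<Longrightarrow> 0 \<le> W x"
proof -
  assume x: "x \<in> Om"
  have "circle_int (\<lambda>t. 1) (\<lambda>y. 0) x \<le> W x"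
    unfolding W_def by (rule circle_int_mono[OF _ cont_sq_plus_cube x]) (auto simp: sq_plus_cube_def)
  then show ?thesis by (simp add: circle_int_const)
qed

definition inner_error :: real where "inner_error = 4 * (2 * C0 + C0\<^sup>2) * (11304 * C0) + 144 * \<bar>a\<bar> * C0\<^sup>2"

text \<open>In a layer of width delta the velocity is O(delta), h is O(delta^2), and the derivatives of the
  cut-off are O(1/delta) and O(1/delta^2); the powers of delta cancel in every term of Q.\<close>

lemma Q_inner:
  assumes \<delta>: "0 < \<delta>" "\<delta> \<le> 1 / 2" and x: "1 + \<delta> \<le> sqn x" "sqn x \<le> 1 + 2 * \<delta>"
    and k: "\<bar>k (sqn x)\<bar> \<le> 18 / \<delta>" "\<bar>k' (sqn x)\<bar> \<le> 162 / \<delta>\<^sup>2"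
  shows "\<bar>Q k k' x\<bar> \<le> inner_error"
proof -
  define r z where "r = norm x" and "z = norm (v x)"
  have r1: "1 < r" using x \<delta> one_less_sqn[of x] by (simp add: r_def)
  have sr: "sqn x = r\<^sup>2" by (simp add: sqn_norm r_def)
  have "(r - 1) * 1 \<le> (r - 1) * (r + 1)" using r1 by (intro mult_left_mono) auto
  also have "\<dots> = r\<^sup>2 - 1" by (simp add: power2_eq_square algebra_simps)
  finally have r: "r - 1 \<le> 2 * \<delta>" "r \<le> 2" using x sr \<delta> by auto
  have xOm: "x \<in> Om" using r1 by (simp add: r_def)
  note C0 = C0_nonneg
  have rC: "C0 * (r - 1) \<le> C0 * (2 * \<delta>)" using C0 r by (intro mult_left_mono) auto
  have z: "0 \<le> z" "z \<le> 2 * C0 * \<delta>"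
    using near_v[of x] r r1 rC by (auto simp: r_def z_def)
  have "V x \<le> 2 * pi * (C0 * (r - 1))" unfolding r_def by (rule near_V) (use r r1 in \<open>auto simp: r_def\<close>)
  also have "\<dots> \<le> 8 * (C0 * (2 * \<delta>))"
    using C0 \<delta> pi_less_4 r1 by (intro mult_mono rC) auto
  finally have V: "V x \<le> 16 * C0 * \<delta>" by simp
  define B where "B = 20 * C0 * \<delta>"
  have H: "\<bar>H1 x\<bar> \<le> B" "\<bar>H2 x\<bar> \<le> B"
    using H_le_V[OF xOm] z V unfolding B_def z_def by linarith+
  have "\<bar>h x\<bar> \<le> 4 * C0 * (r - 1) * (r - 1)" unfolding r_def by (rule near_h) (use r r1 in \<open>auto simp: r_def\<close>)
  also have "\<dots> \<le> 4 * C0 * (2 * \<delta>) * (2 * \<delta>)"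
    using C0 r r1 \<delta> by (intro mult_mono) auto
  finally have h: "\<bar>h x\<bar> \<le> 16 * C0 * \<delta>\<^sup>2" by (simp add: power2_eq_square)
  have D: "sqrt (Dsq x) \<le> 2 * C0"
  proof (rule real_le_lsqrt)
    have d2: "d\<^sup>2 \<le> C0\<^sup>2" if "\<bar>d\<bar> \<le> C0" for d
      using power_mono[OF that abs_ge_zero, of 2] by simp
    show "Dsq x \<le> (2 * C0)\<^sup>2"
      using near_d[of x] r r1 d2[of "d11 x"] d2[of "d12 x"] d2[of "d21 x"] d2[of "d22 x"]
      by (simp add: Dsq_def r_def power_mult_distrib)
  qed (use C0 Dsq_nonneg in auto)
  define \<alpha> \<beta> where "\<alpha> = r * \<bar>k (sqn x)\<bar>" and "\<beta> = 2 * sqn x * \<bar>k' (sqn x)\<bar> + \<bar>k (sqn x)\<bar>"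
  have \<alpha>: "0 \<le> \<alpha>" "\<alpha> \<le> 2 * (18 / \<delta>)"
    unfolding \<alpha>_def using r1 mult_mono[OF r(2) k(1)] by simp_all
  have \<beta>: "0 \<le> \<beta>" "\<beta> \<le> 657 / \<delta>\<^sup>2"
  proof -
    show "0 \<le> \<beta>" by (simp add: \<beta>_def)
    have "2 * sqn x * \<bar>k' (sqn x)\<bar> \<le> 4 * (162 / \<delta>\<^sup>2)"
      using x \<delta> k by (intro mult_mono) auto
    moreover have "18 / \<delta> \<le> 9 / \<delta>\<^sup>2" using \<delta> by (simp add: field_simps power2_eq_square)
    ultimately show "\<beta> \<le> 657 / \<delta>\<^sup>2" using k unfolding \<beta>_def by (simp add: field_simps)
  qed
  have t1: "\<alpha> * (z + B) \<le> 792 * C0"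
  proof -
    have "\<alpha> * (z + B) \<le> 2 * (18 / \<delta>) * (22 * C0 * \<delta>)"
      using \<alpha> z C0 \<delta> by (intro mult_mono) (auto simp: B_def)
    then show ?thesis using \<delta> by simp
  qed
  have t2: "\<beta> * \<bar>h x\<bar> \<le> 10512 * C0"
  proof -
    have "\<beta> * \<bar>h x\<bar> \<le> 657 / \<delta>\<^sup>2 * (16 * C0 * \<delta>\<^sup>2)"
      using \<beta> h by (intro mult_mono) auto
    then show ?thesis using \<delta> by simp
  qed
  have zC: "z \<le> C0" using z(2) mult_left_mono[of "2 * \<delta>" 1 C0] C0 \<delta> by simp
  then have z2: "z\<^sup>2 \<le> C0\<^sup>2" using z by (intro power_mono)
  have t3: "\<alpha> * r * z\<^sup>2 \<le> 144 * C0\<^sup>2"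
  proof -
    have "z * z \<le> (2 * C0 * \<delta>) * C0" using z zC C0 \<delta> by (intro mult_mono) auto
    then have zsq: "z\<^sup>2 \<le> (2 * C0 * \<delta>) * C0" by (simp add: power2_eq_square)
    have "\<alpha> * r \<le> (2 * (18 / \<delta>)) * 2"
      by (rule mult_mono[OF \<alpha>(2) r(2)]) (use r1 \<delta> in auto)
    from mult_mono[OF this zsq] have "\<alpha> * r * z\<^sup>2 \<le> (2 * (18 / \<delta>)) * 2 * ((2 * C0 * \<delta>) * C0)"
      using \<delta> by simp
    also have "\<dots> = 144 * C0\<^sup>2" using \<delta> by (simp add: power2_eq_square)
    finally show ?thesis .
  qed
  have "\<bar>Q k k' x\<bar> \<le> 4 * (sqrt (Dsq x) + z\<^sup>2) * (\<alpha> * (z + B) + \<beta> * \<bar>h x\<bar>) + \<bar>a\<bar> * \<alpha> * r * z\<^sup>2"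
    using Q_bound[OF H, of k k'] unfolding r_def[symmetric] z_def[symmetric] \<alpha>_def[symmetric] \<beta>_def[symmetric] .
  also have "\<dots> \<le> 4 * (2 * C0 + C0\<^sup>2) * (792 * C0 + 10512 * C0) + \<bar>a\<bar> * (144 * C0\<^sup>2)"
  proof (rule add_mono)
    show "\<bar>a\<bar> * \<alpha> * r * z\<^sup>2 \<le> \<bar>a\<bar> * (144 * C0\<^sup>2)"
      using mult_left_mono[OF t3, of "\<bar>a\<bar>"] by (simp add: mult.assoc)
    have "0 \<le> \<alpha> * (z + B) + \<beta> * \<bar>h x\<bar>"
      using \<alpha> \<beta> z C0 \<delta> by (intro add_nonneg_nonneg mult_nonneg_nonneg) (auto simp: B_def)
    then show "4 * (sqrt (Dsq x) + z\<^sup>2) * (\<alpha> * (z + B) + \<beta> * \<bar>h x\<bar>)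
        \<le> 4 * (2 * C0 + C0\<^sup>2) * (792 * C0 + 10512 * C0)"
      using D z2 t1 t2 C0 Dsq_nonneg[of x] by (intro mult_mono) auto
  qed
  also have "\<dots> = inner_error" by (simp add: inner_error_def algebra_simps)
  finally show ?thesis .
qed


definition outer_error :: "nat \<Rightarrow> real" where
  "outer_error M = ((160 * (real M)\<^sup>2)\<^sup>2 + 160 * (real M)\<^sup>2 + 8 * \<bar>a\<bar> * real M) * (1 + 2 * pi)"

lemma outer_error_nonneg: "0 \<le> outer_error M"
  unfolding outer_error_def by (intro mult_nonneg_nonneg add_nonneg_nonneg) auto

text \<open>In Q_bound the factors r |k| and 2 r^2 |k'| + |k| are O(1/R) and O(1/R^2). The second one meets
  |h| = O(R V) and, in the term with a, the first one meets r, so nothing grows with R. Each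
  derivative of the cut-off costs one power of b, and
  Young's inequality then leaves b^(M - 4) in front of the lower order terms.\<close>

lemma Q_outer:
  assumes R: "1 \<le> R" and M: "M = 4 * J + 4" and x: "R\<^sup>2 \<le> sqn x" "sqn x \<le> 4 * R\<^sup>2" "x \<in> Om"
    and b: "0 \<le> b" "b \<le> 1"
    and k: "\<bar>k (sqn x)\<bar> \<le> 2 * real M * b ^ (M - 1) / R\<^sup>2"
    and k': "\<bar>k' (sqn x)\<bar> \<le> 2 * (real M)\<^sup>2 * b ^ (M - 2) / R ^ 4"
  shows "\<bar>Q k k' x\<bar> \<le> b ^ M * Dsq x / 2 + outer_error M * (b ^ (4 * J) * (sq_plus_cube x + W x))"
proof -
  define r z D where "r = norm x" and "z = norm (v x)" and "D = sqrt (Dsq x)"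
  define p where "p = b ^ (M - 2)"
  define N where "N = real M"
  have N: "1 \<le> N" "N \<le> N\<^sup>2" using M by (auto simp: N_def power2_eq_square)
  have p: "0 \<le> p" using b by (simp add: p_def)
  have pb: "b ^ (M - 1) \<le> p" unfolding p_def using b by (intro power_decreasing) auto
  have sr: "sqn x = r\<^sup>2" by (simp add: sqn_norm r_def)
  have r: "0 \<le> r" "r \<le> 2 * R"
  proof -
    show "0 \<le> r" by (simp add: r_def)
    have "r\<^sup>2 \<le> (2 * R)\<^sup>2" using x sr by (simp add: power_mult_distrib)
    then show "r \<le> 2 * R" by (rule power2_le_imp_le) (use R in simp)
  qed
  have z: "0 \<le> z" by (simp add: z_def)
  have D: "0 \<le> D" "D\<^sup>2 = Dsq x" using Dsq_nonneg[of x] by (auto simp: D_def)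
  have V0: "0 \<le> V x" by (rule V_nonneg[OF x(3)])
  have RR: "1 / R \<le> 1" "R \<noteq> 0" "0 < R" using R by auto
  define \<alpha> \<beta> where "\<alpha> = r * \<bar>k (sqn x)\<bar>" and "\<beta> = 2 * sqn x * \<bar>k' (sqn x)\<bar> + \<bar>k (sqn x)\<bar>"
  have k1: "\<bar>k (sqn x)\<bar> \<le> 2 * N * p / R\<^sup>2"
    using k mult_left_mono[OF pb, of "2 * N / R\<^sup>2"] N by (simp add: N_def)
  have \<alpha>0: "0 \<le> \<alpha>" using r by (simp add: \<alpha>_def)
  have \<alpha>R: "\<alpha> * R \<le> 4 * N * p"
  proof -
    have "\<alpha> * R \<le> (2 * R * (2 * N * p / R\<^sup>2)) * R"
      unfolding \<alpha>_def using r k1 R by (intro mult_right_mono mult_mono) auto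
    also have "\<dots> = 4 * N * p" using RR by (simp add: power2_eq_square)
    finally show ?thesis .
  qed
  have \<alpha>1: "\<alpha> \<le> 4 * N * p" using \<alpha>R mult_left_mono[OF R \<alpha>0] by simp
  have \<alpha>r: "\<alpha> * r \<le> 8 * N * p" using \<alpha>R mult_left_mono[OF r(2) \<alpha>0] by simp
  have \<beta>0: "0 \<le> \<beta>" by (simp add: \<beta>_def)
  have \<beta>: "\<beta> \<le> 18 * N\<^sup>2 * p / R\<^sup>2"
  proof -
    have "2 * sqn x * \<bar>k' (sqn x)\<bar> \<le> 2 * (4 * R\<^sup>2) * (2 * N\<^sup>2 * p / R ^ 4)"
      using x k' by (intro mult_mono) (auto simp: N_def p_def)
    also have "\<dots> = 16 * N\<^sup>2 * p / R\<^sup>2"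
      using RR by (simp add: power2_eq_square power4_eq_xxxx)
    finally have 1: "2 * sqn x * \<bar>k' (sqn x)\<bar> \<le> 16 * N\<^sup>2 * p / R\<^sup>2" .
    have "2 * N * p / R\<^sup>2 \<le> 2 * N\<^sup>2 * p / R\<^sup>2"
      using N p by (intro divide_right_mono mult_right_mono) auto
    moreover have "16 * N\<^sup>2 * p / R\<^sup>2 + 2 * N\<^sup>2 * p / R\<^sup>2 = 18 * N\<^sup>2 * p / R\<^sup>2"
      by (simp flip: add_divide_distrib)
    ultimately show ?thesis using 1 k1 unfolding \<beta>_def by linarith
  qed
  have "\<bar>h x\<bar> \<le> r * V x" unfolding r_def by (rule h_le_V[OF x(3)])
  also have "\<dots> \<le> 2 * R * V x" using r V0 by (intro mult_right_mono) auto
  finally have h: "\<bar>h x\<bar> \<le> 2 * R * V x" .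
  have \<beta>h: "\<beta> * \<bar>h x\<bar> \<le> 36 * N\<^sup>2 * p * V x"
  proof -
    have "\<beta> * \<bar>h x\<bar> \<le> (18 * N\<^sup>2 * p / R\<^sup>2) * (2 * R * V x)"
      using \<beta> h \<beta>0 p by (intro mult_mono) auto
    also have "\<dots> = (36 * N\<^sup>2 * p * V x) * (1 / R)" using RR by (simp add: power2_eq_square)
    also have "\<dots> \<le> (36 * N\<^sup>2 * p * V x) * 1" using RR p V0 by (intro mult_left_mono) auto
    finally show ?thesis by simp
  qed
  define B where "B = 2 * z + V x"
  have H: "\<bar>H1 x\<bar> \<le> B" "\<bar>H2 x\<bar> \<le> B"
    using H_le_V[OF x(3)] unfolding B_def z_def by auto
  define c where "c = 160 * N\<^sup>2"
  have c0: "0 \<le> c" by (simp add: c_def)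
  have t: "\<alpha> * (z + B) + \<beta> * \<bar>h x\<bar> \<le> 40 * N\<^sup>2 * p * (z + V x)"
  proof -
    have "\<alpha> * (z + B) \<le> 4 * N * p * (3 * z + V x)"
      using \<alpha>1 z V0 p N by (intro mult_mono) (auto simp: B_def)
    also have "\<dots> \<le> 4 * N\<^sup>2 * p * (3 * z + V x)"
      using N p z V0 by (intro mult_right_mono) auto
    finally have "\<alpha> * (z + B) + \<beta> * \<bar>h x\<bar> \<le> 4 * N\<^sup>2 * p * (3 * z + V x) + 36 * N\<^sup>2 * p * V x"
      using \<beta>h by linarith
    also have "\<dots> = 40 * N\<^sup>2 * p * (z + V x) - 28 * (N\<^sup>2 * p * z)" by (simp add: algebra_simps)
    also have "\<dots> \<le> 40 * N\<^sup>2 * p * (z + V x)" using p z by simp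
    finally show ?thesis .
  qed
  have Q1: "\<bar>Q k k' x\<bar> \<le> 4 * (D + z\<^sup>2) * (40 * N\<^sup>2 * p * (z + V x)) + \<bar>a\<bar> * (8 * N * p * z\<^sup>2)"
  proof -
    have "\<bar>Q k k' x\<bar> \<le> 4 * (D + z\<^sup>2) * (\<alpha> * (z + B) + \<beta> * \<bar>h x\<bar>) + \<bar>a\<bar> * \<alpha> * r * z\<^sup>2"
      using Q_bound[OF H, of k k'] unfolding r_def[symmetric] z_def[symmetric] D_def[symmetric]
        \<alpha>_def[symmetric] \<beta>_def[symmetric] .
    moreover have "4 * (D + z\<^sup>2) * (\<alpha> * (z + B) + \<beta> * \<bar>h x\<bar>) \<le> 4 * (D + z\<^sup>2) * (40 * N\<^sup>2 * p * (z + V x))"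
      using t D by (intro mult_left_mono) auto
    moreover have "\<bar>a\<bar> * \<alpha> * r * z\<^sup>2 \<le> \<bar>a\<bar> * (8 * N * p * z\<^sup>2)"
      using mult_left_mono[OF mult_right_mono[OF \<alpha>r, of "z\<^sup>2"], of "\<bar>a\<bar>"] by (simp add: mult.assoc)
    ultimately show ?thesis by linarith
  qed
  define e where "e = b ^ (2 * J)"
  have e: "0 \<le> e" "e * e = b ^ (4 * J)" "b ^ (2 * J + 2) * e = p" "b ^ (2 * J + 2) * b ^ (2 * J + 2) = b ^ M"
  proof -
    have i: "2 * J + 2 + (2 * J + 2) = M" using M by simp
    show "b ^ (2 * J + 2) * b ^ (2 * J + 2) = b ^ M" unfolding power_add[symmetric] i ..
  qed (use b in \<open>simp_all add: e_def p_def M power_add[symmetric]\<close>)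
  have pe: "p \<le> e * e" unfolding e p_def using b M by (intro power_decreasing) auto
  \<comment> \<open>Here p = b^(M - 2) is split into b^(M/2), which goes with the gradient, and e = b^(M/2 - 2).\<close>
  have young: "c * p * D * (z + V x) \<le> b ^ M * Dsq x / 2 + e * e * c\<^sup>2 * (z\<^sup>2 + (V x)\<^sup>2)"
  proof -
    define X Y where "X = b ^ (2 * J + 2) * D" and "Y = c * e * (z + V x)"
    have "c * p * D * (z + V x) = X * Y" unfolding X_def Y_def e(3)[symmetric] by (simp add: mult_ac)
    also have "\<dots> \<le> X\<^sup>2 / 2 + Y\<^sup>2 / 2" using sum_squares_bound[of X Y] by (simp add: field_simps)
    also have "X\<^sup>2 = b ^ M * Dsq x"
      unfolding X_def power_mult_distrib D(2) using e(4) by (simp add: power2_eq_square)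
    also have "Y\<^sup>2 \<le> (c * e)\<^sup>2 * (2 * (z\<^sup>2 + (V x)\<^sup>2))"
    proof -
      have "(z + V x)\<^sup>2 \<le> 2 * (z\<^sup>2 + (V x)\<^sup>2)"
        using sum_squares_bound[of z "V x"] by (simp add: power2_sum)
      then show ?thesis unfolding Y_def power_mult_distrib[of "c * e"] by (intro mult_left_mono) auto
    qed
    finally have "c * p * D * (z + V x) \<le> b ^ M * Dsq x / 2 + (c * e)\<^sup>2 * (2 * (z\<^sup>2 + (V x)\<^sup>2)) / 2"
      by simp
    also have "(c * e)\<^sup>2 * (2 * (z\<^sup>2 + (V x)\<^sup>2)) / 2 = e * e * c\<^sup>2 * (z\<^sup>2 + (V x)\<^sup>2)"
      by (simp only: power_mult_distrib power2_eq_square[of e] mult_ac nonzero_mult_div_cancel_left)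
    finally show ?thesis .
  qed
  have zzx: "sq_plus_cube x = z\<^sup>2 + z\<^sup>2 * z" by (simp add: sq_plus_cube_def z_def power3_eq_cube power2_eq_square)
  have VW: "(V x)\<^sup>2 \<le> 2 * pi * W x" "z\<^sup>2 * V x \<le> 2 * pi * sq_plus_cube x + W x"
    using V_sq_le_W[OF x(3)] sq_mult_V_le_W[OF x(3)] by (auto simp: z_def)
  define S where "S = sq_plus_cube x + (V x)\<^sup>2 + z\<^sup>2 * V x"
  have S: "S \<le> (1 + 2 * pi) * (sq_plus_cube x + W x)"
    using VW unfolding S_def by (simp add: algebra_simps)
  have S1: "z\<^sup>2 \<le> S" "z\<^sup>2 + (V x)\<^sup>2 \<le> S" "z\<^sup>2 * (z + V x) \<le> S" "0 \<le> S"
    using z V0 unfolding S_def zzx by (auto simp: algebra_simps)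
  have "4 * (D + z\<^sup>2) * (40 * N\<^sup>2 * p * (z + V x)) = c * p * D * (z + V x) + p * (c * (z\<^sup>2 * (z + V x)))"
    by (simp add: c_def algebra_simps)
  then have "\<bar>Q k k' x\<bar> \<le> b ^ M * Dsq x / 2 + e * e * c\<^sup>2 * (z\<^sup>2 + (V x)\<^sup>2)
      + p * (c * (z\<^sup>2 * (z + V x))) + p * (8 * \<bar>a\<bar> * N * z\<^sup>2)"
    using Q1 young by (simp add: mult_ac)
  also have "\<dots> \<le> b ^ M * Dsq x / 2 + e * e * c\<^sup>2 * S + e * e * (c * S) + e * e * (8 * \<bar>a\<bar> * N * S)"
    using S1 pe p e c0 N z V0 by (intro add_mono mult_mono order_refl) (auto intro!: mult_nonneg_nonneg)
  also have "\<dots> = b ^ M * Dsq x / 2 + (e * e) * ((c\<^sup>2 + c + 8 * \<bar>a\<bar> * N) * S)"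
    by (simp add: algebra_simps)
  also have "\<dots> \<le> b ^ M * Dsq x / 2 + (e * e) * ((c\<^sup>2 + c + 8 * \<bar>a\<bar> * N) * ((1 + 2 * pi) * (sq_plus_cube x + W x)))"
    using S e b c0 N by (intro add_left_mono mult_left_mono) auto
  also have "\<dots> = b ^ M * Dsq x / 2 + outer_error M * (b ^ (4 * J) * (sq_plus_cube x + W x))"
    unfolding outer_error_def e N_def[symmetric] c_def[symmetric] by (simp add: mult_ac)
  finally show ?thesis .
qed

lemma cont_Dsq: "continuous_on Om Dsq"
  unfolding Dsq_def[abs_def]
  by (intro continuous_intros C1_gradD(4)[OF d11] C1_gradD(4)[OF d12] C1_gradD(4)[OF d21] C1_gradD(4)[OF d22])

lemma cont_W: "continuous_on Om W"
  unfolding W_def by (intro continuous_on_circle_int cont_sq_plus_cube continuous_intros)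

text \<open>The identity with the two bounds on Q inserted. The circle integral W disappears because the
  weight is radial.\<close>

lemma energy_inequality:
  assumes \<delta>: "0 < \<delta>" "\<delta> \<le> 1 / 2" and R: "4 \<le> R" and M: "M = 4 * J + 4"
  shows "(LINT x:annulus (1 + \<delta>) (4 * R\<^sup>2)|lborel. eta \<delta> R M (sqn x) * Dsq x)
    \<le> 4 * pi * inner_error * \<delta> + 2 * outer_error M * (1 + 2 * pi)
        * (LINT x:annulus (R\<^sup>2) (4 * R\<^sup>2)|lborel. bump (R\<^sup>2) (3 * R\<^sup>2) (sqn x) ^ (4 * J) * sq_plus_cube x)"
proof -
  have M3: "3 \<le> M" using M by simp
  note par = \<delta> R M3
  note R2 = R_sq[OF par]
  let ?K = "annulus (1 + \<delta>) (4 * R\<^sup>2)" and ?I = "annulus (1 + \<delta>) (1 + 2 * \<delta>)"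
  let ?O = "annulus (R\<^sup>2) (4 * R\<^sup>2)"
  let ?g = "eta \<delta> R M" and ?k = "twice_eta' \<delta> R M" and ?k' = "twice_eta'' \<delta> R M"
  let ?b = "\<lambda>x. bump (R\<^sup>2) (3 * R\<^sup>2) (sqn x)"
  have sub: "?I \<subseteq> ?K" "?O \<subseteq> ?K" using \<delta> R2 by (auto simp: annulus_def)
  have KOm: "?K \<subseteq> Om" using \<delta> by (intro annulus_subset_Om) simp
  note E = energy_identity[OF DERIV_eta[OF par] DERIV_twice_eta'[OF par] continuous_on_twice_eta''[OF par],
      of "1 + \<delta>" "4 * R\<^sup>2"]
  have E1: "(LINT x:?K|lborel. ?g (sqn x) * Dsq x + Q ?k ?k' x) = 0"
    and E2: "set_integrable lborel ?K (\<lambda>x. ?g (sqn x) * Dsq x + Q ?k ?k' x)"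
    using \<delta> eta_outside[OF par] by (auto intro!: E)
  have gc: "continuous_on UNIV ?g"
    by (intro continuous_at_imp_continuous_on ballI DERIV_isCont[OF DERIV_eta[OF par]])
  have gD: "continuous_on Om (\<lambda>x. ?g (sqn x) * Dsq x)"
    by (intro continuous_intros continuous_on_compose2[OF gc] cont_Dsq) auto
  have bc: "continuous_on S ?b" for S
    by (rule continuous_on_compose2[OF continuous_on_bump[of "3 * R\<^sup>2" UNIV]])
      (use R2 in \<open>auto intro!: continuous_intros\<close>)
  have G1: "set_integrable lborel ?K (\<lambda>x. ?g (sqn x) * Dsq x / 2)"
    by (intro set_integrable_continuous_compact compact_annulus continuous_on_subset[OF _ KOm]
        continuous_intros gD) auto
  let ?f = "\<lambda>x. outer_error M * (?b x ^ (4 * J) * (sq_plus_cube x + W x))"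
  have fO: "set_integrable lborel ?O ?f"
    by (intro set_integrable_continuous_compact compact_annulus continuous_intros bc
        continuous_on_subset[OF cont_sq_plus_cube] continuous_on_subset[OF cont_W]) (use KOm sub in auto)
  have G3: "set_integrable lborel ?K (\<lambda>x. indicator ?O x * ?f x)"
    using fO by (simp only: set_integral_indicator_subset(2)[OF sub(2)])
  have G2: "set_integrable lborel ?K (\<lambda>x. indicator ?I x * inner_error)"
    by (simp only: set_integral_indicator_subset(2)[OF sub(1)])
      (intro set_integrable_continuous_compact compact_annulus continuous_intros)
  have pt: "?g (sqn x) * Dsq x / 2 - (indicator ?I x * inner_error + indicator ?O x * ?f x)
      \<le> ?g (sqn x) * Dsq x + Q ?k ?k' x" if x: "x \<in> ?K" for x
  proof -
    have xOm: "x \<in> Om" using x KOm by auto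
    have x1: "1 + \<delta> \<le> sqn x" "sqn x \<le> 4 * R\<^sup>2" using x by (auto simp: annulus_def)
    have gD0: "0 \<le> ?g (sqn x) * Dsq x"
      using eta_bounds[OF par] Dsq_nonneg by (intro mult_nonneg_nonneg) auto
    have inner_error: "0 \<le> inner_error" using C0_nonneg by (simp add: inner_error_def)
    have f0: "0 \<le> ?f x"
      using outer_error_nonneg bump_bounds(1) W_nonneg[OF xOm] by (intro mult_nonneg_nonneg) (auto simp: sq_plus_cube_def)
    consider "sqn x \<le> 1 + 2 * \<delta>" | "1 + 2 * \<delta> \<le> sqn x" "sqn x \<le> R\<^sup>2" | "R\<^sup>2 \<le> sqn x" by linarith
    then show ?thesis
    proof cases
      case 1
      have "\<bar>Q ?k ?k' x\<bar> \<le> inner_error"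
        by (rule Q_inner[where k="?k" and k'="?k'", OF \<delta> x1(1) 1 eta_inner[OF par x1(1) 1]])
      moreover have "indicator ?I x = (1::real)" using 1 x1 by (simp add: annulus_def)
      moreover have "0 \<le> indicator ?O x * ?f x" using f0 by (simp add: indicator_def)
      ultimately show ?thesis using gD0 by simp
    next
      case 2
      have "Q ?k ?k' x = 0" using eta_plateau[OF par 2] by (simp add: Q_def Let_def)
      moreover have "0 \<le> indicator ?O x * ?f x" "0 \<le> indicator ?I x * inner_error"
        using f0 inner_error by (simp_all add: indicator_def)
      ultimately show ?thesis using gD0 by simp
    next
      case 3
      then have x2: "1 + 2 * \<delta> \<le> sqn x" using R2 \<delta> by linarith
      note o = eta_outer[OF par x2]
      have L: "0 < 3 * R\<^sup>2" using R2 by simp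
      have "\<bar>Q ?k ?k' x\<bar> \<le> ?b x ^ M * Dsq x / 2 + outer_error M * (?b x ^ (4 * J) * (sq_plus_cube x + W x))"
      proof (rule Q_outer[where k="?k" and k'="?k'" and b="?b x", OF _ M 3 x1(2) xOm])
        show "1 \<le> R" using R by simp
        have "\<bar>?k (sqn x)\<bar> \<le> 2 * (3 * real M / (3 * R\<^sup>2) * ?b x ^ (M - 1))"
          using cutoff'_bound[OF L, of M "R\<^sup>2" "sqn x"] M3 unfolding o by simp
        then show "\<bar>?k (sqn x)\<bar> \<le> 2 * real M * ?b x ^ (M - 1) / R\<^sup>2" by simp
        have "\<bar>?k' (sqn x)\<bar> \<le> 2 * (9 * (real M)\<^sup>2 / (3 * R\<^sup>2)\<^sup>2 * ?b x ^ (M - 2))"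
          using cutoff''_bound[OF L M3, of "R\<^sup>2" "sqn x"] unfolding o by simp
        then show "\<bar>?k' (sqn x)\<bar> \<le> 2 * (real M)\<^sup>2 * ?b x ^ (M - 2) / R ^ 4"
          by (simp add: power_mult_distrib)
      qed (use bump_bounds in auto)
      moreover have "?b x ^ M = ?g (sqn x)" by (simp add: o cutoff_def)
      moreover have "indicator ?O x = (1::real)" using 3 x1 by (simp add: annulus_def)
      moreover have "0 \<le> indicator ?I x * inner_error" using inner_error by (simp add: indicator_def)
      ultimately show ?thesis by simp
    qed
  qed
  have "(LINT x:?K|lborel. ?g (sqn x) * Dsq x / 2 - (indicator ?I x * inner_error + indicator ?O x * ?f x)) \<le> 0"
    unfolding E1[symmetric]
    by (rule set_integral_mono[OF set_integral_diff(1)[OF G1 set_integral_add(1)[OF G2 G3]] E2 pt])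
  then have "(LINT x:?K|lborel. ?g (sqn x) * Dsq x / 2)
      \<le> (LINT x:?K|lborel. indicator ?I x * inner_error) + (LINT x:?K|lborel. indicator ?O x * ?f x)"
    by (subst (asm) set_integral_diff(2)[OF G1 set_integral_add(1)[OF G2 G3]],
        subst (asm) set_integral_add(2)[OF G2 G3]) simp
  also have "(LINT x:?K|lborel. indicator ?I x * inner_error) = (LINT x:?I|lborel. inner_error)"
    by (rule set_integral_indicator_subset(1)[OF sub(1)])
  also have "\<dots> = inner_error * measure lborel ?I"
    using compact_annulus[THEN borel_compact]
    by (simp add: set_lebesgue_integral_def)
  also have "(LINT x:?K|lborel. indicator ?O x * ?f x) = (LINT x:?O|lborel. ?f x)"
    by (rule set_integral_indicator_subset(1)[OF sub(2)])
  also have "(LINT x:?O|lborel. ?f x) = outer_error M * (LINT x:?O|lborel. ?b x ^ (4 * J) * (sq_plus_cube x + W x))"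
    by simp
  also have "(LINT x:?O|lborel. ?b x ^ (4 * J) * (sq_plus_cube x + W x))
      = (LINT x:?O|lborel. ?b x ^ (4 * J) * sq_plus_cube x) + (LINT x:?O|lborel. ?b x ^ (4 * J) * W x)"
    unfolding distrib_left
    by (intro set_integral_add(2) set_integrable_continuous_compact compact_annulus continuous_intros bc
        continuous_on_subset[OF cont_sq_plus_cube] continuous_on_subset[OF cont_W]) (use KOm sub in auto)
  also have "(LINT x:?O|lborel. ?b x ^ (4 * J) * W x) = 2 * pi * (LINT x:?O|lborel. ?b x ^ (4 * J) * sq_plus_cube x)"
    unfolding W_def
  proof (rule integral_annulus_circle_int[OF cont_sq_plus_cube])
    show "continuous_on UNIV (\<lambda>s. bump (R\<^sup>2) (3 * R\<^sup>2) s ^ (4 * J))"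
      by (intro continuous_intros continuous_on_bump) (use R2 in auto)
  qed (use R2 in auto)
  finally have "(LINT x:?K|lborel. ?g (sqn x) * Dsq x) / 2 \<le> inner_error * measure lborel ?I
      + outer_error M * ((1 + 2 * pi) * (LINT x:?O|lborel. ?b x ^ (4 * J) * sq_plus_cube x))"
    by (simp add: algebra_simps)
  moreover have "inner_error * measure lborel ?I \<le> inner_error * (2 * pi * \<delta>)"
    using C0_nonneg by (intro mult_left_mono measure_thin_annulus \<delta>) (simp add: inner_error_def)
  ultimately show ?thesis by (simp add: algebra_simps)
qed

end

section \<open>Integrability of higher powers of the velocity\<close>

text \<open>For z \<le> 1 the first term on the right suffices. For z > 1 the comparison is between the second
  term, if b^4 z^(q - 1) is at least 1, and the first one otherwise: then b^(4 J) beats z^(3 - q), and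
  such a J exists because q > 1.\<close>

lemma powr_interpolation:
  fixes q z b :: real
  assumes q: "1 < q" "q \<le> 2" and J: "3 - q \<le> real J * (q - 1)" and b: "0 \<le> b" "b \<le> 1"
    and z: "0 \<le> z" and j: "2 \<le> j" "j \<le> 3"
  shows "b ^ (4 * J) * z ^ j \<le> z powr q + b ^ (4 * J + 4) * z powr (q + 2)"
proof (cases "z \<le> 1")
  case True
  have "b ^ (4 * J) * z ^ j \<le> 1 * z powr q"
  proof (rule mult_mono)
    show "z ^ j \<le> z powr q"
    proof (cases "z = 0")
      case False
      then have "z ^ j = z powr real j" using z by (simp add: powr_realpow)
      also have "\<dots> \<le> z powr q" using q j z True False by (intro powr_mono') auto
      finally show ?thesis .
    qed (use j in \<open>auto simp: power_0_left\<close>)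
  qed (use b z in \<open>auto intro: power_le_one\<close>)
  then show ?thesis using b by (simp add: add_increasing2)
next
  case False
  then have z1: "1 < z" by simp
  have zj: "z ^ j \<le> z powr 3"
    using z1 j power_increasing[of j 3 z] by (simp add: powr_numeral)
  define w where "w = b ^ 4 * z powr (q - 1)"
  have w0: "0 \<le> w" using b by (simp add: w_def)
  show ?thesis
  proof (cases "1 \<le> w")
    case True
    have "b ^ (4 * J) * z ^ j \<le> (b ^ (4 * J) * z powr 3) * 1"
      using zj b by (simp add: mult_left_mono)
    also have "\<dots> \<le> (b ^ (4 * J) * z powr 3) * w" using True b by (intro mult_left_mono) auto
    also have "\<dots> = b ^ (4 * J + 4) * (z powr 3 * z powr (q - 1))"
      by (simp add: w_def power_add mult_ac)
    also have "z powr 3 * z powr (q - 1) = z powr (q + 2)" by (simp flip: powr_add add: algebra_simps)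
    finally show ?thesis by (simp add: add_increasing)
  next
    case False
    have "w ^ J \<le> 1" using False w0 by (intro power_le_one) auto
    moreover have "w ^ J = b ^ (4 * J) * z powr (real J * (q - 1))"
    proof -
      have "(z powr (q - 1)) ^ J = z powr (real J * (q - 1))"
        using z1 by (simp add: powr_power mult.commute)
      then show ?thesis by (simp add: w_def power_mult_distrib power_mult)
    qed
    ultimately have "b ^ (4 * J) * z powr (real J * (q - 1)) \<le> 1" by simp
    moreover have "z powr (3 - q) \<le> z powr (real J * (q - 1))" using J z1 by (intro powr_mono) auto
    ultimately have 1: "b ^ (4 * J) * z powr (3 - q) \<le> 1"
      using b by (meson mult_left_mono order_trans zero_le_power)
    have "b ^ (4 * J) * z ^ j \<le> b ^ (4 * J) * z powr 3" using zj b by (intro mult_left_mono) auto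
    also have "z powr 3 = z powr (3 - q) * z powr q" by (simp flip: powr_add)
    also have "b ^ (4 * J) * (z powr (3 - q) * z powr q) \<le> 1 * z powr q"
      using 1 mult_right_mono[OF 1, of "z powr q"] by (simp add: mult.assoc)
    finally show ?thesis using b by (simp add: add_increasing2)
  qed
qed

lemma set_integral_Cauchy_Schwarz:
  fixes f g :: "'a::euclidean_space \<Rightarrow> real"
  assumes K: "compact K" and f: "continuous_on K f" and g: "continuous_on K g"
  shows "(LINT x:K|lborel. f x * g x)\<^sup>2 \<le> (LINT x:K|lborel. (f x)\<^sup>2) * (LINT x:K|lborel. (g x)\<^sup>2)"
proof -
  define A B C where "A = (LINT x:K|lborel. (f x)\<^sup>2)" and "B = (LINT x:K|lborel. f x * g x)"
    and "C = (LINT x:K|lborel. (g x)\<^sup>2)"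
  note I = set_integrable_continuous_compact[OF K]
  have iA: "set_integrable lborel K (\<lambda>x. (f x)\<^sup>2)" and iB: "set_integrable lborel K (\<lambda>x. f x * g x)"
    and iC: "set_integrable lborel K (\<lambda>x. (g x)\<^sup>2)"
    by (intro I continuous_intros f g)+
  have quad: "0 \<le> t\<^sup>2 * A - 2 * t * B + C" for t
  proof -
    have "0 \<le> (LINT x:K|lborel. (t * f x - g x)\<^sup>2)"
      by (auto simp: set_lebesgue_integral_def intro!: Bochner_Integration.integral_nonneg)
    also have "(\<lambda>x. (t * f x - g x)\<^sup>2) = (\<lambda>x. (t\<^sup>2 * (f x)\<^sup>2 - 2 * t * (f x * g x)) + (g x)\<^sup>2)"
      by (simp add: fun_eq_iff power2_eq_square algebra_simps)
    also have "(LINT x:K|lborel. (t\<^sup>2 * (f x)\<^sup>2 - 2 * t * (f x * g x)) + (g x)\<^sup>2) = t\<^sup>2 * A - 2 * t * B + C"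
      unfolding A_def B_def C_def using iA iB iC
      by (subst set_integral_add(2) set_integral_diff(2); simp add: set_integral_diff)+
    finally show ?thesis .
  qed
  have A0: "0 \<le> A" unfolding A_def
    by (auto simp: set_lebesgue_integral_def intro!: Bochner_Integration.integral_nonneg)
  have "B\<^sup>2 \<le> A * C"
  proof (cases "A = 0")
    case True
    have "B = 0"
    proof (rule ccontr)
      assume "B \<noteq> 0"
      then show False using quad[of "(C + 1) / (2 * B)"] True by simp
    qed
    then show ?thesis using True by simp
  next
    case False
    then have "0 < A" using A0 by simp
    moreover have "0 \<le> A * ((B / A)\<^sup>2 * A - 2 * (B / A) * B + C)"
      using quad[of "B / A"] A0 by (intro mult_nonneg_nonneg) auto
    ultimately show ?thesis by (simp add: power2_eq_square field_simps)
  qed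
  then show ?thesis by (simp add: A_def B_def C_def)
qed

lemma has_derivative_norm_powr:
  fixes y :: "'a::real_inner"
  assumes "1 < \<sigma>"
  shows "((\<lambda>y. norm y powr \<sigma>) has_derivative (\<lambda>d. \<sigma> * (norm y powr (\<sigma> - 2) *\<^sub>R y \<bullet> d))) (at y)"
proof (cases "y = 0")
  case True
  have "((\<lambda>h::'a. norm h powr (\<sigma> - 1)) \<longlongrightarrow> 0 powr (\<sigma> - 1)) (at 0)"
    by (rule tendsto_powr2[OF tendsto_norm_zero[OF tendsto_ident_at] tendsto_const]) (use assms in auto)
  then have "((\<lambda>h::'a. norm h powr (\<sigma> - 1)) \<longlongrightarrow> 0) (at 0)" by (simp only: powr_0)
  then have "((\<lambda>h::'a. norm (norm h powr \<sigma>) / norm h) \<longlongrightarrow> 0) (at 0)"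
  proof (rule Lim_transform_eventually)
    show "\<forall>\<^sub>F h in at (0::'a). norm h powr (\<sigma> - 1) = norm (norm h powr \<sigma>) / norm h"
      unfolding eventually_at_filter
      by (intro always_eventually) (auto simp: powr_diff)
  qed
  then show ?thesis using True by (simp add: has_derivative_at)
next
  case False
  then have "((\<lambda>t. t powr \<sigma>) has_derivative (*) (\<sigma> * norm y powr (\<sigma> - 1))) (at (norm y))"
    using has_real_derivative_powr[of "norm y" \<sigma>] by (simp add: has_field_derivative_def)
  from has_derivative_compose[OF has_derivative_norm[OF False] this]
  show ?thesis
    by (rule has_derivative_eq_rhs)
      (use False in \<open>auto simp: fun_eq_iff powr_diff power2_eq_square sgn_div_norm inner_commute field_simps\<close>)
qed

lemma continuous_on_norm_powr_scaleR:
  assumes "1 < \<sigma>"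
  shows "continuous_on UNIV (\<lambda>y::'a::real_inner. norm y powr (\<sigma> - 2) *\<^sub>R y)"
proof (intro continuous_at_imp_continuous_on ballI)
  fix y :: 'a
  show "isCont (\<lambda>y. norm y powr (\<sigma> - 2) *\<^sub>R y) y"
  proof (cases "y = 0")
    case True
    have "((\<lambda>h::'a. norm h powr (\<sigma> - 1)) \<longlongrightarrow> 0 powr (\<sigma> - 1)) (at 0)"
      by (rule tendsto_powr2[OF tendsto_norm_zero[OF tendsto_ident_at] tendsto_const]) (use assms in auto)
    then have "((\<lambda>h::'a. norm h powr (\<sigma> - 1)) \<longlongrightarrow> 0) (at 0)" by (simp only: powr_0)
    then have "((\<lambda>h::'a. norm (norm h powr (\<sigma> - 2) *\<^sub>R h)) \<longlongrightarrow> 0) (at 0)"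
    proof (rule Lim_transform_eventually)
      show "\<forall>\<^sub>F h in at (0::'a). norm h powr (\<sigma> - 1) = norm (norm h powr (\<sigma> - 2) *\<^sub>R h)"
        unfolding eventually_at_filter
        by (intro always_eventually) (auto simp: powr_diff power2_eq_square)
    qed
    then have "((\<lambda>h::'a. norm h powr (\<sigma> - 2) *\<^sub>R h) \<longlongrightarrow> 0) (at 0)" by (rule tendsto_norm_zero_cancel)
    then show ?thesis using True by (simp add: isCont_def)
  next
    case False
    then show ?thesis unfolding isCont_def by (intro tendsto_intros) auto
  qed
qed

context rotating_perturbation
begin

lemma v_has_derivative:
  assumes x: "x \<in> Om"
  shows "(v has_derivative (\<lambda>d. vector [d11 x * d $ 1 + d21 x * d $ 2, d12 x * d $ 1 + d22 x * d $ 2])) (at x)"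
proof (subst has_derivative_componentwise_within, intro ballI)
  fix b :: "real^2" assume "b \<in> Basis"
  then obtain i where b: "b = axis i 1" by (auto simp: Basis_vec_def)
  have "i = 1 \<or> i = 2" by (rule exhaust_2)
  then show "((\<lambda>x. v x \<bullet> b) has_derivative (\<lambda>d. vector [d11 x * d $ 1 + d21 x * d $ 2, d12 x * d $ 1 + d22 x * d $ 2] \<bullet> b)) (at x)"
    using C1_gradD(1)[OF v1 x] C1_gradD(1)[OF v2 x] by (auto simp: b inner_axis)
qed

lemma norm_v_powr_C1:
  assumes \<sigma>: "1 < \<sigma>"
  shows "C1_grad Om (\<lambda>x. norm (v x) powr \<sigma>)
    (\<lambda>x. \<sigma> * ((norm (v x) powr (\<sigma> - 2) *\<^sub>R v x) \<bullet> vector [d11 x, d12 x]))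
    (\<lambda>x. \<sigma> * ((norm (v x) powr (\<sigma> - 2) *\<^sub>R v x) \<bullet> vector [d21 x, d22 x]))"
  unfolding C1_grad_def
proof (intro conjI ballI)
  have c: "continuous_on Om (\<lambda>x. norm (v x) powr (\<sigma> - 2) *\<^sub>R v x)"
    by (rule continuous_on_compose2[OF continuous_on_norm_powr_scaleR[OF \<sigma>] cont_v]) simp
  show "continuous_on Om (\<lambda>x. \<sigma> * ((norm (v x) powr (\<sigma> - 2) *\<^sub>R v x) \<bullet> vector [d11 x, d12 x]))"
    "continuous_on Om (\<lambda>x. \<sigma> * ((norm (v x) powr (\<sigma> - 2) *\<^sub>R v x) \<bullet> vector [d21 x, d22 x]))"
    by (intro continuous_on_mult continuous_on_const continuous_on_inner c continuous_on_vector2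
        C1_gradD(4)[OF d11] C1_gradD(4)[OF d12] C1_gradD(4)[OF d21] C1_gradD(4)[OF d22])+
  fix x assume x: "x \<in> Om"
  from has_derivative_compose[OF v_has_derivative[OF x] has_derivative_norm_powr[OF \<sigma>]]
  show "((\<lambda>x. norm (v x) powr \<sigma>) has_derivative
      (\<lambda>d. \<sigma> * ((norm (v x) powr (\<sigma> - 2) *\<^sub>R v x) \<bullet> vector [d11 x, d12 x]) * d $ 1
         + \<sigma> * ((norm (v x) powr (\<sigma> - 2) *\<^sub>R v x) \<bullet> vector [d21 x, d22 x]) * d $ 2)) (at x)"
    by (rule has_derivative_eq_rhs) (simp add: fun_eq_iff inner_vec_def sum_2 algebra_simps)
qed

lemma gradient_norm_v_powr_le:
  assumes \<sigma>: "1 < \<sigma>" and s: "p\<^sup>2 + p'\<^sup>2 \<le> Dsq x"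
  shows "\<bar>(norm (v x) powr (\<sigma> - 2) *\<^sub>R v x) \<bullet> vector [p, p']\<bar> \<le> norm (v x) powr (\<sigma> - 1) * sqrt (Dsq x)"
proof -
  have "norm (vector [p, p'] :: real^2) \<le> sqrt (Dsq x)"
    using s by (simp add: norm_vec_def L2_set_def sum_2)
  then have "norm (norm (v x) powr (\<sigma> - 2) *\<^sub>R v x) * norm (vector [p, p'] :: real^2)
      \<le> norm (norm (v x) powr (\<sigma> - 2) *\<^sub>R v x) * sqrt (Dsq x)" by (intro mult_left_mono) auto
  moreover have "norm (norm (v x) powr (\<sigma> - 2) *\<^sub>R v x) = norm (v x) powr (\<sigma> - 1)"
    by (cases "v x = 0") (auto simp: powr_diff power2_eq_square)
  ultimately show ?thesis
    using Cauchy_Schwarz_ineq2[of "norm (v x) powr (\<sigma> - 2) *\<^sub>R v x" "vector [p, p']"] by simp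
qed

text \<open>Supported in the annulus between R/2 and 2 R. For norms from R on it agrees with the bump
  whose M-th power is the outer part of eta; the additional factor separates it from the disk.\<close>

definition theta :: "real \<Rightarrow> real \<Rightarrow> real" where
  "theta R s = bump (R\<^sup>2) (3 * R\<^sup>2) s * bump (- (R\<^sup>2)) (3 * R\<^sup>2 / 4) (- s)"

lemma theta_bounds: "0 \<le> theta R s" "theta R s \<le> bump (R\<^sup>2) (3 * R\<^sup>2) s" "theta R s \<le> 1"
proof -
  note b = bump_bounds[of "R\<^sup>2" "3 * R\<^sup>2" s] bump_bounds[of "- (R\<^sup>2)" "3 * R\<^sup>2 / 4" "- s"]
  show "0 \<le> theta R s" using b by (simp add: theta_def)
  show 1: "theta R s \<le> bump (R\<^sup>2) (3 * R\<^sup>2) s" using b mult_left_mono[OF b(4) b(1)] by (simp add: theta_def)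
  show "theta R s \<le> 1" using 1 b by linarith
qed

lemma continuous_on_theta: "R \<noteq> 0 \<Longrightarrow> continuous_on S (\<lambda>x. theta R (sqn x))"
  unfolding theta_def
  by (intro continuous_intros continuous_on_compose2[OF continuous_on_bump[of "3 * R\<^sup>2" UNIV]]
     continuous_on_compose2[OF continuous_on_bump[of "3 * R\<^sup>2 / 4" UNIV]]) auto

text \<open>Gagliardo's inequality for the localised power 1 + q/2 of the modulus of v. The gradient of this
  power is at most 2 |v|^(q/2) |grad v|, and Cauchy-Schwarz separates the two factors.\<close>

lemma sobolev_step:
  assumes q: "1 < q" "q \<le> 2" and J: "3 - q \<le> real J * (q - 1)" and R: "4 \<le> R"
  defines "A \<equiv> annulus (R\<^sup>2 / 4) (4 * R\<^sup>2)"
  defines "S \<equiv> LINT x:A|lborel. theta R (sqn x) ^ (4 * J + 4) * norm (v x) powr (q + 2)"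
  defines "\<epsilon> \<equiv> LINT x:A|lborel. norm (v x) powr q"
  shows "S \<le> \<epsilon> * (800 * (real (2 * J + 2))\<^sup>2 * (\<epsilon> + S)
      + 8 * (LINT x:A|lborel. theta R (sqn x) ^ (4 * J + 4) * Dsq x))"
proof -
  define N where "N = 2 * J + 2"
  define \<sigma> where "\<sigma> = 1 + q / 2"
  have N: "2 \<le> N" "2 * N = 4 * J + 4" by (auto simp: N_def)
  have \<sigma>: "1 < \<sigma>" "\<sigma> \<le> 2" using q by (auto simp: \<sigma>_def)
  have R2: "16 \<le> R\<^sup>2" "0 < R" using power_mono[of 4 R 2] R by auto
  have R0: "R \<noteq> 0" using R by auto
  have L: "0 < 3 * R\<^sup>2" "0 < 3 * R\<^sup>2 / 4" using R2 by auto
  have AOm: "A \<subseteq> Om" unfolding A_def using R2 by (intro annulus_subset_Om) simp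
  have Ac: "compact A" unfolding A_def by (rule compact_annulus)
  let ?\<theta> = "\<lambda>x. theta R (sqn x)" and ?z = "\<lambda>x. norm (v x)"
  note tc = continuous_on_theta[OF R0]
  have zc: "continuous_on A ?z" using cont_v AOm by (intro continuous_intros) (rule continuous_on_subset)
  have Dc: "continuous_on A Dsq" using cont_Dsq AOm by (rule continuous_on_subset)
  have zpc: "continuous_on A (\<lambda>x. ?z x powr p)" if "0 < p" for p
    using that by (intro continuous_on_powr' zc continuous_intros) auto
  define chi where "chi s = cutoff N (R\<^sup>2) (3 * R\<^sup>2) s * cutoff N (- (R\<^sup>2)) (3 * R\<^sup>2 / 4) (- s)" for s
  define chi' where "chi' s = cutoff' N (R\<^sup>2) (3 * R\<^sup>2) s * cutoff N (- (R\<^sup>2)) (3 * R\<^sup>2 / 4) (- s)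
      + cutoff N (R\<^sup>2) (3 * R\<^sup>2) s * (cutoff' N (- (R\<^sup>2)) (3 * R\<^sup>2 / 4) (- s) * (-1))" for s
  have chi: "chi s = theta R s ^ N" for s
    by (simp add: chi_def cutoff_def theta_def power_mult_distrib)
  have dchi: "(chi has_real_derivative chi' s) (at s)" for s
  proof -
    have "((\<lambda>s. - s) has_real_derivative -1) (at s)" by (auto intro!: derivative_eq_intros)
    from DERIV_mult[OF DERIV_cutoff[OF L(1) N(1)] DERIV_chain2[OF DERIV_cutoff[OF L(2) N(1)] this]]
    show ?thesis unfolding chi_def[abs_def] chi'_def by (rule DERIV_cong) simp
  qed
  have chi'c: "continuous_on UNIV chi'"
  proof -
    have c: "continuous_on T (cutoff N s0 M)" "continuous_on T (cutoff' N s0 M)" if "0 < M" for T s0 M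
      unfolding cutoff_def[abs_def] cutoff'_def[abs_def]
      using that by (intro continuous_intros continuous_on_bump; simp)+
    show ?thesis unfolding chi'_def
      by (intro continuous_intros c[OF L(1)] continuous_on_compose2[OF c(1)[OF L(2), of UNIV]]
          continuous_on_compose2[OF c(2)[OF L(2), of UNIV]]) auto
  qed
  have chi'b: "\<bar>chi' s\<bar> \<le> 5 * real N * theta R s ^ (N - 1) / R\<^sup>2" for s
  proof -
    define b c where "b = bump (R\<^sup>2) (3 * R\<^sup>2) s" and "c = bump (- (R\<^sup>2)) (3 * R\<^sup>2 / 4) (- s)"
    have bc: "0 \<le> b" "b \<le> 1" "0 \<le> c" "c \<le> 1" using bump_bounds by (auto simp: b_def c_def)
    have pw: "c ^ N \<le> c ^ (N - 1)" "b ^ N \<le> b ^ (N - 1)" using bc by (auto intro: power_decreasing)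
    have 1: "\<bar>cutoff' N (R\<^sup>2) (3 * R\<^sup>2) s * c ^ N\<bar> \<le> (real N / R\<^sup>2 * b ^ (N - 1)) * c ^ (N - 1)"
      unfolding abs_mult using cutoff'_bound[OF L(1) N(1), of "R\<^sup>2" s] pw bc
      by (intro mult_mono) (auto simp: b_def)
    have "\<bar>cutoff' N (- (R\<^sup>2)) (3 * R\<^sup>2 / 4) (- s) * (-1)\<bar> \<le> 4 * real N / R\<^sup>2 * c ^ (N - 1)"
      using cutoff'_bound[OF L(2) N(1), of "- (R\<^sup>2)" "- s"] by (simp add: c_def)
    moreover have "\<bar>b ^ N\<bar> \<le> b ^ (N - 1)" using pw bc by simp
    ultimately have 2: "\<bar>b ^ N * (cutoff' N (- (R\<^sup>2)) (3 * R\<^sup>2 / 4) (- s) * (-1))\<bar>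
        \<le> b ^ (N - 1) * (4 * real N / R\<^sup>2 * c ^ (N - 1))"
      unfolding abs_mult[of "b ^ N"] using bc by (intro mult_mono) auto
    have "\<bar>chi' s\<bar> \<le> \<bar>cutoff' N (R\<^sup>2) (3 * R\<^sup>2) s * c ^ N\<bar>
        + \<bar>b ^ N * (cutoff' N (- (R\<^sup>2)) (3 * R\<^sup>2 / 4) (- s) * (-1))\<bar>"
      unfolding chi'_def cutoff_def b_def[symmetric] c_def[symmetric] by (rule abs_triangle_ineq)
    also have "\<dots> \<le> (real N / R\<^sup>2 * b ^ (N - 1)) * c ^ (N - 1) + b ^ (N - 1) * (4 * real N / R\<^sup>2 * c ^ (N - 1))"
      using 1 2 by (rule add_mono)
    also have "\<dots> = 5 * real N * (b * c) ^ (N - 1) / R\<^sup>2"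
      by (simp add: power_mult_distrib algebra_simps flip: add_divide_distrib)
    finally show ?thesis by (simp add: theta_def b_def c_def)
  qed
  define g1 where "g1 x = \<sigma> * ((norm (v x) powr (\<sigma> - 2) *\<^sub>R v x) \<bullet> vector [d11 x, d12 x])" for x
  define g2 where "g2 x = \<sigma> * ((norm (v x) powr (\<sigma> - 2) *\<^sub>R v x) \<bullet> vector [d21 x, d22 x])" for x
  define F1 where "F1 x = chi' (sqn x) * (2 * x $ 1) * ?z x powr \<sigma> + chi (sqn x) * g1 x" for x
  define F2 where "F2 x = chi' (sqn x) * (2 * x $ 2) * ?z x powr \<sigma> + chi (sqn x) * g2 x" for x
  have C: "C1_grad Om (\<lambda>x. chi (sqn x) * ?z x powr \<sigma>) F1 F2"
    unfolding F1_def[abs_def] F2_def[abs_def] g1_def g2_def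
    by (intro C1_grad_mult C1_grad_radial[OF dchi chi'c] norm_v_powr_C1[OF \<sigma>(1)])
  have z0: "chi (sqn x) * ?z x powr \<sigma> = 0" if "x \<in> Om - A" for x
  proof -
    have "sqn x < R\<^sup>2 / 4 \<or> 4 * R\<^sup>2 < sqn x" using that by (auto simp: A_def annulus_def)
    then have "theta R (sqn x) = 0"
      using bump_eq_0[OF L(1), of "R\<^sup>2" "sqn x"] bump_eq_0[OF L(2), of "- (R\<^sup>2)" "- sqn x"]
      by (auto simp: theta_def)
    then show ?thesis using N by (simp add: chi)
  qed
  define Y where "Y x = 20 * real N * ?\<theta> x ^ (N - 1) * ?z x + 2 * ?\<theta> x ^ N * sqrt (Dsq x)" for x
  have Yc: "continuous_on A Y" unfolding Y_def[abs_def] by (intro continuous_intros tc zc Dc)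
  have Fb: "\<bar>chi' (sqn x) * (2 * y) * ?z x powr \<sigma> + chi (sqn x) * (\<sigma> * g)\<bar> \<le> ?z x powr (q / 2) * Y x"
    if x: "x \<in> A" and y: "\<bar>y\<bar> \<le> norm x" and g: "\<bar>g\<bar> \<le> ?z x powr (\<sigma> - 1) * sqrt (Dsq x)" for x y g
  proof -
    define t where "t = ?\<theta> x"
    have t: "0 \<le> t" using theta_bounds by (simp add: t_def)
    have "(norm x)\<^sup>2 \<le> (2 * R)\<^sup>2" using x by (simp add: A_def annulus_def sqn_norm power_mult_distrib)
    then have "norm x \<le> 2 * R" by (rule power2_le_imp_le) (use R in simp)
    then have y2: "\<bar>2 * y\<bar> \<le> 4 * R" using y by simp
    have "\<bar>chi' (sqn x)\<bar> * \<bar>2 * y\<bar> \<le> (5 * real N * t ^ (N - 1) / R\<^sup>2) * (4 * R)"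
      using chi'b[of "sqn x"] y2 t unfolding t_def by (intro mult_mono) auto
    also have "\<dots> = (20 * real N * t ^ (N - 1)) * (1 / R)" using R0 by (simp add: power2_eq_square)
    also have "\<dots> \<le> (20 * real N * t ^ (N - 1)) * 1" using R t by (intro mult_left_mono) auto
    finally have 1: "\<bar>chi' (sqn x) * (2 * y) * ?z x powr \<sigma>\<bar> \<le> 20 * real N * t ^ (N - 1) * ?z x powr \<sigma>"
      unfolding abs_mult by (simp add: mult_right_mono)
    have "\<bar>chi (sqn x) * (\<sigma> * g)\<bar> \<le> t ^ N * (2 * (?z x powr (\<sigma> - 1) * sqrt (Dsq x)))"
      unfolding abs_mult chi t_def[symmetric] using g \<sigma> t by (intro mult_mono) auto
    moreover have "?z x powr (\<sigma> - 1) = ?z x powr (q / 2)" by (simp add: \<sigma>_def)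
    moreover have "?z x powr \<sigma> = ?z x powr (q / 2) * ?z x" by (simp add: \<sigma>_def powr_add mult.commute)
    ultimately show ?thesis using 1 unfolding Y_def t_def[symmetric]
      by (intro order_trans[OF abs_triangle_ineq]) (simp add: algebra_simps)
  qed
  have F1b: "\<bar>F1 x\<bar> \<le> ?z x powr (q / 2) * Y x" if "x \<in> A" for x
    unfolding F1_def g1_def
    by (rule Fb[OF that component_le_norm_cart gradient_norm_v_powr_le[OF \<sigma>(1)]]) (simp add: Dsq_def)
  have F2b: "\<bar>F2 x\<bar> \<le> ?z x powr (q / 2) * Y x" if "x \<in> A" for x
    unfolding F2_def g2_def
    by (rule Fb[OF that component_le_norm_cart gradient_norm_v_powr_le[OF \<sigma>(1)]]) (simp add: Dsq_def)
  define Z where "Z = (LINT x:A|lborel. ?z x powr (q / 2) * Y x)"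
  note I = set_integrable_continuous_compact[OF Ac]
  have iZ: "set_integrable lborel A (\<lambda>x. ?z x powr (q / 2) * Y x)"
    using q by (intro I continuous_on_mult zpc Yc) auto
  have F12: "(LINT x:A|lborel. \<bar>F1 x\<bar>) \<le> Z" "(LINT x:A|lborel. \<bar>F2 x\<bar>) \<le> Z"
    unfolding Z_def
    by (intro set_integral_mono iZ I continuous_intros continuous_on_subset[OF C1_gradD(2)[OF C] AOm]
        continuous_on_subset[OF C1_gradD(3)[OF C] AOm] F1b F2b; assumption)+
  have "S = (LINT x:A|lborel. (chi (sqn x) * ?z x powr \<sigma>)\<^sup>2)"
  proof -
    have "(chi (sqn x) * ?z x powr \<sigma>)\<^sup>2 = ?\<theta> x ^ (4 * J + 4) * ?z x powr (q + 2)" for x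
    proof -
      have "(?z x powr \<sigma>)\<^sup>2 = ?z x powr (\<sigma> + \<sigma>)" unfolding power2_eq_square powr_add ..
      also have "\<sigma> + \<sigma> = q + 2" by (simp add: \<sigma>_def)
      finally show ?thesis unfolding power_mult_distrib chi N(2)[symmetric]
        by (simp add: power_mult[symmetric] mult.commute)
    qed
    then show ?thesis by (simp add: S_def)
  qed
  also have "\<dots> \<le> (LINT x:A|lborel. \<bar>F1 x\<bar>) * (LINT x:A|lborel. \<bar>F2 x\<bar>)"
    by (rule gagliardo[OF open_Om Ac AOm C z0])
  also have "\<dots> \<le> Z * Z"
    using F12 by (intro mult_mono) (auto simp: set_lebesgue_integral_def
        intro!: Bochner_Integration.integral_nonneg order_trans[OF _ F12(1)])
  also have "Z * Z = Z\<^sup>2" by (simp add: power2_eq_square)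
  also have "\<dots> \<le> (LINT x:A|lborel. (?z x powr (q / 2))\<^sup>2) * (LINT x:A|lborel. (Y x)\<^sup>2)"
    unfolding Z_def
    using q by (intro set_integral_Cauchy_Schwarz Ac zpc Yc) auto
  also have "(LINT x:A|lborel. (?z x powr (q / 2))\<^sup>2) = \<epsilon>"
    unfolding \<epsilon>_def by (simp add: power2_eq_square powr_add[symmetric])
  also have "\<epsilon> * (LINT x:A|lborel. (Y x)\<^sup>2) \<le> \<epsilon> * (800 * (real N)\<^sup>2 * (\<epsilon> + S)
      + 8 * (LINT x:A|lborel. ?\<theta> x ^ (4 * J + 4) * Dsq x))"
  proof (rule mult_left_mono)
    show "0 \<le> \<epsilon>" unfolding \<epsilon>_def
      by (auto simp: set_lebesgue_integral_def intro!: Bochner_Integration.integral_nonneg)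
    have i1: "set_integrable lborel A (\<lambda>x. ?z x powr q)"
      using q by (intro I zpc) auto
    have i2: "set_integrable lborel A (\<lambda>x. ?\<theta> x ^ (4 * J + 4) * ?z x powr (q + 2))"
      using q by (intro I continuous_on_mult continuous_on_power tc zpc) auto
    have i3: "set_integrable lborel A (\<lambda>x. ?\<theta> x ^ (4 * J + 4) * Dsq x)"
      by (intro I continuous_on_mult continuous_on_power tc Dc)
    have i12: "set_integrable lborel A (\<lambda>x. 800 * (real N)\<^sup>2 * (?z x powr q + ?\<theta> x ^ (4 * J + 4) * ?z x powr (q + 2)))"
      by (intro set_integrable_mult_right set_integral_add i1 i2)
    have i33: "set_integrable lborel A (\<lambda>x. 8 * (?\<theta> x ^ (4 * J + 4) * Dsq x))"
      by (intro set_integrable_mult_right i3)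
    have "(LINT x:A|lborel. (Y x)\<^sup>2) \<le> (LINT x:A|lborel. 800 * (real N)\<^sup>2 * (?z x powr q + ?\<theta> x ^ (4 * J + 4) * ?z x powr (q + 2))
        + 8 * (?\<theta> x ^ (4 * J + 4) * Dsq x))"
    proof (rule set_integral_mono)
      show "set_integrable lborel A (\<lambda>x. (Y x)\<^sup>2)" by (intro I continuous_intros Yc)
      show "set_integrable lborel A (\<lambda>x. 800 * (real N)\<^sup>2 * (?z x powr q + ?\<theta> x ^ (4 * J + 4) * ?z x powr (q + 2))
        + 8 * (?\<theta> x ^ (4 * J + 4) * Dsq x))" by (intro set_integral_add i12 i33)
      fix x
      define t z where "t = ?\<theta> x" and "z = ?z x"
      have t: "0 \<le> t" "t \<le> 1" using theta_bounds by (auto simp: t_def)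
      define X X' where "X = 20 * real N * t ^ (N - 1) * z" and "X' = 2 * t ^ N * sqrt (Dsq x)"
      have "(Y x)\<^sup>2 \<le> 2 * X\<^sup>2 + 2 * X'\<^sup>2"
        using sum_squares_bound[of X X'] unfolding Y_def X_def X'_def t_def z_def by (simp add: power2_sum)
      also have "X\<^sup>2 = 400 * (real N)\<^sup>2 * (t ^ (2 * (N - 1)) * z\<^sup>2)"
        by (simp add: X_def power_mult_distrib power_mult[symmetric] mult.commute)
      also have "X'\<^sup>2 = 4 * (t ^ (4 * J + 4) * Dsq x)"
        using Dsq_nonneg[of x] unfolding N(2)[symmetric]
        by (simp add: X'_def power_mult_distrib power_mult[symmetric] mult.commute)
      finally have "(Y x)\<^sup>2 \<le> 800 * (real N)\<^sup>2 * (t ^ (2 * (N - 1)) * z\<^sup>2) + 8 * (t ^ (4 * J + 4) * Dsq x)"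
        by simp
      moreover have "t ^ (2 * (N - 1)) * z\<^sup>2 \<le> z powr q + t ^ (4 * J + 4) * z powr (q + 2)"
      proof -
        have "t ^ (2 * (N - 1)) * z\<^sup>2 \<le> t ^ (4 * J) * z\<^sup>2"
          using t by (intro mult_right_mono power_decreasing) (auto simp: N_def)
        also have "\<dots> \<le> z powr q + t ^ (4 * J + 4) * z powr (q + 2)"
          by (rule powr_interpolation[OF q J t]) (auto simp: z_def)
        finally show ?thesis .
      qed
      then have "800 * (real N)\<^sup>2 * (t ^ (2 * (N - 1)) * z\<^sup>2)
          \<le> 800 * (real N)\<^sup>2 * (z powr q + t ^ (4 * J + 4) * z powr (q + 2))"
        by (intro mult_left_mono) auto
      ultimately show "(Y x)\<^sup>2 \<le> 800 * (real N)\<^sup>2 * (?z x powr q + ?\<theta> x ^ (4 * J + 4) * ?z x powr (q + 2))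
        + 8 * (?\<theta> x ^ (4 * J + 4) * Dsq x)" unfolding t_def z_def by linarith
    qed
    also have "\<dots> = 800 * (real N)\<^sup>2 * (\<epsilon> + S) + 8 * (LINT x:A|lborel. ?\<theta> x ^ (4 * J + 4) * Dsq x)"
      unfolding \<epsilon>_def S_def
      by (simp only: set_integral_add(2)[OF i12 i33] set_integral_add(2)[OF i1 i2] set_integral_mult_right)
    finally show "(LINT x:A|lborel. (Y x)\<^sup>2) \<le> 800 * (real N)\<^sup>2 * (\<epsilon> + S)
      + 8 * (LINT x:A|lborel. ?\<theta> x ^ (4 * J + 4) * Dsq x)" .
  qed
  finally show ?thesis by (simp add: N_def)
qed

end

section \<open>Vanishing of the dissipation\<close>

context rotating_perturbation
begin

abbreviation outer_mass :: "real \<Rightarrow> real \<Rightarrow> real" where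
  "outer_mass q R \<equiv> LINT x:annulus (R\<^sup>2 / 4) (4 * R\<^sup>2)|lborel. norm (v x) powr q"

lemma tail_small:
  assumes Lq: "set_integrable lborel Om (\<lambda>x. norm (v x) powr q)" and e: "0 < e"
  shows "\<exists>R\<ge>R0. 4 \<le> R \<and> outer_mass q R \<le> e"
proof -
  define f where "f x = indicator Om x * norm (v x) powr q" for x
  have fi: "integrable lborel f"
    using Lq by (simp add: set_integrable_def f_def[abs_def])
  have f0: "0 \<le> f x" for x by (simp add: f_def)
  have fm: "f \<in> borel_measurable lborel" using fi by (rule borel_measurable_integrable)
  let ?T = "\<lambda>n. {x::real^2. real n \<le> norm x}"
  have T: "?T n \<in> sets borel" for n
    by (intro borel_closed closed_Collect_le continuous_intros)
  have "(\<lambda>n. LINT x|lborel. indicator (?T n) x * f x) \<longlonglongrightarrow> (LINT x|(lborel::(real^2) measure). 0)"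
  proof (rule integral_dominated_convergence[where w=f])
    show "(\<lambda>x. indicator (?T n) x * f x) \<in> borel_measurable lborel" for n
      using fm T[of n] by (intro borel_measurable_times) auto
    show "AE x in lborel. (\<lambda>n. indicator (?T n) x * f x) \<longlonglongrightarrow> 0"
    proof (rule AE_I2)
      fix x :: "real^2"
      obtain N :: nat where N: "norm x < real N" using reals_Archimedean2 by blast
      have "\<forall>\<^sub>F n in sequentially. indicator (?T n) x * f x = 0"
        using eventually_ge_at_top[of N] by eventually_elim (use N in \<open>auto simp: indicator_def\<close>)
      then show "(\<lambda>n. indicator (?T n) x * f x) \<longlonglongrightarrow> 0" by (rule tendsto_eventually)
    qed
    show "AE x in lborel. norm (indicator (?T n) x * f x) \<le> f x" for n
      using f0 by (intro AE_I2) (auto simp: indicator_def)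
  qed (use fi in auto)
  then have "(\<lambda>n. LINT x|lborel. indicator (?T n) x * f x) \<longlonglongrightarrow> 0" by simp
  then have "\<forall>\<^sub>F n in sequentially. (LINT x|lborel. indicator (?T n) x * f x) < e"
    using e by (rule order_tendstoD)
  then obtain n0 where n0: "\<And>n. n0 \<le> n \<Longrightarrow> (LINT x|lborel. indicator (?T n) x * f x) < e"
    unfolding eventually_sequentially by blast
  obtain N1 :: nat where N1: "R0 < real N1" using reals_Archimedean2 by blast
  define n where "n = max n0 (max N1 4)"
  define R where "R = 2 * real n"
  have R: "R0 \<le> R" "4 \<le> R" using N1 by (auto simp: R_def n_def)
  have "outer_mass q R
      \<le> (LINT x|lborel. indicator (?T n) x * f x)"
    unfolding set_lebesgue_integral_def
  proof (rule Bochner_Integration.integral_mono')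
    show "integrable lborel (\<lambda>x. indicator (?T n) x * f x)"
      by (rule Bochner_Integration.integrable_bound[OF fi])
        (use fm T[of n] f0 in \<open>auto simp: indicator_def intro!: borel_measurable_times\<close>)
    fix x :: "real^2"
    show "0 \<le> indicator (?T n) x * f x" using f0 by simp
    show "indicator (annulus (R\<^sup>2 / 4) (4 * R\<^sup>2)) x *\<^sub>R norm (v x) powr q \<le> indicator (?T n) x * f x"
    proof (cases "x \<in> annulus (R\<^sup>2 / 4) (4 * R\<^sup>2)")
      case True
      then have "(real n)\<^sup>2 \<le> (norm x)\<^sup>2" by (simp add: annulus_def R_def sqn_norm power_mult_distrib)
      then have "real n \<le> norm x" by (rule power2_le_imp_le) simp
      moreover have "1 < real n" by (simp add: n_def)
      ultimately show ?thesis using True by (simp add: f_def)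
    qed (use f0 in simp)
  qed
  also have "\<dots> \<le> e" using n0[of n] by (simp add: n_def)
  finally show ?thesis using R by blast
qed

text \<open>The integral of |v|^2 + |v|^3 left by energy_inequality is at most the outer mass
  plus the integral of |v|^(q + 2), and the latter is at most a small multiple of the dissipation. Both
  are absorbed if the outer mass is below a threshold that depends on q, a and C0 only.\<close>

lemma dissipation_bound:
  assumes q: "1 < q" "q \<le> 2"
  shows "\<exists>J B \<epsilon>0. 0 \<le> B \<and> 0 < \<epsilon>0 \<and> (\<forall>\<delta> R. 0 < \<delta> \<longrightarrow> \<delta> \<le> 1 / 2 \<longrightarrow> 4 \<le> R \<longrightarrow>
     outer_mass q R \<le> \<epsilon>0 \<longrightarrow>
     (LINT x:annulus (1 + \<delta>) (4 * R\<^sup>2)|lborel. eta \<delta> R (4 * J + 4) (sqn x) * Dsq x)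
      \<le> B * (\<delta> + outer_mass q R))"
proof -
  obtain J :: nat where "(3 - q) / (q - 1) < real J" using reals_Archimedean2 by blast
  then have J: "3 - q \<le> real J * (q - 1)" using q by (simp add: field_simps)
  define M where "M = 4 * J + 4"
  have M3: "3 \<le> M" by (simp add: M_def)
  define n2 where "n2 = 800 * (real (2 * J + 2))\<^sup>2"
  define c1 where "c1 = 4 * pi * inner_error"
  define c2 where "c2 = 2 * outer_error M * (1 + 2 * pi)"
  have c: "0 \<le> c1" "0 \<le> c2" "0 < n2"
    using C0_nonneg outer_error_nonneg[of M] by (auto simp: c1_def inner_error_def c2_def n2_def)
  define \<epsilon>0 where "\<epsilon>0 = 1 / (2 * n2 + 64 * c2 + 1)"
  have e0: "0 < \<epsilon>0" using c by (simp add: \<epsilon>0_def)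
  have main: "(LINT x:annulus (1 + \<delta>) (4 * R\<^sup>2)|lborel. eta \<delta> R M (sqn x) * Dsq x)
      \<le> (2 * c1 + 8 * c2) * (\<delta> + outer_mass q R)"
    if \<delta>: "0 < \<delta>" "\<delta> \<le> 1 / 2" and R: "4 \<le> R"
    and small: "outer_mass q R \<le> \<epsilon>0" for \<delta> R
  proof -
    let ?A = "annulus (R\<^sup>2 / 4) (4 * R\<^sup>2)" and ?O = "annulus (R\<^sup>2) (4 * R\<^sup>2)"
    let ?K = "annulus (1 + \<delta>) (4 * R\<^sup>2)"
    let ?\<theta> = "\<lambda>x. theta R (sqn x)" and ?b = "\<lambda>x. bump (R\<^sup>2) (3 * R\<^sup>2) (sqn x)"
    let ?z = "\<lambda>x. norm (v x)"
    note R2 = R_sq[OF \<delta> R M3]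
    define \<epsilon> S F G where "\<epsilon> = (LINT x:?A|lborel. ?z x powr q)"
      and "S = (LINT x:?A|lborel. ?\<theta> x ^ M * ?z x powr (q + 2))"
      and "F = (LINT x:?K|lborel. eta \<delta> R M (sqn x) * Dsq x)"
      and "G = (LINT x:?A|lborel. ?\<theta> x ^ M * Dsq x)"
    have sub: "?A \<subseteq> ?K" "?O \<subseteq> ?A" using \<delta> R2 by (auto simp: annulus_def)
    have KOm: "?K \<subseteq> Om" using \<delta> by (intro annulus_subset_Om) simp
    have AOm: "?A \<subseteq> Om" using sub KOm by blast
    have OOm: "?O \<subseteq> Om" using sub AOm by blast
    note I = set_integrable_continuous_compact[OF compact_annulus]
    have zc: "continuous_on T ?z" if "T \<subseteq> Om" for T
      using cont_v that by (intro continuous_intros) (rule continuous_on_subset)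
    have zpc: "continuous_on T (\<lambda>x. ?z x powr p)" if "0 < p" "T \<subseteq> Om" for T p
      using that by (intro continuous_on_powr' zc continuous_intros) auto
    note tc = continuous_on_theta[OF R2(2)]
    have bc: "continuous_on T ?b" for T
      by (rule continuous_on_compose2[OF continuous_on_bump[of "3 * R\<^sup>2" UNIV]])
        (use R2 in \<open>auto intro!: continuous_intros\<close>)
    have gc: "continuous_on UNIV (eta \<delta> R M)"
      by (intro continuous_at_imp_continuous_on ballI DERIV_isCont[OF DERIV_eta[OF \<delta> R M3]])
    have iF: "set_integrable lborel ?K (\<lambda>x. eta \<delta> R M (sqn x) * Dsq x)"
      by (intro I continuous_intros continuous_on_compose2[OF gc] continuous_on_subset[OF cont_Dsq KOm]) auto
    have iG: "set_integrable lborel ?A (\<lambda>x. ?\<theta> x ^ M * Dsq x)"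
      by (intro I continuous_intros tc continuous_on_subset[OF cont_Dsq AOm])
    have i1: "set_integrable lborel ?A (\<lambda>x. ?z x powr q)" using q by (intro I zpc AOm) auto
    have i2: "set_integrable lborel ?A (\<lambda>x. ?\<theta> x ^ M * ?z x powr (q + 2))"
      using q by (intro I continuous_on_mult continuous_on_power tc zpc AOm) auto
    have nn: "0 \<le> \<epsilon>" "0 \<le> S" "0 \<le> F" "0 \<le> G"
      unfolding \<epsilon>_def S_def F_def G_def
      using theta_bounds(1) eta_bounds(1)[OF \<delta> R M3] Dsq_nonneg
      by (auto simp: set_lebesgue_integral_def intro!: Bochner_Integration.integral_nonneg)
    have GF: "G \<le> F"
    proof -
      have "G = (LINT x:?K|lborel. indicator ?A x * (?\<theta> x ^ M * Dsq x))"
        unfolding G_def by (rule set_integral_indicator_subset(1)[OF sub(1), symmetric])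
      also have "\<dots> \<le> F"
        unfolding F_def
      proof (rule set_integral_mono[OF _ iF])
        show "set_integrable lborel ?K (\<lambda>x. indicator ?A x * (?\<theta> x ^ M * Dsq x))"
          using iG by (simp only: set_integral_indicator_subset(2)[OF sub(1)])
        fix x assume x: "x \<in> ?K"
        show "indicator ?A x * (?\<theta> x ^ M * Dsq x) \<le> eta \<delta> R M (sqn x) * Dsq x"
        proof (cases "x \<in> ?A")
          case True
          then have "1 + 2 * \<delta> \<le> sqn x" using R2 \<delta> by (auto simp: annulus_def)
          then have "eta \<delta> R M (sqn x) = ?b x ^ M"
            by (simp add: eta_outer[OF \<delta> R M3] cutoff_def)
          moreover have "?\<theta> x ^ M \<le> ?b x ^ M" using theta_bounds by (intro power_mono) auto
          ultimately show ?thesis using True Dsq_nonneg[of x] by (simp add: mult_right_mono)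
        qed (use eta_bounds(1)[OF \<delta> R M3] Dsq_nonneg in simp)
      qed
      finally show ?thesis .
    qed
    have S1: "S \<le> \<epsilon> * (n2 * (\<epsilon> + S) + 8 * G)"
      unfolding S_def \<epsilon>_def G_def n2_def M_def by (rule sobolev_step[OF q J R])
    have O1: "(LINT x:?O|lborel. ?b x ^ (4 * J) * sq_plus_cube x) \<le> 2 * \<epsilon> + 2 * S"
    proof -
      have iO: "set_integrable lborel ?O (\<lambda>x. ?b x ^ (4 * J) * sq_plus_cube x)"
        by (intro I continuous_intros bc continuous_on_subset[OF cont_sq_plus_cube OOm])
      have iR: "set_integrable lborel ?A (\<lambda>x. 2 * ?z x powr q + 2 * (?\<theta> x ^ M * ?z x powr (q + 2)))"
        by (intro set_integral_add set_integrable_mult_right i1 i2)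
      have "(LINT x:?O|lborel. ?b x ^ (4 * J) * sq_plus_cube x)
          = (LINT x:?A|lborel. indicator ?O x * (?b x ^ (4 * J) * sq_plus_cube x))"
        by (rule set_integral_indicator_subset(1)[OF sub(2), symmetric])
      also have "\<dots> \<le> (LINT x:?A|lborel. 2 * ?z x powr q + 2 * (?\<theta> x ^ M * ?z x powr (q + 2)))"
      proof (rule set_integral_mono[OF _ iR])
        show "set_integrable lborel ?A (\<lambda>x. indicator ?O x * (?b x ^ (4 * J) * sq_plus_cube x))"
          using iO by (simp only: set_integral_indicator_subset(2)[OF sub(2)])
        fix x assume x: "x \<in> ?A"
        show "indicator ?O x * (?b x ^ (4 * J) * sq_plus_cube x) \<le> 2 * ?z x powr q + 2 * (?\<theta> x ^ M * ?z x powr (q + 2))"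
        proof (cases "x \<in> ?O")
          case True
          then have "bump (- (R\<^sup>2)) (3 * R\<^sup>2 / 4) (- sqn x) = 1"
            using R2 by (intro bump_eq_1) (auto simp: annulus_def)
          then have tb: "?\<theta> x = ?b x" by (simp add: theta_def)
          have t: "0 \<le> ?b x" "?b x \<le> 1" using bump_bounds by auto
          have "?b x ^ (4 * J) * ?z x ^ j \<le> ?z x powr q + ?b x ^ M * ?z x powr (q + 2)"
            if "2 \<le> j" "j \<le> 3" for j
            unfolding M_def by (rule powr_interpolation[OF q J t norm_ge_zero that])
          from this[of 2] this[of 3] show ?thesis
            using True unfolding tb by (simp add: sq_plus_cube_def distrib_left)
        next
          case False
          then show ?thesis using theta_bounds(1) by simp
        qed
      qed
      also have "\<dots> = 2 * \<epsilon> + 2 * S"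
        unfolding \<epsilon>_def S_def using i1 i2
        by (simp only: set_integral_add(2)[OF set_integrable_mult_right set_integrable_mult_right] set_integral_mult_right)
      finally show ?thesis .
    qed
    have "F \<le> c1 * \<delta> + c2 * (LINT x:?O|lborel. ?b x ^ (4 * J) * sq_plus_cube x)"
      unfolding F_def c1_def c2_def by (rule energy_inequality[OF \<delta> R M_def])
    also have "\<dots> \<le> c1 * \<delta> + c2 * (2 * \<epsilon> + 2 * S)"
      using O1 c by (intro add_left_mono mult_left_mono) auto
    finally have F1: "F \<le> c1 * \<delta> + c2 * (2 * \<epsilon> + 2 * S)" .
    have eps: "\<epsilon> * (2 * n2 + 64 * c2 + 1) \<le> 1"
      using small c unfolding \<epsilon>_def[symmetric] \<epsilon>0_def by (simp add: field_simps)
    have en: "\<epsilon> * n2 \<le> 1 / 2" and ec: "\<epsilon> * c2 \<le> 1 / 64"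
    proof -
      have "0 \<le> \<epsilon> * n2" "0 \<le> \<epsilon> * c2" using nn c by auto
      then show "\<epsilon> * n2 \<le> 1 / 2" "\<epsilon> * c2 \<le> 1 / 64"
        using eps nn unfolding distrib_left by auto
    qed
    have "S \<le> (\<epsilon> * n2) * (\<epsilon> + S) + 8 * (\<epsilon> * G)" using S1 by (simp add: algebra_simps)
    also have "\<dots> \<le> 1 / 2 * (\<epsilon> + S) + 8 * (\<epsilon> * F)"
      using en nn GF by (intro add_mono mult_right_mono mult_left_mono) auto
    finally have "S \<le> \<epsilon> + 16 * (\<epsilon> * F)" by (simp add: field_simps)
    then have "c2 * S \<le> c2 * (\<epsilon> + 16 * (\<epsilon> * F))" using c by (intro mult_left_mono) auto
    also have "\<dots> = c2 * \<epsilon> + 16 * ((\<epsilon> * c2) * F)" by (simp add: algebra_simps)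
    also have "\<dots> \<le> c2 * \<epsilon> + 16 * (1 / 64 * F)"
      using ec nn by (intro add_left_mono mult_left_mono mult_right_mono) auto
    finally have "F \<le> 2 * c1 * \<delta> + 8 * (c2 * \<epsilon>)" using F1 by (simp add: algebra_simps)
    also have "\<dots> \<le> (2 * c1 + 8 * c2) * (\<delta> + \<epsilon>)"
      using c nn \<delta> by (simp add: algebra_simps)
    finally show ?thesis by (simp add: F_def \<epsilon>_def)
  qed
  show ?thesis
    by (rule exI[of _ J], rule exI[of _ "2 * c1 + 8 * c2"], rule exI[of _ \<epsilon>0])
      (use main c e0 in \<open>auto simp: M_def[symmetric]\<close>)
qed

text \<open>A positive value of Dsq would persist on a small disk and bound the dissipation from below,
  uniformly in the cut-off; but the dissipation tends to 0 as delta tends to 0 and R to infinity.\<close>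

lemma Dsq_eq_0:
  assumes q: "1 < q" "q \<le> 2" and Lq: "set_integrable lborel Om (\<lambda>x. norm (v x) powr q)"
    and x0: "x0 \<in> Om"
  shows "Dsq x0 = 0"
proof (rule ccontr)
  assume "Dsq x0 \<noteq> 0"
  then have pos: "0 < Dsq x0" using Dsq_nonneg[of x0] by simp
  define c where "c = Dsq x0 / 2"
  have c: "0 < c" "c < Dsq x0" using pos by (auto simp: c_def)
  have "open (Om \<inter> Dsq -` {c<..})"
    using continuous_on_open_vimage[OF open_Om, of Dsq] cont_Dsq by (simp add: Int_commute)
  moreover have "x0 \<in> Om \<inter> Dsq -` {c<..}" using x0 c by simp
  ultimately obtain \<rho> where \<rho>: "0 < \<rho>" "cball x0 \<rho> \<subseteq> Om \<inter> Dsq -` {c<..}"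
    unfolding open_contains_cball by blast
  let ?B = "cball x0 \<rho>"
  have ne: "?B \<noteq> {}" using \<rho> by auto
  obtain x1 where x1: "x1 \<in> ?B" "\<And>y. y \<in> ?B \<Longrightarrow> sqn x1 \<le> sqn y"
    using continuous_attains_inf[OF compact_cball ne, of sqn] continuous_on_sqn by blast
  obtain x2 where x2: "x2 \<in> ?B" "\<And>y. y \<in> ?B \<Longrightarrow> sqn y \<le> sqn x2"
    using continuous_attains_sup[OF compact_cball ne, of sqn] continuous_on_sqn by blast
  have x1s: "1 < sqn x1" using x1 \<rho> by (auto simp: one_less_sqn)
  obtain J :: nat and B \<epsilon>0 where B: "0 \<le> B" "0 < \<epsilon>0"
    and bound: "\<And>\<delta> R. 0 < \<delta> \<Longrightarrow> \<delta> \<le> 1 / 2 \<Longrightarrow> 4 \<le> R \<Longrightarrow>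
     outer_mass q R \<le> \<epsilon>0 \<Longrightarrow>
     (LINT x:annulus (1 + \<delta>) (4 * R\<^sup>2)|lborel. eta \<delta> R (4 * J + 4) (sqn x) * Dsq x)
      \<le> B * (\<delta> + outer_mass q R)"
    using dissipation_bound[OF q] by blast
  define M where "M = 4 * J + 4"
  have M3: "3 \<le> M" by (simp add: M_def)
  define \<kappa> where "\<kappa> = c * measure lborel ?B"
  have \<kappa>: "0 < \<kappa>" using c \<rho> by (simp add: \<kappa>_def content_cball_gt_0_iff)
  define b where "b = B + 1"
  have b: "0 < b" using B by (simp add: b_def)
  define e where "e = \<kappa> / (4 * b)"
  have e: "0 < e" using \<kappa> b by (simp add: e_def)
  define \<delta> where "\<delta> = min (1 / 2) (min e ((sqn x1 - 1) / 2))"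
  have \<delta>: "0 < \<delta>" "\<delta> \<le> 1 / 2" "\<delta> \<le> e" "1 + 2 * \<delta> \<le> sqn x1"
  proof -
    have "\<delta> \<le> (sqn x1 - 1) / 2" unfolding \<delta>_def by (meson min.cobounded2 order_trans)
    then show "1 + 2 * \<delta> \<le> sqn x1" by (simp add: field_simps)
  qed (use e x1s in \<open>auto simp: \<delta>_def\<close>)
  obtain R where R: "sqn x2 + 1 \<le> R" "4 \<le> R"
    and tail: "outer_mass q R \<le> min e \<epsilon>0"
    using tail_small[OF Lq, of "min e \<epsilon>0" "sqn x2 + 1"] e B by auto
  let ?K = "annulus (1 + \<delta>) (4 * R\<^sup>2)"
  have RR: "R \<le> R\<^sup>2" using R by (simp add: power2_eq_square)
  have BK: "1 + 2 * \<delta> \<le> sqn y" "sqn y \<le> R\<^sup>2" if "y \<in> ?B" for y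
    using x1(2)[OF that] x2(2)[OF that] \<delta> R RR by auto
  have sub: "?B \<subseteq> ?K" 
  proof
    fix y assume "y \<in> ?B"
    from BK[OF this] show "y \<in> ?K" using \<delta> by (auto simp: annulus_def)
  qed
  have KOm: "?K \<subseteq> Om" using \<delta> by (intro annulus_subset_Om) simp
  have gc: "continuous_on UNIV (eta \<delta> R M)"
    by (intro continuous_at_imp_continuous_on ballI DERIV_isCont[OF DERIV_eta[OF \<delta>(1,2) R(2) M3]])
  have "\<kappa> = (LINT x:?B|lborel. c)"
    by (simp add: \<kappa>_def set_lebesgue_integral_def)
  also have "\<dots> = (LINT x:?K|lborel. indicator ?B x * c)"
    by (rule set_integral_indicator_subset(1)[OF sub, symmetric])
  also have "\<dots> \<le> (LINT x:?K|lborel. eta \<delta> R M (sqn x) * Dsq x)"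
  proof (rule set_integral_mono)
    show "set_integrable lborel ?K (\<lambda>x. indicator ?B x * c)"
      by (simp only: set_integral_indicator_subset(2)[OF sub])
        (intro set_integrable_continuous_compact compact_cball continuous_intros)
    show "set_integrable lborel ?K (\<lambda>x. eta \<delta> R M (sqn x) * Dsq x)"
      by (intro set_integrable_continuous_compact compact_annulus continuous_intros
          continuous_on_compose2[OF gc] continuous_on_subset[OF cont_Dsq KOm]) auto
    fix x assume "x \<in> ?K"
    show "indicator ?B x * c \<le> eta \<delta> R M (sqn x) * Dsq x"
    proof (cases "x \<in> ?B")
      case True
      then have "eta \<delta> R M (sqn x) = 1" "c < Dsq x"
        using eta_plateau[OF \<delta>(1,2) R(2) M3 BK[OF True]] \<rho> by auto
      then show ?thesis using True by simp
    qed (use eta_bounds(1)[OF \<delta>(1,2) R(2) M3] Dsq_nonneg in simp)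
  qed
  also have "\<dots> \<le> B * (\<delta> + outer_mass q R)"
    unfolding M_def using tail by (intro bound \<delta> R) auto
  also have "\<dots> \<le> B * (e + e)" using \<delta> tail B by (intro mult_left_mono add_mono) auto
  also have "\<dots> \<le> b * (2 * e)" using e B by (simp add: b_def algebra_simps)
  also have "\<dots> = \<kappa> / 2" using b by (simp add: e_def)
  finally show False using \<kappa> by simp
qed

theorem v_eq_0:
  assumes q: "1 < q" "q \<le> 2" and Lq: "set_integrable lborel Om (\<lambda>x. norm (v x) powr q)"
    and x: "x \<in> Om"
  shows "v x = 0"
proof -
  have d: "d11 y = 0" "d12 y = 0" "d21 y = 0" "d22 y = 0" if "y \<in> Om" for y
    using Dsq_eq_0[OF q Lq that] unfolding Dsq_def by (auto simp: add_nonneg_eq_0_iff)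
  have "\<bar>v x $ i\<bar> \<le> 0 * (norm x - 1)"
    if C: "C1_grad Om (\<lambda>x. v x $ i) f1 f2" and f: "\<And>y. y \<in> Om \<Longrightarrow> f1 y = 0 \<and> f2 y = 0" for i f1 f2
  proof (rule radial_bound[OF C _ _ x])
    show "\<bar>v y $ i\<bar> \<le> C0 * (norm y - 1)" if "1 < norm y" "norm y \<le> 2" for y
      using near_v[OF that] component_le_norm_cart[of "v y" i] by linarith
  qed (use f in auto)
  from this[OF v1] this[OF v2] d have "v x $ 1 = 0" "v x $ 2 = 0" by auto
  then show ?thesis by (simp add: vec_eq_iff forall_2)
qed

end

section \<open>From the Navier-Stokes equations to the perturbation\<close>

lemma partial_deriv_cong:
  assumes "open S" "x \<in> S" "\<And>y. y \<in> S \<Longrightarrow> f y = g y"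
  shows "partial_deriv i f x = partial_deriv i g x"
proof -
  have "(f has_derivative D) (at x) \<longleftrightarrow> (g has_derivative D) (at x)" for D
    using has_derivative_transform_within_open[OF _ assms(1,2)] assms(3) by metis
  then show ?thesis by (simp add: partial_deriv_def frechet_derivative_def)
qed

lemma Ck_on_cong:
  assumes "open S" "\<And>y. y \<in> S \<Longrightarrow> f y = g y" "Ck_on k f S"
  shows "Ck_on k g S"
  using assms(2,3)
proof (induction k arbitrary: f g)
  case 0
  then show ?case by (simp cong: continuous_on_cong)
next
  case (Suc k)
  have "g differentiable_on S"
    unfolding differentiable_on_eq_differentiable_at[OF assms(1)]
  proof
    fix x assume x: "x \<in> S"
    then obtain D where "(f has_derivative D) (at x)"
      using Suc.prems(2) by (auto simp: differentiable_on_eq_differentiable_at[OF assms(1)] differentiable_def)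
    then have "(g has_derivative D) (at x)"
      by (rule has_derivative_transform_within_open[OF _ assms(1) x]) (rule Suc.prems(1))
    then show "g differentiable at x" by (auto simp: differentiable_def)
  qed
  moreover have "Ck_on k (partial_deriv i g) S" for i
  proof (rule Suc.IH)
    show "Ck_on k (partial_deriv i f) S" using Suc.prems(2) by simp
    show "partial_deriv i f y = partial_deriv i g y" if "y \<in> S" for y
      by (rule partial_deriv_cong[OF assms(1) that Suc.prems(1)])
  qed
  ultimately show ?case by simp
qed

lemma partial_deriv_component:
  assumes "open S" "f differentiable_on S" "x \<in> S"
  shows "partial_deriv i (\<lambda>y. f y $ j) x = partial_deriv i f x $ j"
proof -
  have "(f has_derivative frechet_derivative f (at x)) (at x)"
    using assms by (simp add: differentiable_on_eq_differentiable_at frechet_derivative_works[symmetric])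
  from bounded_linear.has_derivative[OF bounded_linear_vec_nth this, of j]
  have "frechet_derivative (\<lambda>y. f y $ j) (at x) = (\<lambda>d. frechet_derivative f (at x) d $ j)"
    by (rule frechet_derivative_at[symmetric])
  then show ?thesis by (simp add: partial_deriv_def)
qed

lemma Ck_on_component:
  fixes f :: "real^'n::finite \<Rightarrow> real^'m::finite"
  assumes "open S" "Ck_on k f S"
  shows "Ck_on k (\<lambda>y. f y $ j) S"
  using assms(2)
proof (induction k arbitrary: f)
  case 0
  then show ?case by (simp add: continuous_on_component)
next
  case (Suc k)
  have d: "f differentiable_on S" using Suc.prems by simp
  have "(\<lambda>y. f y $ j) differentiable_on S"
    using d unfolding differentiable_on_def differentiable_def
    using bounded_linear.has_derivative[OF bounded_linear_vec_nth[of j]] by fastforce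
  moreover have "Ck_on k (partial_deriv i (\<lambda>y. f y $ j)) S" for i
    using Suc.prems partial_deriv_component[OF assms(1) d]
    by (intro Ck_on_cong[OF assms(1) _ Suc.IH[of "partial_deriv i f"]]) auto
  ultimately show ?case by simp
qed

lemma C1_grad_partial_deriv:
  assumes "open S" "Ck_on (Suc k) f S"
  shows "C1_grad S f (partial_deriv 1 f) (partial_deriv 2 f)"
  unfolding C1_grad_def
proof (intro conjI ballI)
  have "continuous_on S f" if "Ck_on k f S" for k and f :: "real^2 \<Rightarrow> real"
    using that by (cases k) (auto intro: differentiable_imp_continuous_on)
  then show "continuous_on S (partial_deriv 1 f)" "continuous_on S (partial_deriv 2 f)"
    using assms(2) by auto
  fix x assume "x \<in> S"
  then have D: "(f has_derivative frechet_derivative f (at x)) (at x)"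
    using assms by (simp add: differentiable_on_eq_differentiable_at frechet_derivative_works[symmetric])
  then have lin: "linear (frechet_derivative f (at x))" by (rule has_derivative_linear)
  have "frechet_derivative f (at x) d = partial_deriv 1 f x * d $ 1 + partial_deriv 2 f x * d $ 2" for d
  proof -
    have "d = d $ 1 *\<^sub>R axis 1 1 + d $ 2 *\<^sub>R axis 2 1"
      by (simp add: vec_eq_iff forall_2 axis_def)
    then have "frechet_derivative f (at x) d = frechet_derivative f (at x) (d $ 1 *\<^sub>R axis 1 1 + d $ 2 *\<^sub>R axis 2 1)"
      by simp
    then show ?thesis
      by (simp add: linear_add[OF lin] linear_scale[OF lin] partial_deriv_def mult.commute)
  qed
  then show "(f has_derivative (\<lambda>d. partial_deriv 1 f x * d $ 1 + partial_deriv 2 f x * d $ 2)) (at x)"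
    by (intro has_derivative_eq_rhs[OF D]) (simp add: fun_eq_iff)
qed

lemma exterior_disk_eq: "exterior_disk = Om"
  by (auto simp: exterior_disk_def)

lemma closure_exterior_disk: "closure exterior_disk = {x. 1 \<le> norm x}"
proof -
  have "exterior_disk = - cball 0 1" by (auto simp: exterior_disk_eq)
  then show ?thesis unfolding \<open>exterior_disk = - cball 0 1\<close> closure_complement interior_cball
    by auto
qed

text \<open>The mean value theorem along the ray from the unit circle to x; continuity up to the circle
  is enough at its starting point.\<close>

lemma bounded_by_radial_distance:
  fixes f :: "real^2 \<Rightarrow> real"
  assumes C: "C1_grad Om f f1 f2" and c: "continuous_on {x. 1 \<le> norm x} f"
    and z: "\<And>x. norm x = 1 \<Longrightarrow> f x = 0"
    and b: "\<And>x. 1 < norm x \<Longrightarrow> norm x \<le> 2 \<Longrightarrow> \<bar>f1 x\<bar> \<le> B \<and> \<bar>f2 x\<bar> \<le> B"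
    and x: "1 < norm x" "norm x \<le> 2"
  shows "\<bar>f x\<bar> \<le> 2 * B * (norm x - 1)"
proof -
  define r where "r = norm x"
  have r: "1 < r" "r \<le> 2" using x by (auto simp: r_def)
  have "\<exists>t\<in>{1 / r<..<1}. f (1 *\<^sub>R x) - f ((1 / r) *\<^sub>R x)
      = (\<lambda>h. h * (f1 (t *\<^sub>R x) * x $ 1 + f2 (t *\<^sub>R x) * x $ 2)) (1 - 1 / r)" (is ?ex)
  proof (rule mvt)
    show "1 / r < 1" using r by simp
    show "continuous_on {1 / r..1} (\<lambda>t. f (t *\<^sub>R x))"
    proof (rule continuous_on_compose2[OF c])
      show "(\<lambda>t. t *\<^sub>R x) ` {1 / r..1} \<subseteq> {x. 1 \<le> norm x}"
      proof
        fix y assume "y \<in> (\<lambda>t. t *\<^sub>R x) ` {1 / r..1}"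
        then obtain t where t: "1 / r \<le> t" "y = t *\<^sub>R x" by auto
        then have "1 \<le> t * r" "0 < t" using r by (auto simp: field_simps intro: less_le_trans[of 0 "1 / r"])
        then show "y \<in> {x. 1 \<le> norm x}" using t by (simp add: r_def[symmetric])
      qed
    qed (intro continuous_intros)
    fix t assume t: "1 / r < t" "t < 1"
    then have t1: "1 < t * r" "0 < t" using r by (auto simp: field_simps intro: less_trans[of 0 "1 / r"])
    then have tx: "t *\<^sub>R x \<in> Om" by (simp add: r_def[symmetric])
    have "((\<lambda>t. t *\<^sub>R x) has_derivative (\<lambda>h. h *\<^sub>R x)) (at t)"
      by (auto intro!: derivative_eq_intros)
    from has_derivative_compose[OF this C1_gradD(1)[OF C tx]]
    show "((\<lambda>t. f (t *\<^sub>R x)) has_derivative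
        (\<lambda>h. h * (f1 (t *\<^sub>R x) * x $ 1 + f2 (t *\<^sub>R x) * x $ 2))) (at t)"
      by (rule has_derivative_eq_rhs) (simp add: algebra_simps fun_eq_iff)
  next
    fix t assume "1 / r < t" "t < 1" "f (1 *\<^sub>R x) - f ((1 / r) *\<^sub>R x)
      = (1 - 1 / r) * (f1 (t *\<^sub>R x) * x $ 1 + f2 (t *\<^sub>R x) * x $ 2)"
    then show ?ex by (intro bexI[of _ t]) auto
  qed
  then obtain t where t: "1 / r < t" "t < 1"
    and eq: "f x - f ((1 / r) *\<^sub>R x) = (1 - 1 / r) * (f1 (t *\<^sub>R x) * x $ 1 + f2 (t *\<^sub>R x) * x $ 2)"
    by auto
  have f0: "f ((1 / r) *\<^sub>R x) = 0" by (rule z) (use r in \<open>simp add: r_def[symmetric]\<close>)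
  have t1: "1 < t * r" "0 < t" using r t by (auto simp: field_simps intro: less_trans[of 0 "1 / r"])
  have "t * r \<le> 1 * 2" using t t1 r by (intro mult_mono) auto
  then have bt: "\<bar>f1 (t *\<^sub>R x)\<bar> \<le> B \<and> \<bar>f2 (t *\<^sub>R x)\<bar> \<le> B"
    using t1 by (intro b) (auto simp: r_def[symmetric])
  then have B: "0 \<le> B" using abs_ge_zero[of "f1 (t *\<^sub>R x)"] by linarith
  have "\<bar>f1 (t *\<^sub>R x) * x $ 1 + f2 (t *\<^sub>R x) * x $ 2\<bar> \<le> B * r + B * r"
  proof (rule order_trans[OF abs_triangle_ineq add_mono])
    show "\<bar>f1 (t *\<^sub>R x) * x $ 1\<bar> \<le> B * r" "\<bar>f2 (t *\<^sub>R x) * x $ 2\<bar> \<le> B * r"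
      unfolding abs_mult r_def using bt B component_le_norm_cart[of x] by (auto intro!: mult_mono)
  qed
  then have "\<bar>f x\<bar> \<le> (1 - 1 / r) * (B * r + B * r)"
    using eq f0 r by (simp add: abs_mult mult_left_mono)
  also have "\<dots> = 2 * B * (r - 1)" using r by (simp add: field_simps)
  finally show ?thesis by (simp add: r_def)
qed

lemma partial_deriv_bounded_near_disk:
  assumes "C1_closure u exterior_disk"
  shows "\<exists>B. \<forall>x. 1 < norm x \<longrightarrow> norm x \<le> 2 \<longrightarrow> norm (partial_deriv i u x) \<le> B"
proof -
  obtain g where g: "continuous_on (closure exterior_disk) g" "\<forall>x\<in>exterior_disk. g x = partial_deriv i u x"
    using assms unfolding C1_closure_def by blast
  let ?K = "{x. 1 \<le> norm x} \<inter> cball (0::real^2) 2"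
  have "compact ?K" by (intro closed_Int_compact closed_Collect_le continuous_intros compact_cball)
  then have "bounded (g ` ?K)"
    using g(1) by (intro compact_imp_bounded compact_continuous_image)
      (auto simp: closure_exterior_disk intro: continuous_on_subset)
  then obtain B where "\<forall>y\<in>g ` ?K. norm y \<le> B" unfolding bounded_iff by blast
  then have "norm (partial_deriv i u x) \<le> B" if "1 < norm x" "norm x \<le> 2" for x
    using g(2) that by (metis (no_types, lifting) Int_iff exterior_disk_eq image_eqI less_imp_le
        mem_Collect_eq mem_cball_0)
  then show ?thesis by blast
qed

theorem theorem1p1:
  fixes a q :: real
    and u :: "real^2 \<Rightarrow> real^2"
    and p :: "real^2 \<Rightarrow> real"
  assumes "smooth_on u exterior_disk"
    and "smooth_on p exterior_disk"
    and "stationary_NS_on exterior_disk u p"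
    and "C1_closure u exterior_disk"
    and "\<And>x. x \<in> frontier (ball 0 1) \<Longrightarrow> u x = rotating_flow a x"
    and "1 < q" and "q \<le> 2"
    and "in_Lq q exterior_disk (\<lambda>x. u x - rotating_flow a x)"
  shows "\<forall>x\<in>exterior_disk. u x = rotating_flow a x"
proof -
  note E = exterior_disk_eq
  define v where "v x = u x - rotating_flow a x" for x
  have rf: "rotating_flow a x $ 1 = a / 2 * x $ 2" "rotating_flow a x $ 2 = - (a / 2 * x $ 1)" for x
    by (simp_all add: rotating_flow_def)
  define D where "D i j = partial_deriv i (\<lambda>y. u y $ j)" for i j :: 2
  have Cku: "Ck_on k u Om" and Ckp: "Ck_on k p Om" for k
    using assms(1,2) by (auto simp: smooth_on_def E)
  have Ckj: "Ck_on k (\<lambda>y. u y $ j) Om" for k j by (rule Ck_on_component[OF open_Om Cku])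
  have CkD: "Ck_on k (D i j) Om" for k i j using Ckj[of "Suc k" j] by (simp add: D_def)
  have uC: "C1_grad Om (\<lambda>y. u y $ j) (D 1 j) (D 2 j)" for j
    unfolding D_def by (rule C1_grad_partial_deriv[OF open_Om Ckj])
  have DC: "C1_grad Om (D i j) (partial_deriv 1 (D i j)) (partial_deriv 2 (D i j))" for i j
    by (rule C1_grad_partial_deriv[OF open_Om CkD])
  have pC: "C1_grad Om p (partial_deriv 1 p) (partial_deriv 2 p)"
    by (rule C1_grad_partial_deriv[OF open_Om Ckp])
  define d11 d21 d12 d22 where "d11 = D 1 1" and "d21 = (\<lambda>x. D 2 1 x - a / 2)"
    and "d12 = (\<lambda>x. D 1 2 x + a / 2)" and "d22 = D 2 2"
  \<comment> \<open>The rotating flow u0 satisfies (u0.grad) u0 = - (a^2 / 4) x.\<close>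
  define P where "P x = p x - a\<^sup>2 / 8 * (x $ 1 * x $ 1 + x $ 2 * x $ 2)" for x
  have v1C: "C1_grad Om (\<lambda>x. v x $ 1) d11 d21"
    unfolding v_def vector_minus_component rf d11_def d21_def
    by (rule C1_grad_cong, (rule C1_grad_intros uC)+) auto
  have v2C: "C1_grad Om (\<lambda>x. v x $ 2) d12 d22"
    unfolding v_def vector_minus_component rf d12_def d22_def
    by (rule C1_grad_cong, (rule C1_grad_intros uC)+) auto
  have PC: "C1_grad Om P (\<lambda>x. partial_deriv 1 p x - a\<^sup>2 / 4 * x $ 1) (\<lambda>x. partial_deriv 2 p x - a\<^sup>2 / 4 * x $ 2)"
    unfolding P_def[abs_def]
    by (rule C1_grad_cong, (rule C1_grad_intros pC)+) auto
  have d21C: "C1_grad Om d21 (partial_deriv 1 (D 2 1)) (partial_deriv 2 (D 2 1))"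
    unfolding d21_def by (rule C1_grad_cong, (rule C1_grad_intros DC)+) auto
  have d12C: "C1_grad Om d12 (partial_deriv 1 (D 1 2)) (partial_deriv 2 (D 1 2))"
    unfolding d12_def by (rule C1_grad_cong, (rule C1_grad_intros DC)+) auto
  have NS: "convection u x + gradient p x = vector_laplacian u x" "divergence u x = 0" if "x \<in> Om" for x
    using assms(3) that by (auto simp: stationary_NS_on_def E)
  have NSj: "u x $ 1 * D 1 j x + u x $ 2 * D 2 j x + partial_deriv j p x
      = partial_deriv 1 (D 1 j) x + partial_deriv 2 (D 2 j) x" if "x \<in> Om" for x j
    using arg_cong[OF NS(1)[OF that], of "\<lambda>w. w $ j"]
    by (simp add: convection_def gradient_def vector_laplacian_def sum_2 D_def)
  have div: "D 1 1 x + D 2 2 x = 0" if "x \<in> Om" for x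
    using NS(2)[OF that] by (simp add: divergence_def sum_2 D_def)
  obtain B1 B2 where B1: "\<And>x. 1 < norm x \<Longrightarrow> norm x \<le> 2 \<Longrightarrow> norm (partial_deriv 1 u x) \<le> B1"
    and B2: "\<And>x. 1 < norm x \<Longrightarrow> norm x \<le> 2 \<Longrightarrow> norm (partial_deriv 2 u x) \<le> B2"
    using partial_deriv_bounded_near_disk[OF assms(4)] by metis
  define b1 b2 c where "b1 = \<bar>B1\<bar>" and "b2 = \<bar>B2\<bar>" and "c = \<bar>a\<bar>"
  have bc: "0 \<le> b1" "0 \<le> b2" "0 \<le> c" "B1 \<le> b1" "B2 \<le> b2" "\<bar>a / 2\<bar> \<le> c"
    by (simp_all add: b1_def b2_def c_def)
  define B where "B = b1 + b2 + c"
  have B: "0 \<le> B" "b1 \<le> B" "b2 \<le> B" "b1 + c \<le> B" "b2 + c \<le> B" using bc by (simp_all add: B_def)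
  have B0: "0 \<le> B" by (rule B(1))
  have udiff: "u differentiable_on Om" using Cku[of 1] by simp
  have Db: "\<bar>D 1 j x\<bar> \<le> b1" "\<bar>D 2 j x\<bar> \<le> b2" if x: "1 < norm x" "norm x \<le> 2" for x j
  proof -
    have xOm: "x \<in> Om" using x by simp
    show "\<bar>D 1 j x\<bar> \<le> b1" "\<bar>D 2 j x\<bar> \<le> b2"
      unfolding D_def partial_deriv_component[OF open_Om udiff xOm]
      using order_trans[OF component_le_norm_cart order_trans[OF B1[OF x] bc(4)]]
        order_trans[OF component_le_norm_cart order_trans[OF B2[OF x] bc(5)]] by auto
  qed
  have db: "\<bar>d11 x\<bar> \<le> B \<and> \<bar>d21 x\<bar> \<le> B" "\<bar>d12 x\<bar> \<le> B \<and> \<bar>d22 x\<bar> \<le> B"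
    if x: "1 < norm x" "norm x \<le> 2" for x
  proof -
    note D1 = Db[OF x, of 1] and D2 = Db[OF x, of 2]
    have "\<bar>d21 x\<bar> \<le> b2 + c"
      unfolding d21_def by (rule order_trans[OF abs_triangle_ineq4 add_mono[OF D1(2) bc(6)]])
    moreover have "\<bar>d12 x\<bar> \<le> b1 + c"
      unfolding d12_def by (rule order_trans[OF abs_triangle_ineq add_mono[OF D2(1) bc(6)]])
    ultimately show "\<bar>d11 x\<bar> \<le> B \<and> \<bar>d21 x\<bar> \<le> B" "\<bar>d12 x\<bar> \<le> B \<and> \<bar>d22 x\<bar> \<le> B"
      using D1(1) D2(2) B unfolding d11_def d22_def by (meson order_trans)+
  qed
  have ucl: "continuous_on {x. 1 \<le> norm x} u"
    using assms(4) by (simp add: C1_closure_def closure_exterior_disk)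
  have vcl: "continuous_on {x. 1 \<le> norm x} (\<lambda>x. v x $ j)" for j
    unfolding v_def rotating_flow_def
    by (intro continuous_on_component continuous_intros ucl)
  have v0: "v x $ j = 0" if "norm x = 1" for x j
    using assms(5)[of x] that by (simp add: v_def sphere_def)
  have vb: "\<bar>v x $ 1\<bar> \<le> 2 * B * (norm x - 1)" "\<bar>v x $ 2\<bar> \<le> 2 * B * (norm x - 1)"
    if x: "1 < norm x" "norm x \<le> 2" for x
    by (rule bounded_by_radial_distance[OF v1C vcl v0 db(1) x], assumption+)
      (rule bounded_by_radial_distance[OF v2C vcl v0 db(2) x], assumption+)
  interpret rotating_perturbation a v d11 d21 d12 d22
    "partial_deriv 1 (D 1 1)" "partial_deriv 2 (D 1 1)" "partial_deriv 1 (D 2 1)" "partial_deriv 2 (D 2 1)"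
    "partial_deriv 1 (D 1 2)" "partial_deriv 2 (D 1 2)" "partial_deriv 1 (D 2 2)" "partial_deriv 2 (D 2 2)"
    P "\<lambda>x. partial_deriv 1 p x - a\<^sup>2 / 4 * x $ 1" "\<lambda>x. partial_deriv 2 p x - a\<^sup>2 / 4 * x $ 2" "4 * B"
  proof
    show "C1_grad Om d11 (partial_deriv 1 (D 1 1)) (partial_deriv 2 (D 1 1))"
      "C1_grad Om d22 (partial_deriv 1 (D 2 2)) (partial_deriv 2 (D 2 2))"
      unfolding d11_def d22_def by (rule DC)+
    fix x :: "real^2"
    have uv: "u x $ 1 = v x $ 1 + a / 2 * x $ 2" "u x $ 2 = v x $ 2 - a / 2 * x $ 1"
      by (simp_all add: v_def rf)
    show "d11 x + d22 x = 0" if "x \<in> Om" using div[OF that] by (simp add: d11_def d22_def)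
    show "v x $ 1 * d11 x + v x $ 2 * d21 x + a / 2 * (x $ 2 * d11 x - x $ 1 * d21 x)
       + a / 2 * v x $ 2 + (partial_deriv 1 p x - a\<^sup>2 / 4 * x $ 1)
       = partial_deriv 1 (D 1 1) x + partial_deriv 2 (D 2 1) x" if "x \<in> Om"
      unfolding NSj[OF that, symmetric] uv d11_def d21_def
      by (simp add: power2_eq_square algebra_simps)
    show "v x $ 1 * d12 x + v x $ 2 * d22 x + a / 2 * (x $ 2 * d12 x - x $ 1 * d22 x)
       - a / 2 * v x $ 1 + (partial_deriv 2 p x - a\<^sup>2 / 4 * x $ 2)
       = partial_deriv 1 (D 1 2) x + partial_deriv 2 (D 2 2) x" if "x \<in> Om"
      unfolding NSj[OF that, symmetric] uv d12_def d22_def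
      by (simp add: power2_eq_square algebra_simps)
    assume x: "1 < norm x" "norm x \<le> 2"
    have "norm (v x) \<le> \<bar>v x $ 1\<bar> + \<bar>v x $ 2\<bar>"
      using norm_le_l1_cart[of "v x"] by (simp add: sum_2)
    then show "norm (v x) \<le> 4 * B * (norm x - 1)" using vb[OF x] by linarith
    show "\<bar>d11 x\<bar> \<le> 4 * B \<and> \<bar>d21 x\<bar> \<le> 4 * B \<and> \<bar>d12 x\<bar> \<le> 4 * B \<and> \<bar>d22 x\<bar> \<le> 4 * B"
      using db[OF x] B0 by auto
  qed (fact v1C v2C d21C d12C PC)+
  have Lq: "set_integrable lborel Om (\<lambda>x. norm (v x) powr q)"
  proof -
    have "set_integrable lebesgue Om (\<lambda>x. norm (v x) powr q)"
      using assms(8) by (simp add: in_Lq_def E v_def)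
    moreover
    have "(\<lambda>x. indicator Om x *\<^sub>R norm (v x) powr q) \<in> borel_measurable borel"
    proof (rule borel_measurable_continuous_on_indicator)
      show "Om \<in> sets borel" using open_Om by (rule borel_open)
      show "continuous_on Om (\<lambda>x. norm (v x) powr q)"
        using assms(6) by (intro continuous_on_powr' continuous_intros cont_v) auto
    qed
    then have "(\<lambda>x. indicator Om x *\<^sub>R norm (v x) powr q) \<in> borel_measurable lborel"
      by (simp only: measurable_lborel2)
    from integrable_completion[OF this] calculation show ?thesis
      by (simp only: set_integrable_def)
  qed
  show ?thesis
    using v_eq_0[OF assms(6,7) Lq] by (simp add: E v_def)
qed

end
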